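(* Let $k$ be a field and $R=k[x_1,\dots,x_d]$ with its standard $\mathbb{Z}^d$-grading. If $D$ is a $\mathbb{Z}^d$-graded differential $R$-module with differential of degree $\mathbf{0}$ such that $H(D)\neq 0$ and $H(D)$ is bounded in the $i$-th direction for all $1\le i\le d$, then $$\beta^R(D)\geq 2^d.$$
   Context: The standard $\mathbb{Z}^d$-grading on $R$ has $\deg(x_i)$ equal to the $i$-th standard basis vector of $\mathbb{Z}^d$. For a graded module $M$, $M(\mathbf d)_{\mathbf m}=M_{\mathbf d+\mathbf m}$. Morphisms of $\mathbb{Z}^d$-graded modules are $R$-linear maps preserving degree; complexes of $\mathbb{Z}^d$-graded modules have morphisms as differentials. A $\mathbb{Z}^d$-graded differential $R$-module with differential degree $\mathbf d\in\mathbb{Z}^d$ is a $\mathbb{Z}^d$-graded $R$-module $D$ with a morphism $\delta:D\to D(\mathbf d)$ such that $\delta\circ\delta(-\mathbf d)=0$; its homology is $H(D)=\ker\delta/\operatorname{im}(\delta(-\mathbf d))$, a $\mathbb{Z}^d$-graded $R$-module. No finite generation is assumed. A $\mathbb{Z}^d$-graded (differential) module $M$ is bounded in the $i$-th direction if there are $a,b\in\mathbb{Z}$ such that $M_{\mathbf m}=0$ whenever the $i$-th coordinate $\mathbf m_i\notin[a,b]$ (a graded module is regarded as a differential module with zero differential). For a complex $C$ of $\mathbb{Z}^d$-graded $R$-modules and a $\mathbb{Z}^d$-graded differential module $D$ of differential degree $\mathbf d$, $C\boxtimes_R D=\bigoplus_{i\in\mathbb{Z}}(C_i(-i\mathbf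 d)\otimes_R D)$, with differential $\delta(c\otimes x)=\partial^C(c)\otimes x+(-1)^i c\otimes\delta^D(x)$ for $c\otimes x\in C_i(-i\mathbf d)\otimes_R D$; it is a differential module of differential degree $\mathbf d$. For a $\mathbb{Z}^d$-graded $R$-module $M$, $\operatorname{Tor}^R(M,D)=H(P\boxtimes_R D)$ where $P$ is a $\mathbb{Z}^d$-graded free resolution of $M$ (independent of $P$ up to isomorphism). The Betti number is $\beta^R(D)=\dim_k\operatorname{Tor}^R(k,D)$, where $k=R/(x_1,\dots,x_d)$; it may be infinite. *)

theory Defs
  imports
    "HOL-Algebra.Module"
    "HOL-Algebra.Ideal"
    "HOL-Algebra.Generated_Groups"
    "HOL-Library.Poly_Mapping"
    "HOL-Library.Extended_Nat"
    "HOL-Library.FuncSet"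
begin

section \<open>Modules over a commutative ring\<close>

definition mod_hom ::
  "('r, 'y) ring_scheme \<Rightarrow> ('r, 'a, 'u) module_scheme \<Rightarrow> ('r, 'b, 'v) module_scheme
     \<Rightarrow> ('a \<Rightarrow> 'b) set" where
  "mod_hom R M N = {h. h \<in> carrier M \<rightarrow> carrier N
     \<and> (\<forall>x\<in>carrier M. \<forall>y\<in>carrier M. h (x \<oplus>\<^bsub>M\<^esub> y) = h x \<oplus>\<^bsub>N\<^esub> h y)
     \<and> (\<forall>r\<in>carrier R. \<forall>x\<in>carrier M. h (r \<odot>\<^bsub>M\<^esub> x) = r \<odot>\<^bsub>N\<^esub> h x)}"

definition module_basis ::
  "('r, 'y) ring_scheme \<Rightarrow> ('r, 'a, 'u) module_scheme \<Rightarrow> 'a set \<Rightarrow> bool" where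
  "module_basis R M B \<longleftrightarrow> B \<subseteq> carrier M
     \<and> (\<forall>x\<in>carrier M. \<exists>!f. (\<forall>b\<in>B. f b \<in> carrier R) \<and> (\<forall>b. b \<notin> B \<longrightarrow> f b = \<zero>\<^bsub>R\<^esub>)
          \<and> finite {b. f b \<noteq> \<zero>\<^bsub>R\<^esub>}
          \<and> x = (\<Oplus>\<^bsub>M\<^esub>b\<in>{b. f b \<noteq> \<zero>\<^bsub>R\<^esub>}. f b \<odot>\<^bsub>M\<^esub> b))"

text \<open>The dimension of a vector space is the number of elements of a finite basis, and
  \<open>\<infinity>\<close> (the infimum of the empty set) if there is no finite basis. All finite bases
  have the same number of elements, so the infimum involves no choice.\<close>

definition vs_dim :: "('r, 'y) ring_scheme \<Rightarrow> ('r, 'a, 'u) module_scheme \<Rightarrow> enat" where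
  "vs_dim K V = (INF B\<in>{B. finite B \<and> module_basis K V B}. enat (card B))"

definition gen_submodule ::
  "('r, 'y) ring_scheme \<Rightarrow> ('r, 'a, 'u) module_scheme \<Rightarrow> 'a set \<Rightarrow> 'a set" where
  "gen_submodule R M S = \<Inter>{N. submodule N R M \<and> S \<subseteq> N}"

definition quotient_module ::
  "('r, 'a, 'u) module_scheme \<Rightarrow> 'a set \<Rightarrow> ('r, 'a set) module" where
  "quotient_module M N =
     \<lparr> carrier = a_rcosets\<^bsub>M\<^esub> N, monoid.mult = undefined, one = undefined,
       zero = N, add = (\<lambda>X Y. X <+>\<^bsub>M\<^esub> Y),
       smult = (\<lambda>r X. \<Union>x\<in>X. N +>\<^bsub>M\<^esub> (r \<odot>\<^bsub>M\<^esub> x)) \<rparr>"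

definition free_module :: "('r, 'y) ring_scheme \<Rightarrow> 's set \<Rightarrow> ('r, 's \<Rightarrow> 'r) module" where
  "free_module R S =
     \<lparr> carrier = {f. (\<forall>s\<in>S. f s \<in> carrier R) \<and> (\<forall>s. s \<notin> S \<longrightarrow> f s = \<zero>\<^bsub>R\<^esub>)
                    \<and> finite {s. f s \<noteq> \<zero>\<^bsub>R\<^esub>}},
       monoid.mult = undefined, one = undefined,
       zero = (\<lambda>s. \<zero>\<^bsub>R\<^esub>), add = (\<lambda>f g s. f s \<oplus>\<^bsub>R\<^esub> g s),
       smult = (\<lambda>r f s. r \<otimes>\<^bsub>R\<^esub> f s) \<rparr>"

definition free_gen :: "('r, 'y) ring_scheme \<Rightarrow> 's \<Rightarrow> 's \<Rightarrow> 'r" where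
  "free_gen R s = (\<lambda>t. if t = s then \<one>\<^bsub>R\<^esub> else \<zero>\<^bsub>R\<^esub>)"

text \<open>The tensor product is the free module on the set of pairs modulo the relations of
  bilinearity.\<close>

definition tensor_free ::
  "('r, 'y) ring_scheme \<Rightarrow> ('r, 'a, 'u) module_scheme \<Rightarrow> ('r, 'b, 'v) module_scheme
     \<Rightarrow> ('r, 'a \<times> 'b \<Rightarrow> 'r) module" where
  "tensor_free R M N = free_module R (carrier M \<times> carrier N)"

definition tensor_rel ::
  "('r, 'y) ring_scheme \<Rightarrow> ('r, 'a, 'u) module_scheme \<Rightarrow> ('r, 'b, 'v) module_scheme
     \<Rightarrow> ('a \<times> 'b \<Rightarrow> 'r) set" where
  "tensor_rel R M N = (let F = tensor_free R M N; e = (\<lambda>x y. free_gen R (x, y)) in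
     gen_submodule R F
       ({e (x \<oplus>\<^bsub>M\<^esub> x') y \<ominus>\<^bsub>F\<^esub> (e x y \<oplus>\<^bsub>F\<^esub> e x' y) |
           x x' y. x \<in> carrier M \<and> x' \<in> carrier M \<and> y \<in> carrier N}
      \<union> {e x (y \<oplus>\<^bsub>N\<^esub> y') \<ominus>\<^bsub>F\<^esub> (e x y \<oplus>\<^bsub>F\<^esub> e x y') |
           x y y'. x \<in> carrier M \<and> y \<in> carrier N \<and> y' \<in> carrier N}
      \<union> {e (r \<odot>\<^bsub>M\<^esub> x) y \<ominus>\<^bsub>F\<^esub> r \<odot>\<^bsub>F\<^esub> e x y |
           r x y. r \<in> carrier R \<and> x \<in> carrier M \<and> y \<in> carrier N}
      \<union> {e x (r \<odot>\<^bsub>N\<^esub> y) \<ominus>\<^bsub>F\<^esub> r \<odot>\<^bsub>F\<^esub> e x y |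
           r x y. r \<in> carrier R \<and> x \<in> carrier M \<and> y \<in> carrier N}))"

definition tensor_module ::
  "('r, 'y) ring_scheme \<Rightarrow> ('r, 'a, 'u) module_scheme \<Rightarrow> ('r, 'b, 'v) module_scheme
     \<Rightarrow> ('r, ('a \<times> 'b \<Rightarrow> 'r) set) module" where
  "tensor_module R M N = quotient_module (tensor_free R M N) (tensor_rel R M N)"

definition pure_tensor ::
  "('r, 'y) ring_scheme \<Rightarrow> ('r, 'a, 'u) module_scheme \<Rightarrow> ('r, 'b, 'v) module_scheme
     \<Rightarrow> 'a \<Rightarrow> 'b \<Rightarrow> ('a \<times> 'b \<Rightarrow> 'r) set" where
  "pure_tensor R M N x y = tensor_rel R M N +>\<^bsub>tensor_free R M N\<^esub> free_gen R (x, y)"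

text \<open>For linear maps \<open>f : M \<rightarrow> M'\<close> and \<open>g : N \<rightarrow> N'\<close>, the map \<open>f \<otimes> g\<close> is the unique linear
  map with \<open>x \<otimes> y \<mapsto> f x \<otimes> g y\<close>; \<^const>\<open>extensional\<close> fixes its values outside the carrier.\<close>

definition tensor_map ::
  "('r, 'y) ring_scheme \<Rightarrow> ('r, 'a, 'u) module_scheme \<Rightarrow> ('r, 'b, 'v) module_scheme
     \<Rightarrow> ('r, 'c, 'w) module_scheme \<Rightarrow> ('r, 'e, 'z) module_scheme \<Rightarrow> ('a \<Rightarrow> 'c) \<Rightarrow> ('b \<Rightarrow> 'e)
     \<Rightarrow> ('a \<times> 'b \<Rightarrow> 'r) set \<Rightarrow> ('c \<times> 'e \<Rightarrow> 'r) set" where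
  "tensor_map R M N M' N' f g =
     (THE h. h \<in> mod_hom R (tensor_module R M N) (tensor_module R M' N')
        \<and> h \<in> extensional (carrier (tensor_module R M N))
        \<and> (\<forall>x\<in>carrier M. \<forall>y\<in>carrier N.
              h (pure_tensor R M N x y) = pure_tensor R M' N' (f x) (g y)))"

section \<open>The polynomial ring\<close>

text \<open>A multidegree in \<open>\<int>\<^sup>d\<close> is a finitely supported function supported in \<open>{..<d}\<close>: the
  variables are \<open>x\<^sub>0, \<dots>, x\<^sub>d\<^sub>-\<^sub>1\<close>.\<close>

type_synonym mdeg = "nat \<Rightarrow>\<^sub>0 int"

type_synonym 'k mpol = "(nat \<Rightarrow>\<^sub>0 nat) \<Rightarrow>\<^sub>0 'k"

definition mdegs :: "nat \<Rightarrow> mdeg set" where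
  "mdegs d = {m. Poly_Mapping.keys m \<subseteq> {..<d}}"

definition mpoly_ring :: "nat \<Rightarrow> 'k::field mpol ring" where
  "mpoly_ring d =
     \<lparr> carrier = {p. \<forall>a\<in>Poly_Mapping.keys p. Poly_Mapping.keys a \<subseteq> {..<d}},
       monoid.mult = (*), one = 1, zero = 0, add = (+) \<rparr>"

definition mpoly_var :: "nat \<Rightarrow> 'k::field mpol" where
  "mpoly_var i = Poly_Mapping.single (Poly_Mapping.single i 1) 1"

definition field_ring :: "'k::field ring" where
  "field_ring = \<lparr> carrier = UNIV, monoid.mult = (*), one = 1, zero = 0, add = (+) \<rparr>"

definition restrict_to_field ::
  "('k::field mpol, 'a, 'u) module_scheme \<Rightarrow> ('k, 'a) module" where
  "restrict_to_field M =
     \<lparr> carrier = carrier M, monoid.mult = undefined, one = undefined,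
       zero = \<zero>\<^bsub>M\<^esub>, add = (\<lambda>x y. x \<oplus>\<^bsub>M\<^esub> y),
       smult = (\<lambda>c x. Poly_Mapping.single 0 c \<odot>\<^bsub>M\<^esub> x) \<rparr>"

section \<open>Graded modules and complexes\<close>

record ('r, 'a) graded_module = "('r, 'a) module" +
  hcomp :: "mdeg \<Rightarrow> 'a set"

definition with_grading ::
  "('r, 'a) module \<Rightarrow> (mdeg \<Rightarrow> 'a set) \<Rightarrow> ('r, 'a) graded_module" where
  "with_grading M c = module.extend M (graded_module.fields c)"

text \<open>The values of \<^const>\<open>hcomp\<close> outside \<^term>\<open>mdegs d\<close> are irrelevant throughout.\<close>

locale graded_module = Module.module "mpoly_ring d" M
  for d :: nat and M :: "('k::field mpol, 'a, 'u) graded_module_scheme" (structure) +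
  assumes hcomp_subgroup: "m \<in> mdegs d \<Longrightarrow> subgroup (hcomp M m) (add_monoid M)"
    and hcomp_direct_sum: "x \<in> carrier M \<Longrightarrow>
      \<exists>!f. (\<forall>m\<in>mdegs d. f m \<in> hcomp M m) \<and> (\<forall>m. m \<notin> mdegs d \<longrightarrow> f m = \<zero>\<^bsub>M\<^esub>)
         \<and> finite {m. f m \<noteq> \<zero>\<^bsub>M\<^esub>} \<and> x = (\<Oplus>\<^bsub>M\<^esub>m\<in>{m. f m \<noteq> \<zero>\<^bsub>M\<^esub>}. f m)"
    and hcomp_smult: "\<lbrakk> Poly_Mapping.keys a \<subseteq> {..<d}; m \<in> mdegs d; x \<in> hcomp M m \<rbrakk> \<Longrightarrow>
      Poly_Mapping.single a c \<odot>\<^bsub>M\<^esub> x \<in> hcomp M (Poly_Mapping.map int a + m)"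

definition shift ::
  "mdeg \<Rightarrow> ('r, 'a, 'u) graded_module_scheme \<Rightarrow> ('r, 'a, 'u) graded_module_scheme" where
  "shift e M = M\<lparr>hcomp := (\<lambda>m. hcomp M (e + m))\<rparr>"

definition graded_hom ::
  "nat \<Rightarrow> ('k::field mpol, 'a, 'u) graded_module_scheme
     \<Rightarrow> ('k mpol, 'b, 'v) graded_module_scheme \<Rightarrow> ('a \<Rightarrow> 'b) set" where
  "graded_hom d M N =
     {h \<in> mod_hom (mpoly_ring d) M N. \<forall>m\<in>mdegs d. h ` hcomp M m \<subseteq> hcomp N m}"

definition graded_quotient ::
  "('r, 'a, 'u) graded_module_scheme \<Rightarrow> 'a set \<Rightarrow> ('r, 'a set) graded_module" where
  "graded_quotient M N =
     with_grading (quotient_module M N) (\<lambda>m. (\<lambda>x. N +>\<^bsub>M\<^esub> x) ` hcomp M m)"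

definition graded_tensor ::
  "nat \<Rightarrow> ('k::field mpol, 'a, 'u) graded_module_scheme
     \<Rightarrow> ('k mpol, 'b, 'v) graded_module_scheme
     \<Rightarrow> ('k mpol, ('a \<times> 'b \<Rightarrow> 'k mpol) set) graded_module" where
  "graded_tensor d M N = with_grading (tensor_module (mpoly_ring d) M N)
     (\<lambda>m. generate (add_monoid (tensor_module (mpoly_ring d) M N))
        {pure_tensor (mpoly_ring d) M N x y | x y a b.
           a \<in> mdegs d \<and> b \<in> mdegs d \<and> a + b = m \<and> x \<in> hcomp M a \<and> y \<in> hcomp N b})"

definition graded_free :: "nat \<Rightarrow> ('k::field mpol, 'a, 'u) graded_module_scheme \<Rightarrow> bool" where
  "graded_free d M \<longleftrightarrow>
     (\<exists>B. module_basis (mpoly_ring d) M B \<and> B \<subseteq> (\<Union>m\<in>mdegs d. hcomp M m))"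

text \<open>\<open>R\<close> as a graded module over itself and the residue field \<open>k = R/(x\<^sub>0, \<dots>, x\<^sub>d\<^sub>-\<^sub>1)\<close>.\<close>

definition poly_module :: "nat \<Rightarrow> ('k::field mpol, 'k mpol) graded_module" where
  "poly_module d =
     \<lparr> carrier = carrier (mpoly_ring d), monoid.mult = (*), one = 1, zero = 0, add = (+),
       smult = (*),
       hcomp = (\<lambda>m. {p \<in> carrier (mpoly_ring d).
                       \<forall>a\<in>Poly_Mapping.keys p. Poly_Mapping.map int a = m}) \<rparr>"

definition residue_module :: "nat \<Rightarrow> ('k::field mpol, 'k mpol set) graded_module" where
  "residue_module d = graded_quotient (poly_module d) (Idl\<^bsub>mpoly_ring d\<^esub> (mpoly_var ` {..<d}))"

record ('r, 'a) graded_complex =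
  cobj :: "int \<Rightarrow> ('r, 'a) graded_module"
  cdiff :: "int \<Rightarrow> 'a \<Rightarrow> 'a"

locale graded_complex =
  fixes d :: nat and C :: "('k::field mpol, 'a) graded_complex"
  assumes cobj_graded: "graded_module d (cobj C i)"
    and cdiff_hom: "cdiff C i \<in> graded_hom d (cobj C i) (cobj C (i - 1))"
    and cdiff_cdiff: "x \<in> carrier (cobj C i) \<Longrightarrow>
      cdiff C (i - 1) (cdiff C i x) = \<zero>\<^bsub>cobj C (i - 2)\<^esub>"

locale graded_free_resolution = graded_complex d P
  for d :: nat and P :: "('k::field mpol, 'a) graded_complex"
    and M :: "('k mpol, 'b, 'v) graded_module_scheme" +
  assumes cobj_neg: "i < 0 \<Longrightarrow> carrier (cobj P i) = {\<zero>\<^bsub>cobj P i\<^esub>}"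
    and cobj_free: "i \<ge> 0 \<Longrightarrow> graded_free d (cobj P i)"
    and exact: "i \<ge> 1 \<Longrightarrow>
      {x \<in> carrier (cobj P i). cdiff P i x = \<zero>\<^bsub>cobj P (i - 1)\<^esub>}
        = cdiff P (i + 1) ` carrier (cobj P (i + 1))"
    and augmentation: "\<exists>\<epsilon>\<in>graded_hom d (cobj P 0) M.
      \<epsilon> ` carrier (cobj P 0) = carrier M
      \<and> {x \<in> carrier (cobj P 0). \<epsilon> x = \<zero>\<^bsub>M\<^esub>} = cdiff P 1 ` carrier (cobj P 1)"

section \<open>Differential modules\<close>

record ('r, 'a) graded_diff_module = "('r, 'a) graded_module" +
  ddeg :: mdeg
  dmap :: "'a \<Rightarrow> 'a"

locale graded_diff_module = graded_module d D
  for d :: nat and D :: "('k::field mpol, 'a, 'u) graded_diff_module_scheme" (structure) +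
  assumes ddeg_mdegs: "ddeg D \<in> mdegs d"
    and dmap_hom: "dmap D \<in> graded_hom d D (shift (ddeg D) D)"
    and dmap_dmap: "x \<in> carrier D \<Longrightarrow> dmap D (dmap D x) = \<zero>\<^bsub>D\<^esub>"

definition dker :: "('r, 'a, 'u) graded_diff_module_scheme \<Rightarrow> 'a set" where
  "dker D = {x \<in> carrier D. dmap D x = \<zero>\<^bsub>D\<^esub>}"

definition homology ::
  "('r, 'a, 'u) graded_diff_module_scheme \<Rightarrow> ('r, 'a set) graded_module" where
  "homology D = graded_quotient
     (D\<lparr>carrier := dker D, hcomp := (\<lambda>m. hcomp D m \<inter> dker D)\<rparr>) (dmap D ` carrier D)"

definition bounded_in_direction ::
  "nat \<Rightarrow> ('r, 'a, 'u) graded_module_scheme \<Rightarrow> nat \<Rightarrow> bool" where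
  "bounded_in_direction d M i \<longleftrightarrow>
     (\<exists>a b :: int. \<forall>m\<in>mdegs d. Poly_Mapping.lookup m i \<notin> {a..b} \<longrightarrow> hcomp M m = {\<zero>\<^bsub>M\<^esub>})"

text \<open>The box product of a complex and a differential module. Its elements are the families
  \<open>u\<close> of finite support with \<open>u i\<close> in the \<open>i\<close>-th summand. An element \<open>c \<otimes> x\<close> of the summand
  with index \<open>i\<close> is sent to \<open>\<partial> c \<otimes> x\<close> in the summand with index \<open>i - 1\<close> plus
  \<open>(-1)\<^sup>i c \<otimes> \<delta> x\<close> in the summand with index \<open>i\<close>. The twist affects only the grading, and it is
  trivial for a differential of degree \<open>0\<close>.\<close>

definition box_summand ::
  "nat \<Rightarrow> ('k::field mpol, 'a) graded_complex \<Rightarrow> ('k mpol, 'b, 'v) graded_diff_module_scheme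
     \<Rightarrow> int \<Rightarrow> ('k mpol, ('a \<times> 'b \<Rightarrow> 'k mpol) set) graded_module" where
  "box_summand d C D i =
     graded_tensor d (shift (Poly_Mapping.map (\<lambda>z. - i * z) (ddeg D)) (cobj C i)) D"

definition box_map ::
  "nat \<Rightarrow> ('k::field mpol, 'a) graded_complex \<Rightarrow> ('k mpol, 'b, 'v) graded_diff_module_scheme
     \<Rightarrow> (int \<Rightarrow> ('a \<times> 'b \<Rightarrow> 'k mpol) set) \<Rightarrow> int \<Rightarrow> ('a \<times> 'b \<Rightarrow> 'k mpol) set" where
  "box_map d C D u j =
     (let R = mpoly_ring d;
          v = tensor_map R (cobj C (j + 1)) D (cobj C j) D (cdiff C (j + 1)) (\<lambda>x. x) (u (j + 1));
          w = tensor_map R (cobj C j) D (cobj C j) D (\<lambda>c. c) (dmap D) (u j)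
      in v \<oplus>\<^bsub>box_summand d C D j\<^esub> (if even j then w else \<ominus>\<^bsub>box_summand d C D j\<^esub> w))"

definition box ::
  "nat \<Rightarrow> ('k::field mpol, 'a) graded_complex \<Rightarrow> ('k mpol, 'b, 'v) graded_diff_module_scheme
     \<Rightarrow> ('k mpol, int \<Rightarrow> ('a \<times> 'b \<Rightarrow> 'k mpol) set) graded_diff_module" where
  "box d C D = (let T = box_summand d C D;
                    S = {u. (\<forall>i. u i \<in> carrier (T i)) \<and> finite {i. u i \<noteq> \<zero>\<^bsub>T i\<^esub>}} in
     \<lparr> carrier = S, monoid.mult = undefined, one = undefined,
       zero = (\<lambda>i. \<zero>\<^bsub>T i\<^esub>), add = (\<lambda>u v i. u i \<oplus>\<^bsub>T i\<^esub> v i),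
       smult = (\<lambda>r u i. r \<odot>\<^bsub>T i\<^esub> u i),
       hcomp = (\<lambda>m. {u \<in> S. \<forall>i. u i \<in> hcomp (T i) m}),
       ddeg = ddeg D, dmap = box_map d C D \<rparr>)"

text \<open>\<open>Tor\<^sup>R(M, D)\<close> and \<open>\<beta>\<^sup>R(D)\<close>, computed from a graded free resolution \<open>P\<close> of \<open>M\<close>
  and of the residue field, respectively.\<close>

definition Tor ::
  "nat \<Rightarrow> ('k::field mpol, 'a) graded_complex \<Rightarrow> ('k mpol, 'b, 'v) graded_diff_module_scheme
     \<Rightarrow> ('k mpol, (int \<Rightarrow> ('a \<times> 'b \<Rightarrow> 'k mpol) set) set) graded_module" where
  "Tor d P D = homology (box d P D)"

definition betti ::
  "nat \<Rightarrow> ('k::field mpol, 'a) graded_complex \<Rightarrow> ('k mpol, 'b, 'v) graded_diff_module_scheme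
     \<Rightarrow> enat" where
  "betti d P D = vs_dim field_ring (restrict_to_field (Tor d P D))"

end

theory Submission
  imports Defs
begin

text \<open>
  Let \<open>K\<close> be the Koszul complex on the variables. As \<open>K\<close> and \<open>P\<close> both resolve \<open>k\<close>, there are chain maps
  \<open>f : K \<rightarrow> P\<close> and \<open>g : P \<rightarrow> K\<close> and a homotopy between \<open>g f\<close> and the identity of \<open>K\<close>, so the
  homology of \<open>K \<boxtimes> D\<close> embeds linearly into \<open>Tor(k, D)\<close>. Neither the flatness of \<open>D\<close> nor the grading of
  \<open>f\<close> and \<open>g\<close> matters here, since independence is tested in \<open>K \<boxtimes> D\<close>, where classes of distinct
  degrees are independent.

  Adjoining the variable \<open>x\<^sub>j\<close> replaces a differential module by the cone of the multiplication by \<open>x\<^sub>j\<close>.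
  As the differential has degree \<open>0\<close>, this works degree by degree: if the homology is nonzero in exactly
  one of the degrees \<open>m\<close> and \<open>m - e\<^sub>j\<close>, then the homology of the cone is nonzero in degree \<open>m\<close>. So the
  lowest slice of the support in direction \<open>j\<close> and the translate by \<open>e\<^sub>j\<close> of the highest one survive, the
  number of degrees doubles with each variable, and the homology of \<open>K \<boxtimes> D\<close> lives in at least \<open>2\<^sup>d\<close> degrees.
\<close>

text \<open>The resolution \<open>P\<close> in the statement is arbitrary, so the Koszul complex
  cannot simply be chosen in its place; that is why a comparison is needed. A lower bound asks only
  for injectivity from the Koszul side, hence for one homotopy instead of two.

  The Koszul complex is free with one basis element for each set of variables. Therefore its tensor
  product with \<open>D\<close> is modelled by families of elements of \<open>D\<close> indexed by
  sets of variables; the complexes on fewer variables are the families that vanish on all other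
  sets, and one differential serves them all. Genuine tensor products remain only on the side of
  \<open>P\<close>.

  Since nothing is finitely generated, homogeneous components may have infinite dimension and no
  rank or Euler characteristic is available. Hence only the vanishing or nonvanishing of each
  component is recorded. Boundedness supplies the extreme values of a coordinate, and adjoining a
  variable moves only its own coordinate, so the extreme values in the directions still to come are
  preserved.\<close>

section \<open>Linear maps between modules\<close>

lemma mod_homI:
  assumes "\<And>x. x \<in> carrier M \<Longrightarrow> h x \<in> carrier N"
    and "\<And>x y. \<lbrakk>x \<in> carrier M; y \<in> carrier M\<rbrakk> \<Longrightarrow> h (x \<oplus>\<^bsub>M\<^esub> y) = h x \<oplus>\<^bsub>N\<^esub> h y"
    and "\<And>r x. \<lbrakk>r \<in> carrier R; x \<in> carrier M\<rbrakk> \<Longrightarrow> h (r \<odot>\<^bsub>M\<^esub> x) = r \<odot>\<^bsub>N\<^esub> h x"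
  shows "h \<in> mod_hom R M N"
  using assms by (auto simp: mod_hom_def)

lemma mod_homD:
  assumes "h \<in> mod_hom R M N"
  shows "x \<in> carrier M \<Longrightarrow> h x \<in> carrier N"
    and "\<lbrakk>x \<in> carrier M; y \<in> carrier M\<rbrakk> \<Longrightarrow> h (x \<oplus>\<^bsub>M\<^esub> y) = h x \<oplus>\<^bsub>N\<^esub> h y"
    and "\<lbrakk>r \<in> carrier R; x \<in> carrier M\<rbrakk> \<Longrightarrow> h (r \<odot>\<^bsub>M\<^esub> x) = r \<odot>\<^bsub>N\<^esub> h x"
  using assms by (auto simp: mod_hom_def)

lemma mod_hom_comp:
  assumes "h \<in> mod_hom R M N" "g \<in> mod_hom R N Q"
  shows "(\<lambda>x. g (h x)) \<in> mod_hom R M Q"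
  using assms by (auto intro!: mod_homI simp: mod_homD)

lemma mod_hom_id: "(\<lambda>x. x) \<in> mod_hom R M M"
  by (auto simp: mod_hom_def)

context
  fixes R :: "('r, 'y) ring_scheme" (structure)
    and M :: "('r, 'a, 'u) module_scheme" and N :: "('r, 'b, 'v) module_scheme"
  assumes M: "Module.module R M" and N: "Module.module R N"
begin

interpretation M: Module.module R M by (fact M)
interpretation N: Module.module R N by (fact N)

lemma mod_hom_abelian_group_hom:
  assumes "h \<in> mod_hom R M N"
  shows "abelian_group_hom M N h"
  by (intro abelian_group_homI group_hom.intro group_hom_axioms.intro homI M.abelian_group_axioms
      N.abelian_group_axioms M.add.is_group N.add.is_group)
    (use assms in \<open>auto simp: mod_hom_def\<close>)

lemma mod_hom_zero: "h \<in> mod_hom R M N \<Longrightarrow> h \<zero>\<^bsub>M\<^esub> = \<zero>\<^bsub>N\<^esub>"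
  by (rule abelian_group_hom.hom_zero[OF mod_hom_abelian_group_hom])

lemma mod_hom_a_inv: "\<lbrakk>h \<in> mod_hom R M N; x \<in> carrier M\<rbrakk> \<Longrightarrow> h (\<ominus>\<^bsub>M\<^esub> x) = \<ominus>\<^bsub>N\<^esub> h x"
  by (rule abelian_group_hom.hom_a_inv[OF mod_hom_abelian_group_hom])

lemma mod_hom_minus:
  "\<lbrakk>h \<in> mod_hom R M N; x \<in> carrier M; y \<in> carrier M\<rbrakk> \<Longrightarrow> h (x \<ominus>\<^bsub>M\<^esub> y) = h x \<ominus>\<^bsub>N\<^esub> h y"
  by (simp add: a_minus_def mod_homD mod_hom_a_inv)

lemma mod_hom_finsum:
  assumes h: "h \<in> mod_hom R M N" and f: "f \<in> A \<rightarrow> carrier M"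
  shows "h (\<Oplus>\<^bsub>M\<^esub>a\<in>A. f a) = (\<Oplus>\<^bsub>N\<^esub>a\<in>A. h (f a))"
proof (cases "finite A")
  case True
  then show ?thesis using f
  proof (induction A rule: finite_induct)
    case empty
    then show ?case using h by (simp add: mod_hom_zero)
  next
    case (insert a A)
    then have "(\<lambda>a. h (f a)) \<in> A \<rightarrow> carrier N" "h (f a) \<in> carrier N"
      using h by (auto simp: Pi_iff mod_homD)
    with insert show ?case by (auto simp: mod_homD[OF h])
  qed
next
  case False
  then show ?thesis using h by (simp add: mod_hom_zero M.finsum_infinite N.finsum_infinite)
qed

lemma mod_hom_zero_map: "(\<lambda>_. \<zero>\<^bsub>N\<^esub>) \<in> mod_hom R M N"
  by (auto simp: mod_hom_def)

lemma mod_hom_add: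
  assumes "g \<in> mod_hom R M N" "h \<in> mod_hom R M N"
  shows "(\<lambda>x. g x \<oplus>\<^bsub>N\<^esub> h x) \<in> mod_hom R M N"
  using assms by (auto intro!: mod_homI simp: mod_homD N.add.m_ac N.smult_r_distr)

lemma mod_hom_uminus:
  assumes "h \<in> mod_hom R M N"
  shows "(\<lambda>x. \<ominus>\<^bsub>N\<^esub> h x) \<in> mod_hom R M N"
  using assms by (auto intro!: mod_homI simp: mod_homD N.minus_add N.smult_r_minus)

lemma mod_hom_diff:
  assumes "g \<in> mod_hom R M N" "h \<in> mod_hom R M N"
  shows "(\<lambda>x. g x \<ominus>\<^bsub>N\<^esub> h x) \<in> mod_hom R M N"
  unfolding a_minus_def by (intro mod_hom_add mod_hom_uminus assms)

lemma mod_hom_finsum_maps: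
  assumes "\<And>a. a \<in> A \<Longrightarrow> h a \<in> mod_hom R M N" "finite A"
  shows "(\<lambda>x. \<Oplus>\<^bsub>N\<^esub>a\<in>A. h a x) \<in> mod_hom R M N"
proof (rule mod_homI)
  fix x y assume "x \<in> carrier M" "y \<in> carrier M"
  then show "(\<Oplus>\<^bsub>N\<^esub>a\<in>A. h a (x \<oplus>\<^bsub>M\<^esub> y)) = (\<Oplus>\<^bsub>N\<^esub>a\<in>A. h a x) \<oplus>\<^bsub>N\<^esub> (\<Oplus>\<^bsub>N\<^esub>a\<in>A. h a y)"
    using N.finsum_addf[of "\<lambda>a. h a x" A "\<lambda>a. h a y"]
    by (auto simp: mod_homD[OF assms(1)] Pi_iff cong: N.finsum_cong)
next
  fix r x assume "r \<in> carrier R" "x \<in> carrier M"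
  then show "(\<Oplus>\<^bsub>N\<^esub>a\<in>A. h a (r \<odot>\<^bsub>M\<^esub> x)) = r \<odot>\<^bsub>N\<^esub> (\<Oplus>\<^bsub>N\<^esub>a\<in>A. h a x)"
    using assms(2)
    by (subst N.finsum_smult_ldistr) (auto intro!: N.finsum_cong' simp: mod_homD[OF assms(1)])
qed (auto intro!: N.finsum_closed simp: mod_homD[OF assms(1)])

lemma mod_hom_image_submodule:
  assumes h: "h \<in> mod_hom R M N"
  shows "submodule (h ` carrier M) R N"
proof (rule N.submoduleI)
  show "\<ominus>\<^bsub>N\<^esub> a \<in> h ` carrier M" if "a \<in> h ` carrier M" for a
    using that by (auto simp flip: mod_hom_a_inv[OF h])
qed (auto simp: mod_homD[OF h] simp flip: mod_homD(2,3)[OF h] mod_hom_zero[OF h])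

lemma mod_hom_kernel_submodule:
  assumes h: "h \<in> mod_hom R M N"
  shows "submodule {x \<in> carrier M. h x = \<zero>\<^bsub>N\<^esub>} R M"
  by (rule M.submoduleI) (auto simp: mod_homD[OF h] mod_hom_zero[OF h] mod_hom_a_inv[OF h])

end

lemma mod_hom_scale:
  assumes "Module.module R M" "r \<in> carrier R"
  shows "(\<lambda>x. r \<odot>\<^bsub>M\<^esub> x) \<in> mod_hom R M M"
proof -
  interpret Module.module R M by fact
  show ?thesis using assms(2)
    by (auto intro!: mod_homI simp: smult_r_distr m_comm simp flip: smult_assoc1)
qed

lemma (in abelian_group) a_inv_zero [simp]: "\<ominus> \<zero> = \<zero>"
  using r_neg[OF zero_closed] by simp

lemma (in abelian_group) diff_eq_zero_iff:
  assumes "x \<in> carrier G" "y \<in> carrier G"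
  shows "x \<ominus> y = \<zero> \<longleftrightarrow> x = y"
proof -
  have "(x \<ominus> y) \<oplus> y = x" using assms by (simp add: minus_eq a_assoc l_neg)
  then show ?thesis using assms by (metis l_zero minus_eq r_neg)
qed

lemma (in Module.module) submodule_abelian_subgroup: "submodule H R M \<Longrightarrow> abelian_subgroup H M"
  by (intro abelian_subgroupI3 additive_subgroupI) (auto simp: submodule_def abelian_group_axioms)

lemma (in Module.module) submodule_zero: "submodule H R M \<Longrightarrow> \<zero>\<^bsub>M\<^esub> \<in> H"
  using submodule.axioms(1) subgroup.one_closed by fastforce

section \<open>Quotient modules\<close>

context
  fixes R :: "('r, 'y) ring_scheme" (structure)
    and M :: "('r, 'a, 'u) module_scheme" and H
  assumes M: "Module.module R M" and H: "submodule H R M"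
begin

interpretation M: Module.module R M by (fact M)
interpretation H: abelian_subgroup H M by (rule M.submodule_abelian_subgroup[OF H])

text \<open>Scalar multiplication in \<open>quotient_module\<close> is a union over all
  representatives. Since \<open>H\<close> is stable under scalars, all cosets in this union
  coincide, and one representative suffices.\<close>

lemma smult_coset:
  assumes "r \<in> carrier R" "x \<in> carrier M"
  shows "(\<Union>y\<in>H +>\<^bsub>M\<^esub> x. H +>\<^bsub>M\<^esub> (r \<odot>\<^bsub>M\<^esub> y)) = H +>\<^bsub>M\<^esub> (r \<odot>\<^bsub>M\<^esub> x)"
proof -
  have "H +>\<^bsub>M\<^esub> (r \<odot>\<^bsub>M\<^esub> y) = H +>\<^bsub>M\<^esub> (r \<odot>\<^bsub>M\<^esub> x)" if y: "y \<in> H +>\<^bsub>M\<^esub> x" for y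
  proof -
    obtain z where z: "z \<in> H" "y = z \<oplus>\<^bsub>M\<^esub> x" using y by (auto simp: a_r_coset_def')
    have "r \<odot>\<^bsub>M\<^esub> z \<in> H" using z assms submodule.smult_closed[OF H] by blast
    moreover have "r \<odot>\<^bsub>M\<^esub> y = r \<odot>\<^bsub>M\<^esub> z \<oplus>\<^bsub>M\<^esub> r \<odot>\<^bsub>M\<^esub> x"
      using z assms by (simp add: M.smult_r_distr)
    ultimately have "r \<odot>\<^bsub>M\<^esub> y \<in> H +>\<^bsub>M\<^esub> (r \<odot>\<^bsub>M\<^esub> x)" by (auto simp: a_r_coset_def')
    then show ?thesis using H.a_repr_independence'[of _ "r \<odot>\<^bsub>M\<^esub> x"] assms by auto
  qed
  moreover have "x \<in> H +>\<^bsub>M\<^esub> x" using assms H.a_rcos_self by blast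
  ultimately show ?thesis by blast
qed

lemma quotient_carrier: "carrier (quotient_module M H) = (\<lambda>x. H +>\<^bsub>M\<^esub> x) ` carrier M"
  by (auto simp: quotient_module_def A_RCOSETS_def')

lemma quotient_zero: "\<zero>\<^bsub>quotient_module M H\<^esub> = H"
  by (simp add: quotient_module_def)

lemma quotient_add:
  "\<lbrakk>x \<in> carrier M; y \<in> carrier M\<rbrakk> \<Longrightarrow>
    (H +>\<^bsub>M\<^esub> x) \<oplus>\<^bsub>quotient_module M H\<^esub> (H +>\<^bsub>M\<^esub> y) = H +>\<^bsub>M\<^esub> (x \<oplus>\<^bsub>M\<^esub> y)"
  by (simp add: quotient_module_def H.a_rcos_sum)

lemma quotient_smult:
  "\<lbrakk>r \<in> carrier R; x \<in> carrier M\<rbrakk> \<Longrightarrow>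
    r \<odot>\<^bsub>quotient_module M H\<^esub> (H +>\<^bsub>M\<^esub> x) = H +>\<^bsub>M\<^esub> (r \<odot>\<^bsub>M\<^esub> x)"
  by (simp add: quotient_module_def smult_coset)

lemma coset_eq_iff:
  "\<lbrakk>x \<in> carrier M; y \<in> carrier M\<rbrakk> \<Longrightarrow> H +>\<^bsub>M\<^esub> x = H +>\<^bsub>M\<^esub> y \<longleftrightarrow> x \<ominus>\<^bsub>M\<^esub> y \<in> H"
  using H.a_rcos_module[of y x] H.a_rcos_self[of x] H.a_repr_independence'[of x y]
  by (auto simp: a_minus_def)

lemma quotient_module_is_module: "Module.module R (quotient_module M H)"
proof -
  have "abelian_group (quotient_module M H)"
  proof (rule abelian_groupI)
    fix X assume "X \<in> carrier (quotient_module M H)"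
    then obtain x where x: "x \<in> carrier M" "X = H +>\<^bsub>M\<^esub> x" by (auto simp: quotient_carrier)
    have "H = H +>\<^bsub>M\<^esub> \<zero>\<^bsub>M\<^esub>" by (simp add: H.a_subset M.a_coset_add_zero)
    with x show "\<zero>\<^bsub>quotient_module M H\<^esub> \<oplus>\<^bsub>quotient_module M H\<^esub> X = X"
      using quotient_add[of "\<zero>\<^bsub>M\<^esub>" x] by (simp add: quotient_zero)
    show "\<exists>Y\<in>carrier (quotient_module M H). Y \<oplus>\<^bsub>quotient_module M H\<^esub> X = \<zero>\<^bsub>quotient_module M H\<^esub>"
      by (rule bexI[of _ "H +>\<^bsub>M\<^esub> (\<ominus>\<^bsub>M\<^esub> x)"])
        (use x \<open>H = _\<close> in \<open>auto simp: quotient_carrier quotient_add quotient_zero M.l_neg\<close>)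
  next
    have "H = H +>\<^bsub>M\<^esub> \<zero>\<^bsub>M\<^esub>" by (simp add: H.a_subset M.a_coset_add_zero)
    then show "\<zero>\<^bsub>quotient_module M H\<^esub> \<in> carrier (quotient_module M H)"
      by (auto simp: quotient_zero quotient_carrier)
  qed (auto simp: quotient_carrier quotient_add M.a_ac)
  then show ?thesis
    by (intro moduleI M.is_cring)
      (auto simp: quotient_carrier quotient_add quotient_smult M.smult_l_distr M.smult_r_distr M.smult_assoc1)
qed

lemma quotient_proj: "(\<lambda>x. H +>\<^bsub>M\<^esub> x) \<in> mod_hom R M (quotient_module M H)"
  by (rule mod_homI) (auto simp: quotient_carrier quotient_add quotient_smult)

lemma coset_eq_self_iff:
  "x \<in> carrier M \<Longrightarrow> H +>\<^bsub>M\<^esub> x = H \<longleftrightarrow> x \<in> H"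
  using coset_eq_iff[of x "\<zero>\<^bsub>M\<^esub>"] by (simp add: M.minus_eq H.a_subset)

lemma quotient_lift:
  assumes N: "Module.module R N" and h: "h \<in> mod_hom R M N" and ker: "\<And>x. x \<in> H \<Longrightarrow> h x = \<zero>\<^bsub>N\<^esub>"
  obtains g where "g \<in> mod_hom R (quotient_module M H) N"
    "\<And>x. x \<in> carrier M \<Longrightarrow> g (H +>\<^bsub>M\<^esub> x) = h x"
proof -
  interpret N: Module.module R N by (fact N)
  \<comment> \<open>Any representative will do: \<open>h\<close> vanishes on the difference of two
    of them, which lies in \<open>H\<close>.\<close>
  define g where "g X = h (SOME x. x \<in> carrier M \<and> X = H +>\<^bsub>M\<^esub> x)" for X
  have g: "g (H +>\<^bsub>M\<^esub> x) = h x" if x: "x \<in> carrier M" for x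
  proof -
    define y where "y = (SOME y. y \<in> carrier M \<and> H +>\<^bsub>M\<^esub> x = H +>\<^bsub>M\<^esub> y)"
    have y: "y \<in> carrier M \<and> H +>\<^bsub>M\<^esub> x = H +>\<^bsub>M\<^esub> y"
      unfolding y_def by (rule someI[of _ x]) (use x in simp)
    then have "h (x \<ominus>\<^bsub>M\<^esub> y) = \<zero>\<^bsub>N\<^esub>" using x coset_eq_iff[of x y] ker by simp
    then have "h x = h y"
      using x y mod_homD(1)[OF h] by (simp add: mod_hom_minus[OF M N h] N.diff_eq_zero_iff)
    then show ?thesis by (simp add: g_def y_def)
  qed
  have "g \<in> mod_hom R (quotient_module M H) N"
    by (rule mod_homI) (auto simp: quotient_carrier quotient_add quotient_smult g mod_homD[OF h])
  with g that show ?thesis by blast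
qed

end

section \<open>Free modules\<close>

lemma free_module_simps [simp]:
  "\<zero>\<^bsub>free_module R S\<^esub> = (\<lambda>s. \<zero>\<^bsub>R\<^esub>)"
  "f \<oplus>\<^bsub>free_module R S\<^esub> g = (\<lambda>s. f s \<oplus>\<^bsub>R\<^esub> g s)"
  "r \<odot>\<^bsub>free_module R S\<^esub> f = (\<lambda>s. r \<otimes>\<^bsub>R\<^esub> f s)"
  by (simp_all add: free_module_def)

lemma free_module_carrier:
  "f \<in> carrier (free_module R S) \<longleftrightarrow>
    (\<forall>s\<in>S. f s \<in> carrier R) \<and> (\<forall>s. s \<notin> S \<longrightarrow> f s = \<zero>\<^bsub>R\<^esub>) \<and> finite {s. f s \<noteq> \<zero>\<^bsub>R\<^esub>}"
  by (simp add: free_module_def)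

text \<open>The linear extension of \<open>\<phi>\<close> to the free module. Summing over the
  support of \<open>f\<close> reproduces literally the sum in \<open>module_basis\<close>.\<close>

definition lincomb ::
  "('r, 'y) ring_scheme \<Rightarrow> ('r, 'a, 'u) module_scheme \<Rightarrow> ('s \<Rightarrow> 'a) \<Rightarrow> ('s \<Rightarrow> 'r) \<Rightarrow> 'a" where
  "lincomb R N \<phi> f = (\<Oplus>\<^bsub>N\<^esub>s\<in>{s. f s \<noteq> \<zero>\<^bsub>R\<^esub>}. f s \<odot>\<^bsub>N\<^esub> \<phi> s)"

context cring
begin

lemma free_module_closed: "f \<in> carrier (free_module R S) \<Longrightarrow> f s \<in> carrier R"
  by (cases "s \<in> S") (auto simp: free_module_carrier)

lemma free_module_is_module: "Module.module R (free_module R S)"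
proof (rule moduleI)
  show "abelian_group (free_module R S)"
  proof (rule abelian_groupI)
    fix f g assume fg: "f \<in> carrier (free_module R S)" "g \<in> carrier (free_module R S)"
    have "finite {s. f s \<oplus> g s \<noteq> \<zero>}"
      by (rule finite_subset[of _ "{s. f s \<noteq> \<zero>} \<union> {s. g s \<noteq> \<zero>}"])
        (use fg in \<open>auto simp: free_module_carrier\<close>)
    with fg show "f \<oplus>\<^bsub>free_module R S\<^esub> g \<in> carrier (free_module R S)"
      by (auto simp: free_module_carrier)
    show "f \<oplus>\<^bsub>free_module R S\<^esub> g = g \<oplus>\<^bsub>free_module R S\<^esub> f"
      using fg by (auto simp: free_module_closed a_ac)
  next
    fix f assume f: "f \<in> carrier (free_module R S)"
    have "(\<lambda>s. \<ominus> f s) \<in> carrier (free_module R S)"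
      using f by (auto simp: free_module_carrier elim!: rev_finite_subset)
    then show "\<exists>g\<in>carrier (free_module R S). g \<oplus>\<^bsub>free_module R S\<^esub> f = \<zero>\<^bsub>free_module R S\<^esub>"
      by (rule bexI[rotated]) (use f in \<open>auto simp: free_module_closed l_neg\<close>)
  qed (auto simp: free_module_closed a_ac, auto simp: free_module_carrier)
next
  fix r f assume r: "r \<in> carrier R" and f: "f \<in> carrier (free_module R S)"
  then show "r \<odot>\<^bsub>free_module R S\<^esub> f \<in> carrier (free_module R S)"
    by (auto simp: free_module_carrier elim!: rev_finite_subset)
qed (auto simp: is_cring free_module_closed l_distr r_distr m_assoc)

lemma free_gen_closed: "s \<in> S \<Longrightarrow> free_gen R s \<in> carrier (free_module R S)"
  by (auto simp: free_module_carrier free_gen_def intro: finite_subset[of _ "{s}"])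

text \<open>Supports vary with \<open>f\<close>; additivity needs a common finite index set, over
  which the extra summands are zero.\<close>

lemma lincomb_superset:
  assumes N: "Module.module R N" and "finite A" "{s. f s \<noteq> \<zero>} \<subseteq> A" "f \<in> A \<rightarrow> carrier R"
    "\<phi> \<in> A \<rightarrow> carrier N"
  shows "lincomb R N \<phi> f = (\<Oplus>\<^bsub>N\<^esub>s\<in>A. f s \<odot>\<^bsub>N\<^esub> \<phi> s)"
proof -
  interpret N: Module.module R N by fact
  show ?thesis unfolding lincomb_def
    by (rule N.add.finprod_mono_neutral_cong_left) (use assms in \<open>auto simp: Pi_iff\<close>)
qed

lemma lincomb_hom:
  assumes N: "Module.module R N" and \<phi>: "\<phi> \<in> S \<rightarrow> carrier N"
  shows "lincomb R N \<phi> \<in> mod_hom R (free_module R S) N"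
proof (rule mod_homI)
  interpret N: Module.module R N by fact
  have supp: "{s. f s \<noteq> \<zero>} \<subseteq> S" if "f \<in> carrier (free_module R S)" for f
    using that by (auto simp: free_module_carrier)
  fix f assume f: "f \<in> carrier (free_module R S)"
  then show "lincomb R N \<phi> f \<in> carrier N"
    unfolding lincomb_def using \<phi> supp[OF f] free_module_closed[OF f]
    by (intro N.finsum_closed) (simp add: Pi_iff subset_iff)
  { fix g assume g: "g \<in> carrier (free_module R S)"
    define A where "A = {s. f s \<noteq> \<zero>} \<union> {s. g s \<noteq> \<zero>}"
    have A: "finite A" "A \<subseteq> S" "{s. f s \<oplus> g s \<noteq> \<zero>} \<subseteq> A"
      using f g by (auto simp: A_def free_module_carrier)
    have "lincomb R N \<phi> (\<lambda>s. f s \<oplus> g s) = (\<Oplus>\<^bsub>N\<^esub>s\<in>A. (f s \<oplus> g s) \<odot>\<^bsub>N\<^esub> \<phi> s)"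
      using A \<phi> f g by (intro lincomb_superset N) (auto simp: free_module_closed)
    also have "\<dots> = (\<Oplus>\<^bsub>N\<^esub>s\<in>A. f s \<odot>\<^bsub>N\<^esub> \<phi> s \<oplus>\<^bsub>N\<^esub> g s \<odot>\<^bsub>N\<^esub> \<phi> s)"
      using A \<phi> f g by (intro N.finsum_cong' refl) (auto simp: free_module_closed N.smult_l_distr Pi_iff subset_iff)
    also have "\<dots> = (\<Oplus>\<^bsub>N\<^esub>s\<in>A. f s \<odot>\<^bsub>N\<^esub> \<phi> s) \<oplus>\<^bsub>N\<^esub> (\<Oplus>\<^bsub>N\<^esub>s\<in>A. g s \<odot>\<^bsub>N\<^esub> \<phi> s)"
      using A \<phi> free_module_closed[OF f] free_module_closed[OF g]
      by (intro N.finsum_addf) (simp_all add: Pi_iff subset_iff)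
    also have "(\<Oplus>\<^bsub>N\<^esub>s\<in>A. f s \<odot>\<^bsub>N\<^esub> \<phi> s) = lincomb R N \<phi> f"
      using A \<phi> f by (intro lincomb_superset[symmetric] N) (auto simp: free_module_closed A_def)
    also have "(\<Oplus>\<^bsub>N\<^esub>s\<in>A. g s \<odot>\<^bsub>N\<^esub> \<phi> s) = lincomb R N \<phi> g"
      using A \<phi> g by (intro lincomb_superset[symmetric] N) (auto simp: free_module_closed A_def)
    finally show "lincomb R N \<phi> (f \<oplus>\<^bsub>free_module R S\<^esub> g) = lincomb R N \<phi> f \<oplus>\<^bsub>N\<^esub> lincomb R N \<phi> g"
      by simp }
  { fix r assume r: "r \<in> carrier R"
    define A where "A = {s. f s \<noteq> \<zero>}"
    have A: "finite A" "A \<subseteq> S" "{s. r \<otimes> f s \<noteq> \<zero>} \<subseteq> A"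
      using f r by (auto simp: A_def free_module_carrier)
    have "lincomb R N \<phi> (\<lambda>s. r \<otimes> f s) = (\<Oplus>\<^bsub>N\<^esub>s\<in>A. (r \<otimes> f s) \<odot>\<^bsub>N\<^esub> \<phi> s)"
      using A \<phi> f r by (intro lincomb_superset N) (auto simp: free_module_closed)
    also have "\<dots> = (\<Oplus>\<^bsub>N\<^esub>s\<in>A. r \<odot>\<^bsub>N\<^esub> (f s \<odot>\<^bsub>N\<^esub> \<phi> s))"
      using A \<phi> f r by (intro N.finsum_cong' refl) (auto simp: free_module_closed N.smult_assoc1 Pi_iff subset_iff)
    also have "\<dots> = r \<odot>\<^bsub>N\<^esub> lincomb R N \<phi> f"
      unfolding lincomb_def A_def[symmetric] using A \<phi> free_module_closed[OF f] r
      by (intro N.finsum_smult_ldistr[symmetric]) (simp_all add: Pi_iff subset_iff)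
    finally show "lincomb R N \<phi> (r \<odot>\<^bsub>free_module R S\<^esub> f) = r \<odot>\<^bsub>N\<^esub> lincomb R N \<phi> f"
      by simp }
qed

lemma lincomb_free_gen:
  assumes N: "Module.module R N" and s: "\<phi> s \<in> carrier N"
  shows "lincomb R N \<phi> (free_gen R s) = \<phi> s"
proof -
  interpret N: Module.module R N by fact
  have "lincomb R N \<phi> (free_gen R s) = (\<Oplus>\<^bsub>N\<^esub>t\<in>{s}. free_gen R s t \<odot>\<^bsub>N\<^esub> \<phi> t)"
    using s by (intro lincomb_superset N) (auto simp: free_gen_def)
  then show ?thesis using s by (simp add: free_gen_def)
qed

text \<open>Induction on a finite set that contains the support of \<open>f\<close>, so that
  \<open>f\<close> may vary while the set shrinks.\<close>

lemma free_module_hom_eqI: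
  assumes N: "Module.module R N" and g: "g \<in> mod_hom R (free_module R S) N"
    and h: "h \<in> mod_hom R (free_module R S) N"
    and eq: "\<And>s. s \<in> S \<Longrightarrow> g (free_gen R s) = h (free_gen R s)"
    and f: "f \<in> carrier (free_module R S)"
  shows "g f = h f"
proof -
  have "g f = h f" if "finite A" "{s. f s \<noteq> \<zero>} \<subseteq> A" "f \<in> carrier (free_module R S)" for A f
    using that
  proof (induction A arbitrary: f rule: finite_induct)
    case empty
    then have "f = \<zero>\<^bsub>free_module R S\<^esub>" by auto
    then show ?case using mod_hom_zero[OF free_module_is_module N] g h by metis
  next
    case (insert a A)
    \<comment> \<open>Clearing the entry at \<open>a\<close> brings the support into
      \<open>A\<close>; what was removed is a multiple of one generator.\<close>
    have f': "f(a := \<zero>) \<in> carrier (free_module R S)"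
      using insert.prems by (auto simp: free_module_carrier elim!: rev_finite_subset)
    have "g (f(a := \<zero>)) = h (f(a := \<zero>))"
      by (rule insert.IH[OF _ f']) (use insert.prems in auto)
    show ?case
    proof (cases "a \<in> S")
      case True
      then have fa: "f a \<in> carrier R" using insert.prems by (auto simp: free_module_carrier)
      have "f = f(a := \<zero>) \<oplus>\<^bsub>free_module R S\<^esub> f a \<odot>\<^bsub>free_module R S\<^esub> free_gen R a"
        using insert.prems fa by (auto simp: free_gen_def free_module_closed)
      moreover have "f a \<odot>\<^bsub>free_module R S\<^esub> free_gen R a \<in> carrier (free_module R S)"
        using True fa by (meson Module.module.smult_closed free_gen_closed free_module_is_module)
      ultimately show ?thesis
        using \<open>g _ = h _\<close> f' True fa free_gen_closed[OF True] eq[OF True]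
        by (metis mod_homD(2,3)[OF g] mod_homD(2,3)[OF h])
    next
      case False
      then have "f(a := \<zero>) = f" using insert.prems by (auto simp: free_module_carrier)
      then show ?thesis using \<open>g _ = h _\<close> by simp
    qed
  qed
  then show ?thesis using f by (auto simp: free_module_carrier)
qed

text \<open>The unique existence of coefficients in \<open>module_basis\<close> is bijectivity of
  the map from the free module on the basis. In this form, as an isomorphism \<open>j\<close>,
  freeness enters all lifting arguments.\<close>

lemma module_basis_free_module:
  assumes M: "Module.module R M" and B: "module_basis R M B"
  shows "lincomb R M (\<lambda>b. b) \<in> mod_hom R (free_module R B) M"
    and "bij_betw (lincomb R M (\<lambda>b. b)) (carrier (free_module R B)) (carrier M)"
proof -
  have BM: "B \<subseteq> carrier M" using B by (auto simp: module_basis_def)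
  show hom: "lincomb R M (\<lambda>b. b) \<in> mod_hom R (free_module R B) M"
    using BM by (intro lincomb_hom M) auto
  have ex1: "\<exists>!f. f \<in> carrier (free_module R B) \<and> x = lincomb R M (\<lambda>b. b) f" if "x \<in> carrier M" for x
    using B that unfolding module_basis_def free_module_carrier lincomb_def by (simp add: conj_assoc)
  show "bij_betw (lincomb R M (\<lambda>b. b)) (carrier (free_module R B)) (carrier M)"
    unfolding bij_betw_def
  proof
    show "inj_on (lincomb R M (\<lambda>b. b)) (carrier (free_module R B))"
      by (rule inj_onI) (metis ex1 mod_homD(1)[OF hom])
    show "lincomb R M (\<lambda>b. b) ` carrier (free_module R B) = carrier M"
      using ex1 mod_homD(1)[OF hom] by blast
  qed
qed

text \<open>Projectivity: choose preimages of the images of the generators and extend linearly. The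
  map \<open>e\<close> is only asked to hit the image of \<open>\<psi>\<close>, because in a
  resolution it is a differential, which is onto the next kernel and not onto the whole
  module.\<close>

lemma free_lift:
  assumes M: "Module.module R M" and N: "Module.module R N"
    and j: "j \<in> mod_hom R (free_module R S) M" "bij_betw j (carrier (free_module R S)) (carrier M)"
    and \<psi>: "\<psi> \<in> mod_hom R M N" and N': "Module.module R N'" and e: "e \<in> mod_hom R N' N"
    and sub: "\<And>x. x \<in> carrier M \<Longrightarrow> \<psi> x \<in> e ` carrier N'"
  shows "\<exists>\<chi>\<in>mod_hom R M N'. \<forall>x\<in>carrier M. e (\<chi> x) = \<psi> x"
proof -
  let ?F = "free_module R S"
  interpret M: Module.module R M by fact
  interpret F: Module.module R ?F by (rule free_module_is_module)
  have "\<exists>y. y \<in> carrier N' \<and> e y = \<psi> (j (free_gen R s))" if "s \<in> S" for s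
    using sub[OF mod_homD(1)[OF j(1) free_gen_closed[OF that]]] by fastforce
  then obtain \<phi> where \<phi>: "\<And>s. s \<in> S \<Longrightarrow> \<phi> s \<in> carrier N' \<and> e (\<phi> s) = \<psi> (j (free_gen R s))"
    by metis
  define k where "k = lincomb R N' \<phi>"
  have k: "k \<in> mod_hom R ?F N'" unfolding k_def by (rule lincomb_hom) (use N' \<phi> in auto)
  have ek: "e (k f) = \<psi> (j f)" if "f \<in> carrier ?F" for f
  proof (rule free_module_hom_eqI[OF N mod_hom_comp[OF k e] mod_hom_comp[OF j(1) \<psi>] _ that])
    fix s assume "s \<in> S"
    with \<phi>[OF this] show "e (k (free_gen R s)) = \<psi> (j (free_gen R s))"
      by (simp add: k_def lincomb_free_gen[OF N'])
  qed
  \<comment> \<open>The lift is built on the free module; the inverse of \<open>j\<close> carries it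
    back to \<open>M\<close>.\<close>
  define i where "i = inv_into (carrier ?F) j"
  have i1: "i x \<in> carrier ?F" if "x \<in> carrier M" for x
    unfolding i_def by (rule inv_into_into) (simp add: bij_betw_imp_surj_on[OF j(2)] that)
  have i2: "j (i x) = x" if "x \<in> carrier M" for x
    unfolding i_def by (rule f_inv_into_f[of x j "carrier ?F"]) (simp add: bij_betw_imp_surj_on[OF j(2)] that)
  have ij: "i (j f) = f" if "f \<in> carrier ?F" for f
    unfolding i_def by (rule inv_into_f_f[OF bij_betw_imp_inj_on[OF j(2)] that])
  have "i \<in> mod_hom R M ?F"
  proof (rule mod_homI)
    fix x y assume xy: "x \<in> carrier M" "y \<in> carrier M"
    have *: "j (i x \<oplus>\<^bsub>?F\<^esub> i y) = x \<oplus>\<^bsub>M\<^esub> y"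
      using mod_homD(2)[OF j(1) i1 i1] xy i2 by (simp del: free_module_simps)
    show "i (x \<oplus>\<^bsub>M\<^esub> y) = i x \<oplus>\<^bsub>?F\<^esub> i y"
      using ij[OF F.a_closed[OF i1[OF xy(1)] i1[OF xy(2)]]] unfolding * .
  next
    fix r x assume xy: "r \<in> carrier R" "x \<in> carrier M"
    have *: "j (r \<odot>\<^bsub>?F\<^esub> i x) = r \<odot>\<^bsub>M\<^esub> x"
      using mod_homD(3)[OF j(1) _ i1] xy i2 by (simp del: free_module_simps)
    show "i (r \<odot>\<^bsub>M\<^esub> x) = r \<odot>\<^bsub>?F\<^esub> i x"
      using ij[OF F.smult_closed[OF xy(1) i1[OF xy(2)]]] unfolding * .
  qed (rule i1)
  then have "(\<lambda>x. k (i x)) \<in> mod_hom R M N'" by (rule mod_hom_comp[OF _ k])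
  then show ?thesis using ek i1 i2 by (intro bexI[of _ "\<lambda>x. k (i x)"]) simp_all
qed

end

section \<open>Tensor products\<close>

lemma gen_submodule_submodule:
  assumes "Module.module R M" "S \<subseteq> carrier M"
  shows "submodule (gen_submodule R M S) R M"
proof -
  interpret M: Module.module R M by fact
  have *: "gen_submodule R M S \<subseteq> carrier M"
    unfolding gen_submodule_def using M.carrier_is_submodule assms(2) by auto
  show ?thesis
  proof (rule M.submoduleI[OF *])
    show "\<zero>\<^bsub>M\<^esub> \<in> gen_submodule R M S"
      by (simp add: gen_submodule_def M.submodule_zero)
  next
    fix a assume "a \<in> gen_submodule R M S"
    then show "\<ominus>\<^bsub>M\<^esub> a \<in> gen_submodule R M S"
      unfolding gen_submodule_def using M.submoduleE(3) by blast
  next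
    fix a b assume "a \<in> gen_submodule R M S" "b \<in> gen_submodule R M S"
    then show "a \<oplus>\<^bsub>M\<^esub> b \<in> gen_submodule R M S"
      unfolding gen_submodule_def using M.submoduleE(5) by blast
  next
    fix a x assume "a \<in> carrier R" "x \<in> gen_submodule R M S"
    then show "a \<odot>\<^bsub>M\<^esub> x \<in> gen_submodule R M S"
      unfolding gen_submodule_def using M.submoduleE(4) by blast
  qed
qed

lemma gen_submodule_incl: "S \<subseteq> gen_submodule R M S"
  by (auto simp: gen_submodule_def)

lemma gen_submodule_least: "\<lbrakk>submodule H R M; S \<subseteq> H\<rbrakk> \<Longrightarrow> gen_submodule R M S \<subseteq> H"
  by (auto simp: gen_submodule_def)

definition bilinear_map ::
  "('r, 'y) ring_scheme \<Rightarrow> ('r, 'a, 'u) module_scheme \<Rightarrow> ('r, 'b, 'v) module_scheme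
     \<Rightarrow> ('r, 'c, 'w) module_scheme \<Rightarrow> ('a \<Rightarrow> 'b \<Rightarrow> 'c) \<Rightarrow> bool" where
  "bilinear_map R M N Q \<beta> \<longleftrightarrow>
     (\<forall>x\<in>carrier M. \<beta> x \<in> mod_hom R N Q) \<and> (\<forall>y\<in>carrier N. (\<lambda>x. \<beta> x y) \<in> mod_hom R M Q)"

context
  fixes R :: "('r, 'y) ring_scheme" (structure)
    and M :: "('r, 'a, 'u) module_scheme" and N :: "('r, 'b, 'v) module_scheme"
  assumes M: "Module.module R M" and N: "Module.module R N"
begin

interpretation M: Module.module R M by (fact M)
interpretation N: Module.module R N by (fact N)
interpretation F: Module.module R "tensor_free R M N"
  unfolding tensor_free_def by (rule M.free_module_is_module)

lemma tensor_gen_closed: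
  "\<lbrakk>x \<in> carrier M; y \<in> carrier N\<rbrakk> \<Longrightarrow> free_gen R (x, y) \<in> carrier (tensor_free R M N)"
  by (simp add: tensor_free_def M.free_gen_closed)

lemma tensor_rel_submodule: "submodule (tensor_rel R M N) R (tensor_free R M N)"
  unfolding tensor_rel_def Let_def
  by (rule gen_submodule_submodule[OF F.module_axioms]) (auto intro!: F.minus_closed tensor_gen_closed F.a_closed F.smult_closed)

lemma tensor_module_is_module: "Module.module R (tensor_module R M N)"
  unfolding tensor_module_def by (rule quotient_module_is_module[OF F.module_axioms tensor_rel_submodule])

text \<open>Composing with the projection from the free module on pairs reduces the claim to
  generators, whose images are the pure tensors.\<close>

lemma tensor_hom_eqI:
  assumes Q: "Module.module R Q" and g: "g \<in> mod_hom R (tensor_module R M N) Q"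
    and h: "h \<in> mod_hom R (tensor_module R M N) Q"
    and eq: "\<And>x y. \<lbrakk>x \<in> carrier M; y \<in> carrier N\<rbrakk> \<Longrightarrow> g (pure_tensor R M N x y) = h (pure_tensor R M N x y)"
    and t: "t \<in> carrier (tensor_module R M N)"
  shows "g t = h t"
proof -
  let ?p = "\<lambda>f. tensor_rel R M N +>\<^bsub>tensor_free R M N\<^esub> f"
  have p: "?p \<in> mod_hom R (tensor_free R M N) (tensor_module R M N)"
    unfolding tensor_module_def by (rule quotient_proj[OF F.module_axioms tensor_rel_submodule])
  obtain f where f: "f \<in> carrier (tensor_free R M N)" "t = ?p f"
    using t quotient_carrier[OF F.module_axioms tensor_rel_submodule] by (auto simp: tensor_module_def)
  have "g (?p f) = h (?p f)"
    by (rule M.free_module_hom_eqI[OF Q, of _ "carrier M \<times> carrier N", folded tensor_free_def, OF mod_hom_comp[OF p g] mod_hom_comp[OF p h]])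
      (use eq f in \<open>auto simp: pure_tensor_def\<close>)
  then show ?thesis using f by simp
qed

lemma pure_tensor_bilinear: "bilinear_map R M N (tensor_module R M N) (pure_tensor R M N)"
proof -
  let ?F = "tensor_free R M N" and ?e = "\<lambda>x y. free_gen R (x, y)"
  note q = quotient_carrier[OF F.module_axioms tensor_rel_submodule, folded tensor_module_def]
    quotient_add[OF F.module_axioms tensor_rel_submodule, folded tensor_module_def]
    quotient_smult[OF F.module_axioms tensor_rel_submodule, folded tensor_module_def]
  note eq = iffD2[OF coset_eq_iff[OF F.module_axioms tensor_rel_submodule]]
  note incl = subsetD[OF gen_submodule_incl]
  have rel:
    "\<lbrakk>x \<in> carrier M; x' \<in> carrier M; y \<in> carrier N\<rbrakk> \<Longrightarrow>
      ?e (x \<oplus>\<^bsub>M\<^esub> x') y \<ominus>\<^bsub>?F\<^esub> (?e x y \<oplus>\<^bsub>?F\<^esub> ?e x' y) \<in> tensor_rel R M N"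
    "\<lbrakk>x \<in> carrier M; y \<in> carrier N; y' \<in> carrier N\<rbrakk> \<Longrightarrow>
      ?e x (y \<oplus>\<^bsub>N\<^esub> y') \<ominus>\<^bsub>?F\<^esub> (?e x y \<oplus>\<^bsub>?F\<^esub> ?e x y') \<in> tensor_rel R M N"
    "\<lbrakk>r \<in> carrier R; x \<in> carrier M; y \<in> carrier N\<rbrakk> \<Longrightarrow>
      ?e (r \<odot>\<^bsub>M\<^esub> x) y \<ominus>\<^bsub>?F\<^esub> r \<odot>\<^bsub>?F\<^esub> ?e x y \<in> tensor_rel R M N"
    "\<lbrakk>r \<in> carrier R; x \<in> carrier M; y \<in> carrier N\<rbrakk> \<Longrightarrow>
      ?e x (r \<odot>\<^bsub>N\<^esub> y) \<ominus>\<^bsub>?F\<^esub> r \<odot>\<^bsub>?F\<^esub> ?e x y \<in> tensor_rel R M N" for r x x' y y'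
    unfolding tensor_rel_def Let_def by (rule incl, blast)+
  note gen = tensor_gen_closed
  have pure: "pure_tensor R M N x y \<in> carrier (tensor_module R M N)" if "x \<in> carrier M" "y \<in> carrier N" for x y
    using that by (auto simp: pure_tensor_def q gen)
  have "pure_tensor R M N (x \<oplus>\<^bsub>M\<^esub> x') y = pure_tensor R M N x y \<oplus>\<^bsub>tensor_module R M N\<^esub> pure_tensor R M N x' y"
    if "x \<in> carrier M" "x' \<in> carrier M" "y \<in> carrier N" for x x' y
    using that unfolding pure_tensor_def
    by (subst q(2)) (simp_all add: eq rel gen)
  moreover have "pure_tensor R M N x (y \<oplus>\<^bsub>N\<^esub> y') = pure_tensor R M N x y \<oplus>\<^bsub>tensor_module R M N\<^esub> pure_tensor R M N x y'"
    if "x \<in> carrier M" "y \<in> carrier N" "y' \<in> carrier N" for x y y'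
    using that unfolding pure_tensor_def
    by (subst q(2)) (simp_all add: eq rel gen)
  moreover have "pure_tensor R M N (r \<odot>\<^bsub>M\<^esub> x) y = r \<odot>\<^bsub>tensor_module R M N\<^esub> pure_tensor R M N x y"
    "pure_tensor R M N x (r \<odot>\<^bsub>N\<^esub> y) = r \<odot>\<^bsub>tensor_module R M N\<^esub> pure_tensor R M N x y"
    if "r \<in> carrier R" "x \<in> carrier M" "y \<in> carrier N" for r x y
    using that unfolding pure_tensor_def
    by (subst q(3); simp add: eq rel gen)+
  ultimately show ?thesis unfolding bilinear_map_def
    by (intro conjI ballI mod_homI) (simp_all add: pure)
qed

text \<open>Universal property. The linear extension \<open>k\<close> of \<open>\<beta>\<close> to
  the free module on pairs has a submodule as kernel; bilinearity puts the four kinds of generating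
  relations into it, hence all of \<open>tensor_rel\<close>, and \<open>k\<close> descends to the
  quotient.\<close>

lemma tensor_lift:
  assumes Q: "Module.module R Q" and \<beta>: "bilinear_map R M N Q \<beta>"
  obtains h where "h \<in> mod_hom R (tensor_module R M N) Q"
    "\<And>x y. \<lbrakk>x \<in> carrier M; y \<in> carrier N\<rbrakk> \<Longrightarrow> h (pure_tensor R M N x y) = \<beta> x y"
proof -
  interpret Q: Module.module R Q by fact
  have \<beta>1: "\<beta> x \<in> mod_hom R N Q" if "x \<in> carrier M" for x using \<beta> that by (simp add: bilinear_map_def)
  have \<beta>2: "(\<lambda>x. \<beta> x y) \<in> mod_hom R M Q" if "y \<in> carrier N" for y using \<beta> that by (simp add: bilinear_map_def)
  define k where "k = lincomb R Q (\<lambda>(x, y). \<beta> x y)"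
  have k: "k \<in> mod_hom R (tensor_free R M N) Q"
    unfolding k_def tensor_free_def by (rule M.lincomb_hom[OF Q]) (auto simp: mod_homD(1)[OF \<beta>1])
  have kg: "k (free_gen R (x, y)) = \<beta> x y" if "x \<in> carrier M" "y \<in> carrier N" for x y
    using that unfolding k_def by (subst M.lincomb_free_gen[OF Q]) (auto simp: mod_homD(1)[OF \<beta>1])
  note km = mod_hom_minus[OF F.module_axioms Q k]
  have "tensor_rel R M N \<subseteq> {x \<in> carrier (tensor_free R M N). k x = \<zero>\<^bsub>Q\<^esub>}"
    unfolding tensor_rel_def Let_def
  proof (rule gen_submodule_least[OF mod_hom_kernel_submodule[OF F.module_axioms Q k]], intro Un_least subsetI; clarify)
    note gen = tensor_gen_closed
    note s = km gen kg mod_homD[OF \<beta>1] mod_homD(2,3)[OF \<beta>2] mod_homD(2,3)[OF k] Q.diff_eq_zero_iff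
    { fix x x' y assume "x \<in> carrier M" "x' \<in> carrier M" "y \<in> carrier N"
      then show "free_gen R (x \<oplus>\<^bsub>M\<^esub> x', y) \<ominus>\<^bsub>tensor_free R M N\<^esub>
          (free_gen R (x, y) \<oplus>\<^bsub>tensor_free R M N\<^esub> free_gen R (x', y)) \<in> carrier (tensor_free R M N) \<and>
        k (free_gen R (x \<oplus>\<^bsub>M\<^esub> x', y) \<ominus>\<^bsub>tensor_free R M N\<^esub>
          (free_gen R (x, y) \<oplus>\<^bsub>tensor_free R M N\<^esub> free_gen R (x', y))) = \<zero>\<^bsub>Q\<^esub>"
        by (simp add: s) }
    { fix x y y' assume "x \<in> carrier M" "y \<in> carrier N" "y' \<in> carrier N"
      then show "free_gen R (x, y \<oplus>\<^bsub>N\<^esub> y') \<ominus>\<^bsub>tensor_free R M N\<^esub>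
          (free_gen R (x, y) \<oplus>\<^bsub>tensor_free R M N\<^esub> free_gen R (x, y')) \<in> carrier (tensor_free R M N) \<and>
        k (free_gen R (x, y \<oplus>\<^bsub>N\<^esub> y') \<ominus>\<^bsub>tensor_free R M N\<^esub>
          (free_gen R (x, y) \<oplus>\<^bsub>tensor_free R M N\<^esub> free_gen R (x, y'))) = \<zero>\<^bsub>Q\<^esub>"
        by (simp add: s) }
    { fix r x y assume "r \<in> carrier R" "x \<in> carrier M" "y \<in> carrier N"
      then show "free_gen R (r \<odot>\<^bsub>M\<^esub> x, y) \<ominus>\<^bsub>tensor_free R M N\<^esub> r \<odot>\<^bsub>tensor_free R M N\<^esub> free_gen R (x, y)
          \<in> carrier (tensor_free R M N) \<and>
        k (free_gen R (r \<odot>\<^bsub>M\<^esub> x, y) \<ominus>\<^bsub>tensor_free R M N\<^esub> r \<odot>\<^bsub>tensor_free R M N\<^esub> free_gen R (x, y)) = \<zero>\<^bsub>Q\<^esub>"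
        by (simp add: s) }
    { fix r x y assume "r \<in> carrier R" "x \<in> carrier M" "y \<in> carrier N"
      then show "free_gen R (x, r \<odot>\<^bsub>N\<^esub> y) \<ominus>\<^bsub>tensor_free R M N\<^esub> r \<odot>\<^bsub>tensor_free R M N\<^esub> free_gen R (x, y)
          \<in> carrier (tensor_free R M N) \<and>
        k (free_gen R (x, r \<odot>\<^bsub>N\<^esub> y) \<ominus>\<^bsub>tensor_free R M N\<^esub> r \<odot>\<^bsub>tensor_free R M N\<^esub> free_gen R (x, y)) = \<zero>\<^bsub>Q\<^esub>"
        by (simp add: s) }
  qed
  then have "\<And>f. f \<in> tensor_rel R M N \<Longrightarrow> k f = \<zero>\<^bsub>Q\<^esub>" by blast
  from quotient_lift[OF F.module_axioms tensor_rel_submodule Q k this]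
  obtain h where "h \<in> mod_hom R (tensor_module R M N) Q"
    "\<And>f. f \<in> carrier (tensor_free R M N) \<Longrightarrow> h (tensor_rel R M N +>\<^bsub>tensor_free R M N\<^esub> f) = k f"
    unfolding tensor_module_def by blast
  then show ?thesis using that kg by (simp add: pure_tensor_def tensor_gen_closed)
qed

end

lemma pure_tensor_closed:
  "\<lbrakk>Module.module R M; Module.module R N; x \<in> carrier M; y \<in> carrier N\<rbrakk> \<Longrightarrow>
    pure_tensor R M N x y \<in> carrier (tensor_module R M N)"
  using pure_tensor_bilinear[of R M N] mod_homD(1)[of "pure_tensor R M N x" R N "tensor_module R M N"]
  by (simp add: bilinear_map_def)

text \<open>Justifies the definite description in \<open>tensor_map\<close>: existence comes from
  the universal property, uniqueness from the agreement on pure tensors inside the carrier and from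
  extensionality outside.\<close>

lemma tensor_map_props:
  assumes M: "Module.module R M" and N: "Module.module R N"
    and M': "Module.module R M'" and N': "Module.module R N'"
    and f: "f \<in> mod_hom R M M'" and g: "g \<in> mod_hom R N N'"
  shows tensor_map_hom: "tensor_map R M N M' N' f g \<in> mod_hom R (tensor_module R M N) (tensor_module R M' N')"
    and tensor_map_pure: "\<And>x y. \<lbrakk>x \<in> carrier M; y \<in> carrier N\<rbrakk> \<Longrightarrow>
      tensor_map R M N M' N' f g (pure_tensor R M N x y) = pure_tensor R M' N' (f x) (g y)"
proof -
  let ?T = "tensor_module R M N" and ?T' = "tensor_module R M' N'"
  let ?P = "\<lambda>h. h \<in> mod_hom R ?T ?T' \<and> h \<in> extensional (carrier ?T)
        \<and> (\<forall>x\<in>carrier M. \<forall>y\<in>carrier N. h (pure_tensor R M N x y) = pure_tensor R M' N' (f x) (g y))"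
  interpret T: Module.module R ?T by (rule tensor_module_is_module[OF M N])
  have T': "Module.module R ?T'" by (rule tensor_module_is_module[OF M' N'])
  have b: "pure_tensor R M' N' x \<in> mod_hom R N' ?T'" if "x \<in> carrier M'" for x
    using pure_tensor_bilinear[OF M' N'] that by (simp add: bilinear_map_def)
  have b': "(\<lambda>x. pure_tensor R M' N' x y) \<in> mod_hom R M' ?T'" if "y \<in> carrier N'" for y
    using pure_tensor_bilinear[OF M' N'] that by (simp add: bilinear_map_def)
  have "bilinear_map R M N ?T' (\<lambda>x y. pure_tensor R M' N' (f x) (g y))"
    unfolding bilinear_map_def using mod_hom_comp[OF g b] mod_hom_comp[OF f b'] mod_homD(1)[OF f] mod_homD(1)[OF g]
    by simp
  from tensor_lift[OF M N T' this] obtain h where h: "h \<in> mod_hom R ?T ?T'"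
    "\<And>x y. \<lbrakk>x \<in> carrier M; y \<in> carrier N\<rbrakk> \<Longrightarrow> h (pure_tensor R M N x y) = pure_tensor R M' N' (f x) (g y)"
    by blast
  \<comment> \<open>The lift is arbitrary outside the carrier, so it is cut off there to become
    extensional.\<close>
  have ex: "?P (restrict h (carrier ?T))"
    using h by (auto simp: pure_tensor_closed[OF M N] mod_homD[OF h(1)] intro!: mod_homI)
  have uniq: "h1 = h2" if h12: "?P h1" "?P h2" for h1 h2
  proof (rule extensionalityI[of _ "carrier ?T"])
    show "h1 t = h2 t" if "t \<in> carrier ?T" for t
      by (rule tensor_hom_eqI[OF M N T' conjunct1[OF h12(1)] conjunct1[OF h12(2)] _ that]) (simp add: h12)
  qed (use h12 in blast)+
  have "?P (THE h. ?P h)"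
    by (rule theI'[of ?P], rule ex1I[of ?P, OF ex], rule uniq[OF _ ex])
  then show "tensor_map R M N M' N' f g \<in> mod_hom R ?T ?T'"
    and "\<And>x y. \<lbrakk>x \<in> carrier M; y \<in> carrier N\<rbrakk> \<Longrightarrow>
      tensor_map R M N M' N' f g (pure_tensor R M N x y) = pure_tensor R M' N' (f x) (g y)"
    unfolding tensor_map_def by auto
qed

section \<open>Lifting chain maps and homotopies\<close>

text \<open>The maps are chosen one after the other by dependent choice. The invariant
  \<open>P\<close> records that the current map sends boundaries to boundaries, which is what
  \<open>free_lift\<close> needs for the next one; exactness of \<open>E\<close> restores the
  invariant.\<close>

lemma comparison_theorem:
  fixes C :: "nat \<Rightarrow> ('r, 'a, 'u) module_scheme" and E :: "nat \<Rightarrow> ('r, 'b, 'v) module_scheme"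
  assumes C: "\<And>n. Module.module R (C n)" and E: "\<And>n. Module.module R (E n)"
    and j: "\<And>n. j n \<in> mod_hom R (free_module R (S n)) (C n)"
      "\<And>n. bij_betw (j n) (carrier (free_module R (S n))) (carrier (C n))"
    and dC: "\<And>n. dC n \<in> mod_hom R (C (Suc n)) (C n)" and dE: "\<And>n. dE n \<in> mod_hom R (E (Suc n)) (E n)"
    and dCdC: "\<And>n x. x \<in> carrier (C (Suc (Suc n))) \<Longrightarrow> dC n (dC (Suc n) x) = \<zero>\<^bsub>C n\<^esub>"
    and exact: "\<And>n x. \<lbrakk>x \<in> carrier (E (Suc n)); dE n x = \<zero>\<^bsub>E n\<^esub>\<rbrakk> \<Longrightarrow> x \<in> dE (Suc n) ` carrier (E (Suc (Suc n)))"
    and f0: "f0 \<in> mod_hom R (C 0) (E 0)"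
      "\<And>x. x \<in> carrier (C (Suc 0)) \<Longrightarrow> f0 (dC 0 x) \<in> dE 0 ` carrier (E (Suc 0))"
  obtains f where "f 0 = f0" "\<And>n. f n \<in> mod_hom R (C n) (E n)"
    "\<And>n x. x \<in> carrier (C (Suc n)) \<Longrightarrow> dE n (f (Suc n) x) = f n (dC n x)"
proof -
  define P where "P n f \<longleftrightarrow> f \<in> mod_hom R (C n) (E n) \<and>
    (\<forall>x\<in>carrier (C (Suc n)). f (dC n x) \<in> dE n ` carrier (E (Suc n))) \<and> (n = 0 \<longrightarrow> f = f0)" for n f
  define Q where "Q n f g \<longleftrightarrow> (\<forall>x\<in>carrier (C (Suc n)). dE n (g x) = f (dC n x))" for n f g
  interpret cring R using C[of 0] by (rule Module.module.axioms(1))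
  have "\<exists>f. \<forall>n. P n (f n) \<and> Q n (f n) (f (Suc n))"
  proof (rule dependent_nat_choice)
    show "\<exists>f. P 0 f" using f0 by (auto simp: P_def)
  next
    fix n f assume "P n f"
    then have f: "f \<in> mod_hom R (C n) (E n)"
      "\<And>x. x \<in> carrier (C (Suc n)) \<Longrightarrow> f (dC n x) \<in> dE n ` carrier (E (Suc n))" by (auto simp: P_def)
    obtain g where g: "g \<in> mod_hom R (C (Suc n)) (E (Suc n))"
      "\<And>x. x \<in> carrier (C (Suc n)) \<Longrightarrow> dE n (g x) = f (dC n x)"
      using free_lift[OF C E j mod_hom_comp[OF dC f(1)] E dE f(2)] by blast
    have "g (dC (Suc n) x) \<in> dE (Suc n) ` carrier (E (Suc (Suc n)))"
      if x: "x \<in> carrier (C (Suc (Suc n)))" for x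
    proof (rule exact)
      have dx: "dC (Suc n) x \<in> carrier (C (Suc n))" using dC x by (rule mod_homD(1))
      show "g (dC (Suc n) x) \<in> carrier (E (Suc n))" using g(1) dx by (rule mod_homD(1))
      show "dE n (g (dC (Suc n) x)) = \<zero>\<^bsub>E n\<^esub>"
        using g(2)[OF dx] dCdC[OF x] mod_hom_zero[OF C E f(1)] by simp
    qed
    then show "\<exists>g. P (Suc n) g \<and> Q n f g" using g by (auto simp: P_def Q_def)
  qed
  then obtain f where "\<And>n. P n (f n)" "\<And>n. Q n (f n) (f (Suc n))" by blast
  then show thesis by (intro that[of f]) (auto simp: P_def Q_def)
qed

text \<open>Again dependent choice. The equation kept in the invariant \<open>P\<close> says that
  the next map to be lifted, \<open>\<phi>\<close> minus the homotopy already built after the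
  differential, takes values in cycles; exactness turns them into boundaries.\<close>

lemma null_homotopic:
  fixes C :: "nat \<Rightarrow> ('r, 'a, 'u) module_scheme" and E :: "nat \<Rightarrow> ('r, 'b, 'v) module_scheme"
  assumes C: "\<And>n. Module.module R (C n)" and E: "\<And>n. Module.module R (E n)"
    and j: "\<And>n. j n \<in> mod_hom R (free_module R (S n)) (C n)"
      "\<And>n. bij_betw (j n) (carrier (free_module R (S n))) (carrier (C n))"
    and dC: "\<And>n. dC n \<in> mod_hom R (C (Suc n)) (C n)" and dE: "\<And>n. dE n \<in> mod_hom R (E (Suc n)) (E n)"
    and dCdC: "\<And>n x. x \<in> carrier (C (Suc (Suc n))) \<Longrightarrow> dC n (dC (Suc n) x) = \<zero>\<^bsub>C n\<^esub>"
    and exact: "\<And>n x. \<lbrakk>x \<in> carrier (E (Suc n)); dE n x = \<zero>\<^bsub>E n\<^esub>\<rbrakk> \<Longrightarrow> x \<in> dE (Suc n) ` carrier (E (Suc (Suc n)))"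
    and \<phi>: "\<And>n. \<phi> n \<in> mod_hom R (C n) (E n)"
      "\<And>n x. x \<in> carrier (C (Suc n)) \<Longrightarrow> dE n (\<phi> (Suc n) x) = \<phi> n (dC n x)"
      "\<And>x. x \<in> carrier (C 0) \<Longrightarrow> \<phi> 0 x \<in> dE 0 ` carrier (E (Suc 0))"
  obtains s where "\<And>n. s n \<in> mod_hom R (C n) (E (Suc n))"
    "\<And>x. x \<in> carrier (C 0) \<Longrightarrow> dE 0 (s 0 x) = \<phi> 0 x"
    "\<And>n x. x \<in> carrier (C (Suc n)) \<Longrightarrow> dE (Suc n) (s (Suc n) x) = \<phi> (Suc n) x \<ominus>\<^bsub>E (Suc n)\<^esub> s n (dC n x)"
proof -
  define P where "P n s \<longleftrightarrow> s \<in> mod_hom R (C n) (E (Suc n)) \<and>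
    (\<forall>x\<in>carrier (C (Suc n)). dE n (s (dC n x)) = \<phi> n (dC n x)) \<and>
    (n = 0 \<longrightarrow> (\<forall>x\<in>carrier (C 0). dE 0 (s x) = \<phi> 0 x))" for n s
  define Q where "Q n s t \<longleftrightarrow>
    (\<forall>x\<in>carrier (C (Suc n)). dE (Suc n) (t x) = \<phi> (Suc n) x \<ominus>\<^bsub>E (Suc n)\<^esub> s (dC n x))" for n s t
  interpret cring R using C[of 0] by (rule Module.module.axioms(1))
  interpret E: Module.module R "E n" for n by (rule E)
  note dC' = mod_homD(1)[OF dC] and \<phi>' = mod_homD(1)[OF \<phi>(1)]
  have "\<exists>s. \<forall>n. P n (s n) \<and> Q n (s n) (s (Suc n))"
  proof (rule dependent_nat_choice)
    obtain s where "s \<in> mod_hom R (C 0) (E (Suc 0))" "\<And>x. x \<in> carrier (C 0) \<Longrightarrow> dE 0 (s x) = \<phi> 0 x"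
      using free_lift[OF C E j \<phi>(1) E dE \<phi>(3)] by blast
    then show "\<exists>s. P 0 s" by (intro exI[of _ s]) (simp add: P_def dC')
  next
    fix n s assume "P n s"
    then have s: "s \<in> mod_hom R (C n) (E (Suc n))"
      and sx: "\<And>x. x \<in> carrier (C (Suc n)) \<Longrightarrow> dE n (s (dC n x)) = \<phi> n (dC n x)" by (auto simp: P_def)
    note s' = mod_homD(1)[OF s]
    let ?\<psi> = "\<lambda>x. \<phi> (Suc n) x \<ominus>\<^bsub>E (Suc n)\<^esub> s (dC n x)"
    have \<psi>: "?\<psi> \<in> mod_hom R (C (Suc n)) (E (Suc n))"
      by (intro mod_hom_diff C E \<phi> mod_hom_comp[OF dC s])
    have lift: "?\<psi> x \<in> dE (Suc n) ` carrier (E (Suc (Suc n)))" if x: "x \<in> carrier (C (Suc n))" for x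
    proof (rule exact)
      show "?\<psi> x \<in> carrier (E (Suc n))" using \<psi> x by (rule mod_homD(1))
      show "dE n (?\<psi> x) = \<zero>\<^bsub>E n\<^esub>"
        using x by (subst mod_hom_minus[OF E E dE]) (simp_all add: sx \<phi>(2) dC' \<phi>' s' E.minus_eq E.r_neg)
    qed
    obtain t where t: "t \<in> mod_hom R (C (Suc n)) (E (Suc (Suc n)))"
      "\<And>x. x \<in> carrier (C (Suc n)) \<Longrightarrow> dE (Suc n) (t x) = ?\<psi> x"
      using free_lift[OF C E j \<psi> E dE lift] by blast
    have "dE (Suc n) (t (dC (Suc n) x)) = \<phi> (Suc n) (dC (Suc n) x)" if "x \<in> carrier (C (Suc (Suc n)))" for x
      using that by (simp add: t dC' dCdC mod_hom_zero[OF C E s] E.minus_eq \<phi>')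
    then show "\<exists>t. P (Suc n) t \<and> Q n s t" using t by (auto simp: P_def Q_def)
  qed
  then obtain s where "\<And>n. P n (s n)" "\<And>n. Q n (s n) (s (Suc n))" by blast
  then show thesis by (intro that[of s]) (auto simp: P_def Q_def)
qed

section \<open>The polynomial ring\<close>

lemma mpoly_ring_simps [simp]:
  "\<zero>\<^bsub>mpoly_ring d\<^esub> = 0" "\<one>\<^bsub>mpoly_ring d\<^esub> = 1"
  "p \<oplus>\<^bsub>mpoly_ring d\<^esub> q = p + q" "p \<otimes>\<^bsub>mpoly_ring d\<^esub> q = p * q"
  by (simp_all add: mpoly_ring_def)

lemma keys_add_nat: "Poly_Mapping.keys (a + b :: nat \<Rightarrow>\<^sub>0 nat) = Poly_Mapping.keys a \<union> Poly_Mapping.keys b"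
  by (auto simp: in_keys_iff lookup_add)

lemma mpoly_carrier:
  "p \<in> carrier (mpoly_ring d) \<longleftrightarrow> (\<forall>a\<in>Poly_Mapping.keys p. Poly_Mapping.keys a \<subseteq> {..<d})"
  by (simp add: mpoly_ring_def)

lemma mpoly_carrier_intros [simp]:
  "0 \<in> carrier (mpoly_ring d)" "1 \<in> carrier (mpoly_ring d)"
  "\<lbrakk>p \<in> carrier (mpoly_ring d); q \<in> carrier (mpoly_ring d)\<rbrakk> \<Longrightarrow> p + q \<in> carrier (mpoly_ring d)"
  "\<lbrakk>p \<in> carrier (mpoly_ring d); q \<in> carrier (mpoly_ring d)\<rbrakk> \<Longrightarrow> p * q \<in> carrier (mpoly_ring d)"
  "p \<in> carrier (mpoly_ring d) \<Longrightarrow> - p \<in> carrier (mpoly_ring d)"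
  "Poly_Mapping.keys a \<subseteq> {..<d} \<Longrightarrow> Poly_Mapping.single a c \<in> carrier (mpoly_ring d)"
proof -
  assume p: "p \<in> carrier (mpoly_ring d)" "q \<in> carrier (mpoly_ring d)"
  show "p + q \<in> carrier (mpoly_ring d)"
    using p Poly_Mapping.keys_add[of p q] by (auto simp: mpoly_carrier)
  show "p * q \<in> carrier (mpoly_ring d)"
    using p keys_mult[of p q] by (fastforce simp: mpoly_carrier keys_add_nat)
qed (auto simp: mpoly_carrier in_keys_iff)

lemma mpoly_carrier_sum:
  "(\<And>i. i \<in> A \<Longrightarrow> f i \<in> carrier (mpoly_ring d)) \<Longrightarrow> sum f A \<in> carrier (mpoly_ring d)"
  by (induction A rule: infinite_finite_induct) auto

lemma mpoly_cring: "cring (mpoly_ring d :: 'k::field mpol ring)"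
proof (rule cringI)
  show "abelian_group (mpoly_ring d :: 'k mpol ring)"
  proof (rule abelian_groupI)
    fix p :: "'k mpol" assume "p \<in> carrier (mpoly_ring d)"
    then show "\<exists>q\<in>carrier (mpoly_ring d). q \<oplus>\<^bsub>mpoly_ring d\<^esub> p = \<zero>\<^bsub>mpoly_ring d\<^esub>"
      by (intro bexI[of _ "- p"]) simp_all
  qed (simp_all add: ac_simps)
  show "comm_monoid (mpoly_ring d :: 'k mpol ring)"
    by (rule comm_monoidI) (simp_all add: ac_simps)
qed (simp add: algebra_simps)

lemma mpoly_a_inv: "p \<in> carrier (mpoly_ring d) \<Longrightarrow> \<ominus>\<^bsub>mpoly_ring d\<^esub> p = - p"
  by (rule abelian_group.minus_equality[OF cring.axioms(1)[OF mpoly_cring, THEN ring.axioms(1)]]) simp_all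

lemma lookup_single_mult_add:
  "Poly_Mapping.lookup (Poly_Mapping.single e c * p) (e + b) = c * Poly_Mapping.lookup p b"
  for e b :: "nat \<Rightarrow>\<^sub>0 nat" and p :: "'k::field mpol"
  by (simp add: lookup_mult lookup_single when_mult)

text \<open>Subtraction of exponents is truncated, so divisibility of the monomial by
  \<open>x_i\<close> has to be tested separately.\<close>

lemma lookup_single_mult_var:
  fixes p :: "'k::field mpol"
  shows "Poly_Mapping.lookup (Poly_Mapping.single (Poly_Mapping.single i 1) c * p) a =
    (if i \<in> Poly_Mapping.keys a then c * Poly_Mapping.lookup p (a - Poly_Mapping.single i 1) else 0)"
proof (cases "i \<in> Poly_Mapping.keys a")
  case True
  then have "a = Poly_Mapping.single i 1 + (a - Poly_Mapping.single i 1)"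
    by (intro poly_mapping_eqI) (auto simp: lookup_add lookup_minus lookup_single in_keys_iff when_def)
  then show ?thesis using True lookup_single_mult_add by metis
next
  case False
  have "a \<notin> Poly_Mapping.keys (Poly_Mapping.single (Poly_Mapping.single i 1) c * p)"
  proof
    assume "a \<in> Poly_Mapping.keys (Poly_Mapping.single (Poly_Mapping.single i 1) c * p)"
    then obtain b where "a = Poly_Mapping.single i 1 + b"
      using keys_mult[of "Poly_Mapping.single (Poly_Mapping.single i 1) c" p] by (auto split: if_splits)
    with False show False by (simp add: keys_add_nat)
  qed
  with False show ?thesis by (simp add: in_keys_iff)
qed

section \<open>The Koszul complex\<close>

definition subsets_of_card :: "nat \<Rightarrow> nat \<Rightarrow> nat set set" where
  "subsets_of_card d n = {S. S \<subseteq> {..<d} \<and> card S = n}"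

abbreviation koszul_module :: "nat \<Rightarrow> nat \<Rightarrow> ('k::field mpol, nat set \<Rightarrow> 'k mpol) module" where
  "koszul_module d n \<equiv> free_module (mpoly_ring d) (subsets_of_card d n)"

text \<open>The coefficient of \<open>e_T\<close> in the Koszul differential of
  \<open>e_(insert i T)\<close>: the variable \<open>x_i\<close>, with the sign given by the
  position of \<open>i\<close> in the increasing enumeration of \<open>insert i T\<close>.\<close>

definition koszul_coeff :: "nat \<Rightarrow> nat set \<Rightarrow> 'k::field mpol" where
  "koszul_coeff i T = Poly_Mapping.single (Poly_Mapping.single i 1) ((- 1) ^ card {j\<in>T. j < i})"

text \<open>The differential that sends \<open>e_S\<close> to the signed sum of
  \<open>x_i e_(S - {i})\<close>, read off at \<open>e_T\<close>. The homological degree does not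
  occur, so one map serves all degrees.\<close>

definition koszul_diff :: "nat \<Rightarrow> (nat set \<Rightarrow> 'k::field mpol) \<Rightarrow> nat set \<Rightarrow> 'k mpol" where
  "koszul_diff d u T =
     (if T \<subseteq> {..<d} then \<Sum>i\<in>{..<d} - T. koszul_coeff i T * u (insert i T) else 0)"

lemma finite_subsets_of_card [simp]: "finite (subsets_of_card d n)"
  by (rule finite_subset[of _ "Pow {..<d}"]) (auto simp: subsets_of_card_def)

lemma koszul_module_is_module: "Module.module (mpoly_ring d) (koszul_module d n)"
  by (rule cring.free_module_is_module[OF mpoly_cring])

lemma koszul_carrier:
  "u \<in> carrier (koszul_module d n) \<longleftrightarrow>
    (\<forall>S\<in>subsets_of_card d n. u S \<in> carrier (mpoly_ring d)) \<and> (\<forall>S. S \<notin> subsets_of_card d n \<longrightarrow> u S = 0)"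
  by (auto simp: free_module_carrier intro: finite_subset[OF _ finite_subsets_of_card])

lemma koszul_carrierD: "u \<in> carrier (koszul_module d n) \<Longrightarrow> u S \<in> carrier (mpoly_ring d)"
  by (rule cring.free_module_closed[OF mpoly_cring])

lemma insert_subsets_of_card:
  assumes "T \<subseteq> {..<d}" "i \<in> {..<d} - T"
  shows "insert i T \<in> subsets_of_card d m \<longleftrightarrow> m = Suc (card T)"
  using assms finite_subset[OF assms(1)] by (auto simp: subsets_of_card_def)

lemma koszul_coeff_closed [simp]: "i < d \<Longrightarrow> koszul_coeff i T \<in> carrier (mpoly_ring d)"
  by (simp add: koszul_coeff_def)

lemma koszul_diff_hom:
  "koszul_diff d \<in> mod_hom (mpoly_ring d) (koszul_module d (Suc n) :: ('k::field mpol, _) module) (koszul_module d n)"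
proof (rule mod_homI)
  fix u :: "nat set \<Rightarrow> 'k mpol" assume u: "u \<in> carrier (koszul_module d (Suc n))"
  have "koszul_diff d u T = 0" if "T \<notin> subsets_of_card d n" for T
  proof (cases "T \<subseteq> {..<d}")
    case True
    with that have "card T \<noteq> n" by (simp add: subsets_of_card_def)
    with True have "u (insert i T) = 0" if "i \<in> {..<d} - T" for i
      using u insert_subsets_of_card[OF True that, of "Suc n"] by (auto simp: koszul_carrier)
    then show ?thesis by (simp add: koszul_diff_def)
  qed (simp add: koszul_diff_def)
  then show "koszul_diff d u \<in> carrier (koszul_module d n)"
    using koszul_carrierD[OF u] by (auto simp: koszul_carrier koszul_diff_def intro!: mpoly_carrier_sum)
qed (auto simp: koszul_diff_def fun_eq_iff algebra_simps sum.distrib sum_distrib_left)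

text \<open>In the induction the row and the column of the new index cancel. Exchanging the two
  summation indices would only show that the sum equals its own negative, which is not enough in
  characteristic 2.\<close>

lemma sum_alternating_eq_0:
  fixes g :: "'i \<Rightarrow> 'i \<Rightarrow> 'a::ab_group_add"
  assumes "finite A" "\<And>i j. \<lbrakk>i \<in> A; j \<in> A; i \<noteq> j\<rbrakk> \<Longrightarrow> g i j = - g j i"
  shows "(\<Sum>i\<in>A. \<Sum>j\<in>A - {i}. g i j) = 0"
  using assms
proof (induction A rule: finite_induct)
  case (insert a A)
  have "(\<Sum>i\<in>A. \<Sum>j\<in>insert a A - {i}. g i j) = (\<Sum>i\<in>A. g i a + (\<Sum>j\<in>A - {i}. g i j))"
  proof (rule sum.cong[OF refl])
    fix i assume "i \<in> A"
    with insert.hyps have "insert a A - {i} = insert a (A - {i})" by auto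
    with insert.hyps show "(\<Sum>j\<in>insert a A - {i}. g i j) = g i a + (\<Sum>j\<in>A - {i}. g i j)" by simp
  qed
  also have "\<dots> = (\<Sum>i\<in>A. g i a)"
    unfolding sum.distrib using insert.IH[OF insert.prems] by simp
  also have "\<dots> = - (\<Sum>i\<in>A. g a i)"
    unfolding sum_negf[symmetric] by (rule sum.cong[OF refl], rule insert.prems) (use insert.hyps in auto)
  finally have "(\<Sum>i\<in>A. \<Sum>j\<in>insert a A - {i}. g i j) = - (\<Sum>i\<in>A. g a i)" .
  moreover have "insert a A - {a} = A" using insert.hyps by auto
  ultimately show ?case using insert.hyps by simp
qed simp

lemma card_less_insert:
  fixes i :: nat
  assumes "finite T" "i \<notin> T"
  shows "card {l\<in>insert i T. l < j} = (if i < j then 1 else 0) + card {l\<in>T. l < j}"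
proof -
  have "{l\<in>insert i T. l < j} = (if i < j then insert i {l\<in>T. l < j} else {l\<in>T. l < j})" by auto
  with assms show ?thesis by simp
qed

text \<open>Exactly one of \<open>i < j\<close> and \<open>j < i\<close> holds, so inserting one
  index changes the sign of the other coefficient on exactly one side.\<close>

lemma koszul_coeff_anticomm:
  assumes "finite T" "i \<notin> T" "j \<notin> T" "i \<noteq> j"
  shows "koszul_coeff i T * koszul_coeff j (insert i T) =
    - (koszul_coeff j T * koszul_coeff i (insert j T) :: 'k::field mpol)"
proof -
  have "i < j \<or> j < i" using assms by auto
  then show ?thesis
    unfolding koszul_coeff_def mult_single card_less_insert[OF assms(1,2)] card_less_insert[OF assms(1,3)]
    by (auto simp: single_uminus[symmetric] add.commute mult.commute)
qed

lemma koszul_diff_diff: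
  fixes u :: "nat set \<Rightarrow> 'k::field mpol"
  shows "koszul_diff d (koszul_diff d u) T = 0"
proof (cases "T \<subseteq> {..<d}")
  case True
  then have fin: "finite T" by (rule finite_subset) simp
  have "koszul_diff d (koszul_diff d u) T = (\<Sum>i\<in>{..<d} - T. \<Sum>j\<in>({..<d} - T) - {i}.
    koszul_coeff i T * (koszul_coeff j (insert i T) * u (insert j (insert i T))))"
    using True by (auto simp: koszul_diff_def sum_distrib_left intro!: sum.cong)
  also have "\<dots> = 0"
  proof (rule sum_alternating_eq_0)
    fix i j assume ij: "i \<in> {..<d} - T" "j \<in> {..<d} - T" "i \<noteq> j"
    have "koszul_coeff i T * koszul_coeff j (insert i T) * u (insert j (insert i T)) =
      - (koszul_coeff j T * koszul_coeff i (insert j T)) * u (insert i (insert j T))"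
      using koszul_coeff_anticomm[OF fin, of i j, where 'k = 'k] ij by (simp add: insert_commute)
    then show "koszul_coeff i T * (koszul_coeff j (insert i T) * u (insert j (insert i T))) =
      - (koszul_coeff j T * (koszul_coeff i (insert j T) * u (insert i (insert j T))))"
      by (simp add: mult.assoc)
  qed simp
  finally show ?thesis .
qed (simp add: koszul_diff_def)

lemma lookup_koszul_diff:
  assumes "T \<subseteq> {..<d}"
  shows "Poly_Mapping.lookup (koszul_diff d u T) a =
    (\<Sum>i\<in>{..<d} - T. if i \<in> Poly_Mapping.keys a
       then (- 1) ^ card {j\<in>T. j < i} * Poly_Mapping.lookup (u (insert i T)) (a - Poly_Mapping.single i 1) else 0)"
  using assms by (simp add: koszul_diff_def lookup_sum koszul_coeff_def lookup_single_mult_var del: One_nat_def)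

text \<open>In each multidegree the complex is contracted by the map that moves the smallest variable
  \<open>x\<^sub>i\<close> of \<open>x\<^sup>a e\<^sub>S\<close> (the smallest element \<open>i\<close> of \<open>supp a \<union> S\<close>) from \<open>x\<^sup>a\<close> to \<open>e\<^sub>S\<close>,
  and that vanishes if \<open>i \<in> S\<close>.\<close>

definition koszul_contract :: "nat \<Rightarrow> (nat set \<Rightarrow> 'k::field mpol) \<Rightarrow> nat set \<Rightarrow> 'k mpol" where
  "koszul_contract d u T = (if T \<subseteq> {..<d} \<and> T \<noteq> {} then
     Poly_Mapping.mapp (\<lambda>b c. if \<forall>j\<in>Poly_Mapping.keys b. Min T \<le> j then c else 0)
       (Poly_Mapping.map_key (\<lambda>b. b + Poly_Mapping.single (Min T) 1) (u (T - {Min T}))) else 0)"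

lemma lookup_koszul_contract:
  "Poly_Mapping.lookup (koszul_contract d u T) b =
    (if T \<subseteq> {..<d} \<and> T \<noteq> {} \<and> (\<forall>j\<in>Poly_Mapping.keys b. Min T \<le> j)
     then Poly_Mapping.lookup (u (T - {Min T})) (b + Poly_Mapping.single (Min T) 1) else 0)"
proof -
  have "inj (\<lambda>b. b + Poly_Mapping.single (Min T) (1::nat))" by (simp add: inj_def)
  then show ?thesis
    by (auto simp: koszul_contract_def lookup_mapp map_key.rep_eq in_keys_iff when_def)
qed

lemma koszul_contract_closed:
  assumes u: "u \<in> carrier (koszul_module d n)"
  shows "koszul_contract d u \<in> carrier (koszul_module d (Suc n))"
  unfolding koszul_carrier
proof (intro conjI ballI allI impI)
  fix T
  show "koszul_contract d u T \<in> carrier (mpoly_ring d)"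
    unfolding mpoly_carrier
  proof
    fix b assume "b \<in> Poly_Mapping.keys (koszul_contract d u T)"
    then have "b + Poly_Mapping.single (Min T) 1 \<in> Poly_Mapping.keys (u (T - {Min T}))"
      by (auto simp: in_keys_iff lookup_koszul_contract split: if_splits)
    then show "Poly_Mapping.keys b \<subseteq> {..<d}"
      using koszul_carrierD[OF u, of "T - {Min T}"] unfolding mpoly_carrier by (metis keys_add_nat le_sup_iff)
  qed
  assume T: "T \<notin> subsets_of_card d (Suc n)"
  have "T - {Min T} \<notin> subsets_of_card d n" if "T \<subseteq> {..<d}" "T \<noteq> {}"
  proof -
    have "finite T" using that finite_subset by blast
    then have "Suc (card (T - {Min T})) = card T" using that by (intro card_Suc_Diff1) auto
    then show ?thesis using that T by (auto simp: subsets_of_card_def)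
  qed
  then show "koszul_contract d u T = 0"
    using u by (intro poly_mapping_eqI) (auto simp: lookup_koszul_contract koszul_carrier)
qed

text \<open>Compare coefficients at \<open>x^a e_T\<close>, and let \<open>q\<close> be the smallest
  element of the support of \<open>a\<close> together with \<open>T\<close>. If \<open>q\<close> is
  outside \<open>T\<close>, only the summand with index \<open>q\<close> survives and gives back
  \<open>u\<close>. If \<open>q\<close> lies in \<open>T\<close>, the vanishing of the differential
  of \<open>u\<close> at a neighbouring coefficient expresses the wanted coefficient by the
  summands. No division occurs, so the characteristic is arbitrary.\<close>

lemma koszul_exact:
  assumes u: "u \<in> carrier (koszul_module d (Suc n))" and du: "\<And>T. koszul_diff d u T = 0"
  shows "koszul_diff d (koszul_contract d u) = u"
proof
  fix T
  note contr = koszul_contract_closed[OF u]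
  show "koszul_diff d (koszul_contract d u) T = u T"
  proof (cases "T \<in> subsets_of_card d (Suc n)")
    case False
    then show ?thesis using u mod_homD(1)[OF koszul_diff_hom contr] by (simp add: koszul_carrier)
  next
    case True
    then have T: "T \<subseteq> {..<d}" "finite T" "T \<noteq> {}"
      by (auto simp: subsets_of_card_def intro: finite_subset)
    show ?thesis
    proof (rule poly_mapping_eqI)
      fix a
      let ?e = "\<lambda>i. Poly_Mapping.single i (1::nat)"
      let ?t = "\<lambda>i. if i \<in> Poly_Mapping.keys a then (- 1) ^ card {j\<in>T. j < i} *
        Poly_Mapping.lookup (koszul_contract d u (insert i T)) (a - ?e i) else 0"
      define q where "q = Min (Poly_Mapping.keys a \<union> T)"
      have q: "q \<in> Poly_Mapping.keys a \<union> T" "\<And>j. j \<in> Poly_Mapping.keys a \<union> T \<Longrightarrow> q \<le> j"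
        unfolding q_def by (rule Min_in; use T in simp) (rule Min_le; use T in simp)
      have keys_diff: "j \<in> Poly_Mapping.keys a" if "j \<in> Poly_Mapping.keys (a - ?e i)" for i j
        using that by (auto simp: in_keys_iff lookup_minus)
      have sum: "Poly_Mapping.lookup (koszul_diff d (koszul_contract d u) T) a = (\<Sum>i\<in>{..<d} - T. ?t i)"
        by (rule lookup_koszul_diff[OF T(1)])
      show "Poly_Mapping.lookup (koszul_diff d (koszul_contract d u) T) a = Poly_Mapping.lookup (u T) a"
      proof (cases "q \<in> T")
        case False
        then have qa: "q \<in> Poly_Mapping.keys a" using q by auto
        have "Min T \<in> T" using T by simp
        then have "q < d" using q(2)[of "Min T"] T(1) by auto
        have less: "q < j" if "j \<in> T" for j using q(2)[of j] that False by (cases "j = q") auto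
        \<comment> \<open>Removing \<open>x_i\<close> leaves \<open>x_q\<close> in the monomial, and
          \<open>q\<close> is smaller than every element of \<open>insert i T\<close>; the
          contraction is zero on such terms.\<close>
        have t0: "?t i = 0" if "i \<in> {..<d} - T - {q}" for i
        proof (cases "i \<in> Poly_Mapping.keys a")
          case True
          have "q < Min (insert i T)" using T less q(2)[of i] True that by (subst Min_gr_iff) auto
          moreover have "q \<in> Poly_Mapping.keys (a - ?e i)"
            using qa that by (auto simp: in_keys_iff lookup_minus lookup_single when_def)
          ultimately show ?thesis by (auto simp: lookup_koszul_contract)
        qed simp
        have M: "Min (insert q T) = q" using T less by (intro Min_eqI) (auto intro: less_imp_le)
        have "{j\<in>T. j < q} = {}" using less by fastforce
        then have c: "card {j\<in>T. j < q} = 0" by (simp only: card.empty)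
        have tq: "?t q = Poly_Mapping.lookup (koszul_contract d u (insert q T)) (a - ?e q)"
          by (subst c) (use qa in simp)
        have "(\<Sum>i\<in>{..<d} - T. ?t i) = ?t q"
          using sum.mono_neutral_right[of "{..<d} - T" "{q}" ?t] t0 \<open>q < d\<close> False by auto
        also note tq
        also have "Poly_Mapping.lookup (koszul_contract d u (insert q T)) (a - ?e q) = Poly_Mapping.lookup (u T) (a - ?e q + ?e q)"
          using T(1) \<open>q < d\<close> False q(2) keys_diff by (auto simp: lookup_koszul_contract M)
        also have "a - ?e q + ?e q = a"
          using qa by (intro poly_mapping_eqI) (auto simp: lookup_add lookup_minus lookup_single in_keys_iff when_def)
        finally show ?thesis using sum by simp
      next
        case True
        let ?T = "T - {q}"
        let ?r = "\<lambda>i. if i \<in> Poly_Mapping.keys (a + ?e q) then (- 1) ^ card {j\<in>?T. j < i} *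
          Poly_Mapping.lookup (u (insert i ?T)) (a + ?e q - ?e i) else 0"
        have iT: "insert q ?T = T" using True by auto
        have qd: "q < d" using True T by auto
        have M: "Min (insert i T) = q" if "i \<in> Poly_Mapping.keys a" for i
          using T True q(2) that by (intro Min_eqI) auto
        \<comment> \<open>Compared with \<open>T - {q}\<close>, the set \<open>T\<close> has one
          more element below \<open>i\<close>, namely \<open>q\<close>; this accounts for the
          sign.\<close>
        have tr: "?t i = - ?r i" if i: "i \<in> {..<d} - T" for i
        proof (cases "i \<in> Poly_Mapping.keys a")
          case ia: True
          have "q < i" using q(2)[of i] ia i True by (cases "i = q") auto
          then have c: "card {j\<in>T. j < i} = Suc (card {j\<in>?T. j < i})"
            using card_less_insert[of ?T q i] T(2) unfolding iT by simp
          have "a + ?e q - ?e i = a - ?e i + ?e q"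
            using ia \<open>q < i\<close> by (intro poly_mapping_eqI)
              (auto simp: lookup_add lookup_minus lookup_single in_keys_iff when_def)
          moreover have "insert i T - {q} = insert i ?T" using \<open>q < i\<close> by auto
          moreover have "Poly_Mapping.lookup (koszul_contract d u (insert i T)) (a - ?e i) =
              Poly_Mapping.lookup (u (insert i T - {q})) (a - ?e i + ?e q)"
            using T(1) i q(2) keys_diff by (auto simp: lookup_koszul_contract M[OF ia])
          ultimately show ?thesis using ia c by (simp add: keys_add_nat)
        next
          case False
          then show ?thesis using i True by (auto simp: keys_add_nat)
        qed
        have "{j\<in>?T. j < q} = {}" using q(2) by fastforce
        then have c: "card {j\<in>?T. j < q} = 0" by (simp only: card.empty)
        have rq: "?r q = Poly_Mapping.lookup (u T) a" by (subst c) (simp add: keys_add_nat insert_absorb[OF True])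
        \<comment> \<open>The cycle condition at \<open>x^a x_q e_(T - {q})\<close>: its summand
          with index \<open>q\<close> is the coefficient of \<open>u\<close> in question, and its
          other summands are those of the claim up to sign.\<close>
        have "0 = Poly_Mapping.lookup (koszul_diff d u ?T) (a + ?e q)" using du by simp
        also have "\<dots> = (\<Sum>i\<in>{..<d} - ?T. ?r i)"
          using T(1) by (intro lookup_koszul_diff) auto
        also have "{..<d} - ?T = insert q ({..<d} - T)" using True qd by auto
        also have "(\<Sum>i\<in>insert q ({..<d} - T). ?r i) = ?r q + (\<Sum>i\<in>{..<d} - T. ?r i)"
          using True by (intro sum.insert) auto
        also note rq
        also have "(\<Sum>i\<in>{..<d} - T. ?r i) = - (\<Sum>i\<in>{..<d} - T. ?t i)"
          unfolding sum_negf[symmetric] by (rule sum.cong[OF refl]) (simp add: tr)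
        finally show ?thesis using sum by simp
      qed
    qed
  qed
qed

section \<open>The residue field and its resolutions\<close>

lemma with_grading_simps [simp]:
  "carrier (with_grading M c) = carrier M" "\<zero>\<^bsub>with_grading M c\<^esub> = \<zero>\<^bsub>M\<^esub>"
  "x \<oplus>\<^bsub>with_grading M c\<^esub> y = x \<oplus>\<^bsub>M\<^esub> y" "r \<odot>\<^bsub>with_grading M c\<^esub> x = r \<odot>\<^bsub>M\<^esub> x"
  "hcomp (with_grading M c) = c"
  by (simp_all add: with_grading_def module.defs graded_module.defs)

text \<open>Transfers the module axioms between records that differ only in additional fields such
  as a grading.\<close>

lemma module_cong:
  fixes M :: "('r, 'a, 'u) module_scheme" and N :: "('r, 'a, 'v) module_scheme"
  assumes M: "Module.module R M" and "carrier N = carrier M" "\<zero>\<^bsub>N\<^esub> = \<zero>\<^bsub>M\<^esub>"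
    "\<And>x y. x \<oplus>\<^bsub>N\<^esub> y = x \<oplus>\<^bsub>M\<^esub> y" "\<And>r x. r \<odot>\<^bsub>N\<^esub> x = r \<odot>\<^bsub>M\<^esub> x"
  shows "Module.module R N"
proof -
  interpret M: Module.module R M by fact
  have "\<exists>y\<in>carrier M. y \<oplus>\<^bsub>M\<^esub> x = \<zero>\<^bsub>M\<^esub>" if "x \<in> carrier M" for x
    using that M.l_neg by blast
  then have "abelian_group N"
    by (intro abelian_groupI) (simp_all add: assms M.a_ac)
  then show ?thesis
    by (intro moduleI M.is_cring) (simp_all add: assms M.smult_l_distr M.smult_r_distr M.smult_assoc1)
qed

lemma mod_hom_with_grading [simp]: "mod_hom R M (with_grading N c) = mod_hom R M N"
  by (simp add: mod_hom_def)

lemma poly_module_simps [simp]: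
  "carrier (poly_module d) = carrier (mpoly_ring d)" "\<zero>\<^bsub>poly_module d\<^esub> = 0"
  "p \<oplus>\<^bsub>poly_module d\<^esub> q = p + q" "p \<odot>\<^bsub>poly_module d\<^esub> q = p * q"
  by (simp_all add: poly_module_def)

lemma poly_module_is_module: "Module.module (mpoly_ring d) (poly_module d :: ('k::field mpol, 'k mpol) graded_module)"
proof (rule moduleI[OF mpoly_cring])
  show "abelian_group (poly_module d :: ('k mpol, 'k mpol) graded_module)"
  proof (rule abelian_groupI)
    fix p :: "'k mpol" assume "p \<in> carrier (poly_module d)"
    then show "\<exists>q\<in>carrier (poly_module d). q \<oplus>\<^bsub>poly_module d\<^esub> p = \<zero>\<^bsub>poly_module d\<^esub>"
      by (intro bexI[of _ "- p"]) simp_all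
  qed (simp_all add: ac_simps)
qed (simp_all add: algebra_simps)

lemma poly_module_a_inv: "p \<in> carrier (mpoly_ring d) \<Longrightarrow> \<ominus>\<^bsub>poly_module d\<^esub> p = - p"
  by (rule abelian_group.minus_equality[OF Module.module.axioms(2)[OF poly_module_is_module]]) simp_all

lemma poly_module_finsum:
  fixes f :: "'s \<Rightarrow> 'k::field mpol"
  assumes "f \<in> A \<rightarrow> carrier (mpoly_ring d)"
  shows "(\<Oplus>\<^bsub>poly_module d\<^esub>a\<in>A. f a) = sum f A"
proof -
  interpret Module.module "mpoly_ring d" "poly_module d :: ('k mpol, 'k mpol) graded_module"
    by (rule poly_module_is_module)
  show ?thesis using assms
  proof (induction A rule: infinite_finite_induct)
    case (insert a A)
    then have "(\<Oplus>\<^bsub>poly_module d\<^esub>a\<in>insert a A. f a) = f a \<oplus>\<^bsub>poly_module d\<^esub> (\<Oplus>\<^bsub>poly_module d\<^esub>a\<in>A. f a)"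
      by (intro M.finsum_insert) auto
    with insert show ?case by auto
  qed (auto simp: M.finsum_infinite)
qed

abbreviation max_ideal :: "nat \<Rightarrow> 'k::field mpol set" where
  "max_ideal d \<equiv> Idl\<^bsub>mpoly_ring d\<^esub> (mpoly_var ` {..<d})"

lemma mpoly_var_closed: "i < d \<Longrightarrow> mpoly_var i \<in> carrier (mpoly_ring d)"
  by (simp add: mpoly_var_def)

text \<open>In one direction it makes the quotient lemmas available for the ideal of the variables;
  in the other it turns images of linear maps into ideals, so that generation can be used.\<close>

lemma ideal_iff_submodule:
  fixes I :: "'k::field mpol set"
  shows "ideal I (mpoly_ring d) \<longleftrightarrow> submodule I (mpoly_ring d) (poly_module d)"
  (is "?i = ?s")
proof
  interpret R: cring "mpoly_ring d :: 'k mpol ring" by (rule mpoly_cring)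
  interpret M: Module.module "mpoly_ring d" "poly_module d :: ('k mpol, 'k mpol) graded_module"
    by (rule poly_module_is_module)
  show ?s if ?i
  proof -
    interpret I: ideal I "mpoly_ring d" by fact
    show ?s
    proof (rule M.submoduleI)
      show "I \<subseteq> carrier (poly_module d)" using I.a_subset by simp
      show "\<zero>\<^bsub>poly_module d\<^esub> \<in> I" using I.zero_closed by simp
      show "\<ominus>\<^bsub>poly_module d\<^esub> a \<in> I" if "a \<in> I" for a
        using I.a_inv_closed[OF that] I.a_Hcarr[OF that] by (simp add: mpoly_a_inv poly_module_a_inv)
      show "a \<oplus>\<^bsub>poly_module d\<^esub> b \<in> I" if "a \<in> I" "b \<in> I" for a b
        using I.a_closed[OF that] by simp
      show "a \<odot>\<^bsub>poly_module d\<^esub> x \<in> I" if "a \<in> carrier (mpoly_ring d)" "x \<in> I" for a x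
        using I.I_l_closed[OF that(2,1)] by simp
    qed
  qed
  show ?i if ?s
  proof (rule idealI)
    note E = M.submoduleE[OF that]
    have sub: "a \<in> carrier (mpoly_ring d)" if "a \<in> I" for a using E(1) that by auto
    show "subgroup I (add_monoid (mpoly_ring d))"
    proof (rule R.add.subgroupI)
      show "\<ominus>\<^bsub>mpoly_ring d\<^esub> a \<in> I" if "a \<in> I" for a
        using E(3)[OF that] sub[OF that] by (simp add: mpoly_a_inv poly_module_a_inv)
    qed (use E sub in auto)
    show "x \<otimes>\<^bsub>mpoly_ring d\<^esub> a \<in> I" "a \<otimes>\<^bsub>mpoly_ring d\<^esub> x \<in> I" if "a \<in> I" "x \<in> carrier (mpoly_ring d)" for a x
      using E(4)[OF that(2,1)] by (simp_all add: mult.commute)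
  qed (rule R.ring_axioms)
qed

lemma max_ideal_ideal: "ideal (max_ideal d :: 'k::field mpol set) (mpoly_ring d)"
proof -
  interpret R: cring "mpoly_ring d :: 'k mpol ring" by (rule mpoly_cring)
  show ?thesis by (rule R.genideal_ideal) (auto simp: mpoly_var_closed)
qed

lemmas max_ideal_submodule = max_ideal_ideal[unfolded ideal_iff_submodule]

lemma residue_module_is_module:
  "Module.module (mpoly_ring d) (residue_module d :: ('k::field mpol, 'k mpol set) graded_module)"
  by (rule module_cong[OF quotient_module_is_module[OF poly_module_is_module max_ideal_submodule]])
    (simp_all add: residue_module_def graded_quotient_def)

definition koszul_aug :: "nat \<Rightarrow> (nat set \<Rightarrow> 'k::field mpol) \<Rightarrow> 'k mpol set" where
  "koszul_aug d u = max_ideal d +>\<^bsub>poly_module d\<^esub> u {}"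

lemma koszul_eval_hom: "(\<lambda>u. u S) \<in> mod_hom (mpoly_ring d) (koszul_module d n) (poly_module d)"
  by (rule mod_homI) (simp_all add: koszul_carrierD)

lemma koszul_aug_hom: "koszul_aug d \<in> mod_hom (mpoly_ring d) (koszul_module d 0) (residue_module d)"
  using mod_hom_comp[OF koszul_eval_hom quotient_proj[OF poly_module_is_module max_ideal_submodule]]
  by (simp add: koszul_aug_def[abs_def] residue_module_def graded_quotient_def)

lemma empty_subsets_of_card [simp]: "subsets_of_card d 0 = {{}}"
  by (auto simp: subsets_of_card_def dest: finite_subset)

lemma koszul_aug_surj:
  "koszul_aug d ` carrier (koszul_module d 0) = carrier (residue_module d :: ('k::field mpol, 'k mpol set) graded_module)"
proof -
  have "koszul_aug d (\<lambda>S. if S = {} then p else 0) = max_ideal d +>\<^bsub>poly_module d\<^esub> p"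
    "(\<lambda>S. if S = {} then p else 0) \<in> carrier (koszul_module d 0)"
    if "p \<in> carrier (mpoly_ring d)" for p :: "'k mpol"
    using that unfolding koszul_carrier by (auto simp: koszul_aug_def)
  moreover have "carrier (residue_module d) = (\<lambda>p :: 'k mpol. max_ideal d +>\<^bsub>poly_module d\<^esub> p) ` carrier (mpoly_ring d)"
    by (simp add: residue_module_def graded_quotient_def quotient_carrier[OF poly_module_is_module max_ideal_submodule])
  ultimately have "carrier (residue_module d) \<subseteq> koszul_aug d ` carrier (koszul_module d 0 :: ('k mpol, _) module)"
    by (auto intro: image_eqI[OF sym])
  then show ?thesis using mod_homD(1)[OF koszul_aug_hom] by blast
qed

text \<open>Exactness at degree 0. The entries at \<open>{}\<close> of boundaries form an ideal that
  contains every variable and consists of combinations of variables, so it is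
  \<open>max_ideal d\<close>; and an element of degree 0 is determined by its entry at
  \<open>{}\<close>.\<close>

lemma koszul_aug_eq_zero:
  fixes u :: "nat set \<Rightarrow> 'k::field mpol"
  assumes u: "u \<in> carrier (koszul_module d 0)"
  shows "koszul_aug d u = \<zero>\<^bsub>residue_module d\<^esub> \<longleftrightarrow> u \<in> koszul_diff d ` carrier (koszul_module d (Suc 0))"
proof -
  let ?R = "mpoly_ring d" and ?h = "\<lambda>w :: nat set \<Rightarrow> 'k mpol. koszul_diff d w {}"
  have h: "?h \<in> mod_hom ?R (koszul_module d (Suc 0)) (poly_module d)"
    by (rule mod_hom_comp[OF koszul_diff_hom koszul_eval_hom])
  let ?J = "?h ` carrier (koszul_module d (Suc 0))"
  have J: "ideal ?J ?R"
    unfolding ideal_iff_submodule by (rule mod_hom_image_submodule[OF koszul_module_is_module poly_module_is_module h])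
  have "max_ideal d \<subseteq> ?J"
  proof (rule ring.genideal_minimal[OF cring.axioms(1)[OF mpoly_cring] J], clarify)
    fix i assume i: "i < d"
    \<comment> \<open>The basis element \<open>e_{i}\<close>, whose differential is
      \<open>x_i\<close>.\<close>
    let ?w = "\<lambda>S. if S = {i} then 1 else 0 :: 'k mpol"
    have "?w \<in> carrier (koszul_module d (Suc 0))" using i unfolding koszul_carrier by (auto simp: subsets_of_card_def)
    moreover have "?h ?w = mpoly_var i"
      using i by (simp add: koszul_diff_def koszul_coeff_def mpoly_var_def if_distrib[of "(*) _"] cong: if_cong)
    ultimately show "mpoly_var i \<in> ?J" by (intro image_eqI) auto
  qed
  moreover have "?J \<subseteq> max_ideal d"
  proof clarify
    fix w :: "nat set \<Rightarrow> 'k mpol" assume w: "w \<in> carrier (koszul_module d (Suc 0))"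
    interpret I: ideal "max_ideal d :: 'k mpol set" ?R by (rule max_ideal_ideal)
    have "mpoly_var ` {..<d} \<subseteq> (max_ideal d :: 'k mpol set)"
      by (rule ring.genideal_self[OF cring.axioms(1)[OF mpoly_cring]]) (auto simp: mpoly_var_closed)
    then have var: "mpoly_var i \<in> (max_ideal d :: 'k mpol set)" if "i < d" for i using that by auto
    have "\<zero>\<^bsub>?R\<^esub> \<in> (max_ideal d :: 'k mpol set)"
      by (rule additive_subgroup.zero_closed[OF ideal.axioms(1)[OF max_ideal_ideal]])
    then have zero: "0 \<in> (max_ideal d :: 'k mpol set)" by simp
    have sumI: "sum f A \<in> max_ideal d" if "\<And>i. i \<in> A \<Longrightarrow> f i \<in> max_ideal d" for f :: "nat \<Rightarrow> 'k mpol" and A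
      using that
    proof (induction A rule: infinite_finite_induct)
      case (insert x F)
      have "f x \<in> max_ideal d" "sum f F \<in> max_ideal d" using insert by auto
      then have "f x \<oplus>\<^bsub>?R\<^esub> sum f F \<in> max_ideal d"
        by (rule additive_subgroup.a_closed[OF ideal.axioms(1)[OF max_ideal_ideal]])
      then show ?case using insert.hyps by simp
    qed (simp_all add: zero)
    have "koszul_coeff i {} = (mpoly_var i :: 'k mpol)" for i
      by (simp add: koszul_coeff_def mpoly_var_def)
    moreover have "mpoly_var i * w S \<in> max_ideal d" if "i < d" for i S
      using I.I_r_closed[OF var[OF that] koszul_carrierD[OF w]] by simp
    ultimately show "?h w \<in> max_ideal d" by (auto simp: koszul_diff_def intro!: sumI)
  qed
  ultimately have J_eq: "max_ideal d = ?J" by blast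
  have "koszul_aug d u = \<zero>\<^bsub>residue_module d\<^esub> \<longleftrightarrow> u {} \<in> max_ideal d"
    using coset_eq_self_iff[OF poly_module_is_module max_ideal_submodule, of "u {}"] koszul_carrierD[OF u]
    by (simp add: koszul_aug_def residue_module_def graded_quotient_def quotient_zero[OF poly_module_is_module max_ideal_submodule])
  also have "\<dots> \<longleftrightarrow> u \<in> koszul_diff d ` carrier (koszul_module d (Suc 0))"
  proof
    assume "u {} \<in> max_ideal d"
    then obtain w where w: "w \<in> carrier (koszul_module d (Suc 0))" "u {} = koszul_diff d w {}"
      unfolding J_eq by blast
    have "koszul_diff d w \<in> carrier (koszul_module d 0)" by (rule mod_homD(1)[OF koszul_diff_hom w(1)])
    with u have "koszul_diff d w S = u S" for S using w(2) unfolding koszul_carrier by (cases "S = {}") simp_all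
    then have "koszul_diff d w = u" by (rule ext)
    with w(1) show "u \<in> koszul_diff d ` carrier (koszul_module d (Suc 0))" by blast
  qed (auto simp: J_eq)
  finally show ?thesis .
qed

lemma koszul_minus:
  assumes "u \<in> carrier (koszul_module d n)" "v \<in> carrier (koszul_module d n)"
  shows "(u \<ominus>\<^bsub>koszul_module d n\<^esub> v) T = u T - v T"
proof -
  have "(u \<ominus>\<^bsub>koszul_module d n\<^esub> v) T = u T \<ominus>\<^bsub>poly_module d\<^esub> v T"
    by (rule mod_hom_minus[OF koszul_module_is_module poly_module_is_module koszul_eval_hom assms])
  then show ?thesis using assms by (simp add: a_minus_def poly_module_a_inv koszul_carrierD)
qed

text \<open>The sum runs over all subsets of the given size instead of the support of
  \<open>u\<close>; with fixed finite index sets double sums can be exchanged later.\<close>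

lemma koszul_hom_expand:
  fixes Q :: "('k::field mpol, 'q, 'w) module_scheme"
  assumes Q: "Module.module (mpoly_ring d) Q" and h: "h \<in> mod_hom (mpoly_ring d) (koszul_module d n) Q"
    and u: "u \<in> carrier (koszul_module d n)"
  shows "h u = (\<Oplus>\<^bsub>Q\<^esub>S\<in>subsets_of_card d n. u S \<odot>\<^bsub>Q\<^esub> h (free_gen (mpoly_ring d) S))"
proof -
  let ?R = "mpoly_ring d :: 'k mpol ring" and ?\<phi> = "\<lambda>S. h (free_gen (mpoly_ring d) S)"
  interpret R: cring ?R by (rule mpoly_cring)
  have \<phi>: "?\<phi> \<in> subsets_of_card d n \<rightarrow> carrier Q"
    using mod_homD(1)[OF h R.free_gen_closed] by auto
  have "h u = lincomb ?R Q ?\<phi> u"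
    by (rule R.free_module_hom_eqI[OF Q h R.lincomb_hom[OF Q \<phi>] _ u])
      (rule R.lincomb_free_gen[OF Q, symmetric], use \<phi> in auto)
  also have "\<dots> = (\<Oplus>\<^bsub>Q\<^esub>S\<in>subsets_of_card d n. u S \<odot>\<^bsub>Q\<^esub> ?\<phi> S)"
    by (rule R.lincomb_superset[OF Q _ _ _ \<phi>]) (use u in \<open>auto simp: koszul_carrier\<close>)
  finally show ?thesis .
qed

text \<open>Here \<open>f\<close> and \<open>g\<close> lift the identity of the residue field, so
  \<open>g f\<close> minus the identity lifts zero and is null homotopic. The homotopy is stated
  entry by entry, the form in which it is evaluated on tensors later. The case \<open>n = 0\<close>
  is separate because \<open>0 - 1\<close> is \<open>0\<close> for natural numbers.\<close>

lemma koszul_comparison: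
  fixes P :: "('k::field mpol, 'p) graded_complex"
  assumes P: "graded_free_resolution d P (residue_module d :: ('k mpol, 'k mpol set) graded_module)"
  obtains f g s where
    "\<And>n. f n \<in> mod_hom (mpoly_ring d) (koszul_module d n) (cobj P (int n))"
    "\<And>n x. x \<in> carrier (koszul_module d (Suc n)) \<Longrightarrow> cdiff P (int (Suc n)) (f (Suc n) x) = f n (koszul_diff d x)"
    "\<And>n. g n \<in> mod_hom (mpoly_ring d) (cobj P (int n)) (koszul_module d n)"
    "\<And>n x. x \<in> carrier (cobj P (int (Suc n))) \<Longrightarrow> koszul_diff d (g (Suc n) x) = g n (cdiff P (int (Suc n)) x)"
    "\<And>n. s n \<in> mod_hom (mpoly_ring d) (koszul_module d n) (koszul_module d (Suc n))"
    "\<And>n x T. x \<in> carrier (koszul_module d n) \<Longrightarrow>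
      g n (f n x) T = x T + koszul_diff d (s n x) T + (if n = 0 then 0 else s (n - 1) (koszul_diff d x) T)"
proof -
  let ?R = "mpoly_ring d :: 'k mpol ring"
  let ?K = "\<lambda>n. koszul_module d n :: ('k mpol, nat set \<Rightarrow> 'k mpol) module"
  interpret P: graded_free_resolution d P "residue_module d :: ('k mpol, 'k mpol set) graded_module" by fact
  interpret R: cring ?R by (rule mpoly_cring)
  let ?E = "\<lambda>n. cobj P (int n)" and ?dE = "\<lambda>n. cdiff P (int (Suc n))"
  have K: "Module.module ?R (?K n)" for n by (rule koszul_module_is_module)
  have E: "Module.module ?R (?E n)" for n using P.cobj_graded by (rule graded_module.axioms(1))
  have k: "Module.module ?R (residue_module d :: ('k mpol, 'k mpol set) graded_module)"
    by (rule residue_module_is_module)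
  have jK: "(\<lambda>x. x) \<in> mod_hom ?R (free_module ?R (subsets_of_card d n)) (?K n)"
    "bij_betw (\<lambda>x. x) (carrier (free_module ?R (subsets_of_card d n))) (carrier (?K n))" for n
    by (auto intro: mod_hom_id bij_betw_id[unfolded id_def])
  have "\<exists>B. module_basis ?R (?E n) B" for n using P.cobj_free[of "int n"] by (auto simp: graded_free_def)
  then obtain B where B: "\<And>n. module_basis ?R (?E n) (B n)" by metis
  note jE = R.module_basis_free_module[OF E B]
  have dE: "?dE n \<in> mod_hom ?R (?E (Suc n)) (?E n)" for n
    using P.cdiff_hom[of "int (Suc n)"] by (simp add: graded_hom_def)
  have dEdE: "?dE n (?dE (Suc n) x) = \<zero>\<^bsub>?E n\<^esub>" if "x \<in> carrier (?E (Suc (Suc n)))" for n x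
    using P.cdiff_cdiff[OF that] by (simp add: algebra_simps)
  have exE: "x \<in> ?dE (Suc n) ` carrier (?E (Suc (Suc n)))"
    if "x \<in> carrier (?E (Suc n))" "?dE n x = \<zero>\<^bsub>?E n\<^esub>" for n x
    using P.exact[of "int (Suc n)"] that by (auto simp: algebra_simps set_eq_iff)
  have dKdK: "koszul_diff d (koszul_diff d x) = \<zero>\<^bsub>?K n\<^esub>" if "x \<in> carrier (?K (Suc (Suc n)))" for n x
    by (simp add: koszul_diff_diff fun_eq_iff)
  have exK: "x \<in> koszul_diff d ` carrier (?K (Suc (Suc n)))"
    if "x \<in> carrier (?K (Suc n))" "koszul_diff d x = \<zero>\<^bsub>?K n\<^esub>" for n x
    using koszul_exact[OF that(1)] koszul_contract_closed[OF that(1)] that(2) by (metis image_eqI free_module_simps(1) mpoly_ring_simps(1))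
  obtain \<epsilon> where \<epsilon>: "\<epsilon> \<in> mod_hom ?R (?E 0) (residue_module d)"
    "\<epsilon> ` carrier (?E 0) = carrier (residue_module d)"
    "{x \<in> carrier (?E 0). \<epsilon> x = \<zero>\<^bsub>residue_module d\<^esub>} = ?dE 0 ` carrier (?E (Suc 0))"
    using P.augmentation by (auto simp: graded_hom_def)
  have aug: "koszul_aug d \<in> mod_hom ?R (?K 0) (residue_module d)" by (rule koszul_aug_hom)
  obtain f0 where f0: "f0 \<in> mod_hom ?R (?K 0) (?E 0)" "\<And>x. x \<in> carrier (?K 0) \<Longrightarrow> \<epsilon> (f0 x) = koszul_aug d x"
    using R.free_lift[OF K k jK aug E \<epsilon>(1)] mod_homD(1)[OF aug] \<epsilon>(2) by blast
  obtain g0 where g0: "g0 \<in> mod_hom ?R (?E 0) (?K 0)" "\<And>x. x \<in> carrier (?E 0) \<Longrightarrow> koszul_aug d (g0 x) = \<epsilon> x"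
    using R.free_lift[OF E k jE \<epsilon>(1) K aug] mod_homD(1)[OF \<epsilon>(1)] koszul_aug_surj by blast
  have f0d: "f0 (koszul_diff d x) \<in> ?dE 0 ` carrier (?E (Suc 0))" if x: "x \<in> carrier (?K (Suc 0))" for x
  proof -
    have dx: "koszul_diff d x \<in> carrier (?K 0)" by (rule mod_homD(1)[OF koszul_diff_hom x])
    have "\<epsilon> (f0 (koszul_diff d x)) = \<zero>\<^bsub>residue_module d\<^esub>"
      using f0(2)[OF dx] koszul_aug_eq_zero[OF dx] x by simp
    then show ?thesis using \<epsilon>(3) mod_homD(1)[OF f0(1) dx] by blast
  qed
  have g0d: "g0 (?dE 0 x) \<in> koszul_diff d ` carrier (?K (Suc 0))" if x: "x \<in> carrier (?E (Suc 0))" for x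
  proof -
    have dx: "?dE 0 x \<in> carrier (?E 0)" by (rule mod_homD(1)[OF dE x])
    have "\<epsilon> (?dE 0 x) = \<zero>\<^bsub>residue_module d\<^esub>" using \<epsilon>(3) x by blast
    then show ?thesis using g0(2)[OF dx] koszul_aug_eq_zero[OF mod_homD(1)[OF g0(1) dx]] by simp
  qed
  obtain f where f: "f 0 = f0" "\<And>n. f n \<in> mod_hom ?R (?K n) (?E n)"
    "\<And>n x. x \<in> carrier (?K (Suc n)) \<Longrightarrow> ?dE n (f (Suc n) x) = f n (koszul_diff d x)"
    using comparison_theorem[where C = ?K and E = ?E and dC = "\<lambda>_. koszul_diff d" and dE = ?dE,
        OF K E jK koszul_diff_hom dE dKdK exE f0(1) f0d] by blast
  obtain g where g: "g 0 = g0" "\<And>n. g n \<in> mod_hom ?R (?E n) (?K n)"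
    "\<And>n x. x \<in> carrier (?E (Suc n)) \<Longrightarrow> koszul_diff d (g (Suc n) x) = g n (?dE n x)"
    using comparison_theorem[where C = ?E and E = ?K and dE = "\<lambda>_. koszul_diff d" and dC = ?dE,
        OF E K jE dE koszul_diff_hom dEdE exK g0(1) g0d] by blast
  let ?\<phi> = "\<lambda>n x. g n (f n x) \<ominus>\<^bsub>?K n\<^esub> x"
  have gf: "(\<lambda>x. g n (f n x)) \<in> mod_hom ?R (?K n) (?K n)" for n by (rule mod_hom_comp[OF f(2) g(2)])
  have \<phi>: "?\<phi> n \<in> mod_hom ?R (?K n) (?K n)" for n
    by (rule mod_hom_diff[OF K K gf mod_hom_id])
  have \<phi>d: "koszul_diff d (?\<phi> (Suc n) x) = ?\<phi> n (koszul_diff d x)" if x: "x \<in> carrier (?K (Suc n))" for n x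
    using mod_hom_minus[OF K K koszul_diff_hom mod_homD(1)[OF gf x] x]
    unfolding g(3)[OF mod_homD(1)[OF f(2) x]] f(3)[OF x] .
  \<comment> \<open>Both \<open>g0 f0\<close> and the identity are compatible with the augmentation,
    so their difference lands in its kernel, which is the image of the differential.\<close>
  have \<phi>0: "?\<phi> 0 x \<in> koszul_diff d ` carrier (?K (Suc 0))" if x: "x \<in> carrier (?K 0)" for x
  proof -
    interpret k: Module.module ?R "residue_module d :: ('k mpol, 'k mpol set) graded_module" by (rule k)
    have "koszul_aug d (?\<phi> 0 x) = koszul_aug d (g0 (f0 x)) \<ominus>\<^bsub>residue_module d\<^esub> koszul_aug d x"
      using mod_hom_minus[OF K k aug mod_homD(1)[OF gf x] x] by (simp add: f(1) g(1))
    also have "koszul_aug d (g0 (f0 x)) = koszul_aug d x"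
      using g0(2) f0(2) x mod_homD(1)[OF f0(1) x] by simp
    also have "koszul_aug d x \<ominus>\<^bsub>residue_module d\<^esub> koszul_aug d x = \<zero>\<^bsub>residue_module d\<^esub>"
      using mod_homD(1)[OF aug x] k.diff_eq_zero_iff by blast
    finally show ?thesis using koszul_aug_eq_zero[OF mod_homD(1)[OF \<phi> x]] by simp
  qed
  obtain s where s: "\<And>n. s n \<in> mod_hom ?R (?K n) (?K (Suc n))"
    "\<And>x. x \<in> carrier (?K 0) \<Longrightarrow> koszul_diff d (s 0 x) = ?\<phi> 0 x"
    "\<And>n x. x \<in> carrier (?K (Suc n)) \<Longrightarrow> koszul_diff d (s (Suc n) x) = ?\<phi> (Suc n) x \<ominus>\<^bsub>?K (Suc n)\<^esub> s n (koszul_diff d x)"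
    using null_homotopic[where C = ?K and E = ?K and dE = "\<lambda>_. koszul_diff d" and dC = "\<lambda>_. koszul_diff d",
        OF K K jK koszul_diff_hom koszul_diff_hom dKdK exK \<phi> \<phi>d \<phi>0] by blast
  show thesis
  proof (rule that[of f g s])
    fix n x T assume x: "x \<in> carrier (?K n)"
    show "g n (f n x) T = x T + koszul_diff d (s n x) T + (if n = 0 then 0 else s (n - 1) (koszul_diff d x) T)"
    proof (cases n)
      case 0
      then show ?thesis using s(2)[of x] koszul_minus[OF mod_homD(1)[OF gf x] x, of T] x by simp
    next
      case (Suc m)
      have "s m (koszul_diff d x) \<in> carrier (?K n)"
        using x unfolding Suc by (intro mod_homD(1)[OF s(1)] mod_homD(1)[OF koszul_diff_hom])
      then have "koszul_diff d (s n x) T = ?\<phi> n x T - s m (koszul_diff d x) T"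
        using s(3)[of x m] x koszul_minus[OF mod_homD(1)[OF \<phi> x]] Suc by simp
      then show ?thesis using koszul_minus[OF mod_homD(1)[OF gf x] x, of T] Suc by simp
    qed
  qed (use f g s in auto)
qed

section \<open>The Koszul complex with coefficients in a differential module\<close>

text \<open>For finite \<open>S\<close> this is the free module on \<open>S\<close> tensored with
  \<open>M\<close>. It replaces the tensor product on the Koszul side.\<close>

definition fun_module :: "'s set \<Rightarrow> ('r, 'a, 'u) module_scheme \<Rightarrow> ('r, 's \<Rightarrow> 'a) module" where
  "fun_module S M =
     \<lparr> carrier = {u. (\<forall>s\<in>S. u s \<in> carrier M) \<and> (\<forall>s. s \<notin> S \<longrightarrow> u s = \<zero>\<^bsub>M\<^esub>)},
       monoid.mult = undefined, one = undefined,
       zero = (\<lambda>s. \<zero>\<^bsub>M\<^esub>), add = (\<lambda>u v s. u s \<oplus>\<^bsub>M\<^esub> v s), smult = (\<lambda>r u s. r \<odot>\<^bsub>M\<^esub> u s) \<rparr>"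

lemma fun_module_simps [simp]:
  "\<zero>\<^bsub>fun_module S M\<^esub> = (\<lambda>s. \<zero>\<^bsub>M\<^esub>)"
  "u \<oplus>\<^bsub>fun_module S M\<^esub> v = (\<lambda>s. u s \<oplus>\<^bsub>M\<^esub> v s)"
  "r \<odot>\<^bsub>fun_module S M\<^esub> u = (\<lambda>s. r \<odot>\<^bsub>M\<^esub> u s)"
  by (simp_all add: fun_module_def)

lemma fun_module_carrier:
  "u \<in> carrier (fun_module S M) \<longleftrightarrow> (\<forall>s\<in>S. u s \<in> carrier M) \<and> (\<forall>s. s \<notin> S \<longrightarrow> u s = \<zero>\<^bsub>M\<^esub>)"
  by (simp add: fun_module_def)

lemma fun_module_closed:
  assumes "Module.module R M" "u \<in> carrier (fun_module S M)"
  shows "u s \<in> carrier M"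
proof -
  interpret Module.module R M by fact
  show ?thesis using assms(2) by (cases "s \<in> S") (auto simp: fun_module_carrier)
qed

lemma fun_module_is_module:
  assumes "Module.module R M"
  shows "Module.module R (fun_module S M)"
proof -
  interpret M: Module.module R M by fact
  note closed = fun_module_closed[OF assms]
  have "abelian_group (fun_module S M)"
  proof (rule abelian_groupI)
    fix u assume u: "u \<in> carrier (fun_module S M)"
    have "(\<lambda>s. \<ominus>\<^bsub>M\<^esub> u s) \<in> carrier (fun_module S M)" using u by (auto simp: fun_module_carrier)
    then show "\<exists>v\<in>carrier (fun_module S M). v \<oplus>\<^bsub>fun_module S M\<^esub> u = \<zero>\<^bsub>fun_module S M\<^esub>"
      by (rule bexI[rotated]) (simp add: closed[OF u] M.l_neg)
  qed (auto simp: closed M.a_ac, auto simp: fun_module_carrier)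
  then show ?thesis
    by (intro moduleI M.is_cring) (auto simp: closed M.smult_l_distr M.smult_r_distr M.smult_assoc1,
      auto simp: fun_module_carrier)
qed

lemma fun_module_eval_hom:
  "Module.module R M \<Longrightarrow> (\<lambda>u. u s) \<in> mod_hom R (fun_module S M) M"
  by (rule mod_homI) (simp_all add: fun_module_closed)

text \<open>The multidegree of the Koszul basis element \<open>e_S\<close>, which makes the
  differential homogeneous of degree 0.\<close>

definition set_deg :: "nat set \<Rightarrow> mdeg" where
  "set_deg S = (\<Sum>i\<in>S. Poly_Mapping.single i 1)"

lemma set_deg_insert: "\<lbrakk>finite S; i \<notin> S\<rbrakk> \<Longrightarrow> set_deg (insert i S) = Poly_Mapping.single i 1 + set_deg S"
  by (simp add: set_deg_def)

lemma mdegs_intros: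
  "m \<in> mdegs d \<Longrightarrow> n \<in> mdegs d \<Longrightarrow> m + n \<in> mdegs d"
  "m \<in> mdegs d \<Longrightarrow> n \<in> mdegs d \<Longrightarrow> m - n \<in> mdegs d"
  "i < d \<Longrightarrow> Poly_Mapping.single i c \<in> mdegs d"
  "0 \<in> mdegs d"
  using Poly_Mapping.keys_add[of m n] Poly_Mapping.keys_diff[of m n] by (auto simp: mdegs_def)

lemma set_deg_mdegs:
  assumes "S \<subseteq> {..<d}"
  shows "set_deg S \<in> mdegs d"
proof -
  have "finite S" using assms finite_subset by blast
  then show ?thesis using assms
    by (induction S rule: finite_induct) (auto simp: set_deg_insert mdegs_intros, simp add: set_deg_def mdegs_intros)
qed

locale koszul_tensor = graded_diff_module d D
  for d :: nat and D :: "('k::field mpol, 'm) graded_diff_module" +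
  assumes ddeg_zero: "ddeg D = 0"
begin

abbreviation "R \<equiv> mpoly_ring d :: 'k mpol ring"

lemma D_module: "Module.module R D" by (rule module_axioms)

lemma dmap_mod_hom: "dmap D \<in> mod_hom R D D"
  using dmap_hom by (simp add: graded_hom_def mod_hom_def shift_def)

lemma dmap_hcomp: "\<lbrakk>m \<in> mdegs d; x \<in> hcomp D m\<rbrakk> \<Longrightarrow> dmap D x \<in> hcomp D m"
  using dmap_hom by (auto simp: graded_hom_def shift_def ddeg_zero image_subset_iff)

lemmas dmap_closed [simp] = mod_homD(1)[OF dmap_mod_hom]

lemma hcomp_props:
  assumes "m \<in> mdegs d"
  shows hcomp_carrier: "x \<in> hcomp D m \<Longrightarrow> x \<in> carrier D"
    and hcomp_zero: "\<zero>\<^bsub>D\<^esub> \<in> hcomp D m"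
    and hcomp_add: "\<lbrakk>x \<in> hcomp D m; y \<in> hcomp D m\<rbrakk> \<Longrightarrow> x \<oplus>\<^bsub>D\<^esub> y \<in> hcomp D m"
    and hcomp_a_inv: "x \<in> hcomp D m \<Longrightarrow> \<ominus>\<^bsub>D\<^esub> x \<in> hcomp D m"
  using hcomp_subgroup[OF assms] subgroup.mem_carrier subgroup.one_closed subgroup.m_closed subgroup.m_inv_closed
  by (fastforce simp: a_inv_def)+

lemma hcomp_finsum:
  assumes "m \<in> mdegs d" "\<And>a. a \<in> A \<Longrightarrow> f a \<in> hcomp D m"
  shows "(\<Oplus>\<^bsub>D\<^esub>a\<in>A. f a) \<in> hcomp D m"
  using assms(2)
proof (induction A rule: infinite_finite_induct)
  case (insert a A)
  then have "(\<Oplus>\<^bsub>D\<^esub>a\<in>insert a A. f a) = f a \<oplus>\<^bsub>D\<^esub> (\<Oplus>\<^bsub>D\<^esub>a\<in>A. f a)"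
    by (intro M.finsum_insert) (auto intro!: hcomp_carrier[OF assms(1)])
  with insert show ?case by (auto intro!: hcomp_add[OF assms(1)])
qed (auto simp: M.finsum_infinite hcomp_zero[OF assms(1)])

lemma const_smult_hcomp: "\<lbrakk>m \<in> mdegs d; x \<in> hcomp D m\<rbrakk> \<Longrightarrow> Poly_Mapping.single 0 c \<odot>\<^bsub>D\<^esub> x \<in> hcomp D m"
  using hcomp_smult[of 0 m x c] by (simp add: map_eq_zero_iff[THEN iffD2])

lemma single_smult_hcomp:
  "\<lbrakk>i < d; m \<in> mdegs d; x \<in> hcomp D m\<rbrakk> \<Longrightarrow>
    Poly_Mapping.single (Poly_Mapping.single i 1) c \<odot>\<^bsub>D\<^esub> x \<in> hcomp D (Poly_Mapping.single i 1 + m)"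
  using hcomp_smult[of "Poly_Mapping.single i 1" m x c] by simp

lemma sign_closed [simp]: "(- 1) ^ n \<in> carrier R"
  by (induction n) auto

lemma sign_smult: "x \<in> carrier D \<Longrightarrow> (- 1) ^ n \<odot>\<^bsub>D\<^esub> x = (if even n then x else \<ominus>\<^bsub>D\<^esub> x)"
  using smult_l_minus[of 1 x] smult_one[of x] by (auto simp: mpoly_a_inv)

lemma smult_smult: "\<lbrakk>p \<in> carrier R; q \<in> carrier R; x \<in> carrier D\<rbrakk> \<Longrightarrow> p \<odot>\<^bsub>D\<^esub> (q \<odot>\<^bsub>D\<^esub> x) = (p * q) \<odot>\<^bsub>D\<^esub> x"
  using smult_assoc1 by simp

abbreviation KD :: "('k mpol, nat set \<Rightarrow> 'm) module" where
  "KD \<equiv> fun_module (Pow {..<d}) D"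

text \<open>The box product differential on the Koszul complex tensored with \<open>D\<close>, all
  homological degrees at once: \<open>T\<close> sits in degree \<open>card T\<close>, which explains
  the sign before \<open>dmap D\<close>.\<close>

definition kdiff :: "(nat set \<Rightarrow> 'm) \<Rightarrow> nat set \<Rightarrow> 'm" where
  "kdiff u T = (if T \<subseteq> {..<d} then
     (\<Oplus>\<^bsub>D\<^esub>i\<in>{..<d} - T. koszul_coeff i T \<odot>\<^bsub>D\<^esub> u (insert i T)) \<oplus>\<^bsub>D\<^esub> (- 1) ^ card T \<odot>\<^bsub>D\<^esub> dmap D (u T) else \<zero>\<^bsub>D\<^esub>)"

lemma KD_module: "Module.module R KD" by (rule fun_module_is_module[OF D_module])

lemma KD_closed: "u \<in> carrier KD \<Longrightarrow> u S \<in> carrier D"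
  by (rule fun_module_closed[OF D_module])

lemma kdiff_hom: "kdiff \<in> mod_hom R KD KD"
proof -
  have *: "(\<lambda>u. kdiff u T) \<in> mod_hom R KD D" for T
  proof (cases "T \<subseteq> {..<d}")
    case True
    have "(\<lambda>u. (\<Oplus>\<^bsub>D\<^esub>i\<in>{..<d} - T. koszul_coeff i T \<odot>\<^bsub>D\<^esub> u (insert i T)) \<oplus>\<^bsub>D\<^esub> (- 1) ^ card T \<odot>\<^bsub>D\<^esub> dmap D (u T))
        \<in> mod_hom R KD D"
      by (intro mod_hom_add mod_hom_finsum_maps KD_module D_module mod_hom_comp[OF fun_module_eval_hom mod_hom_scale]
          mod_hom_comp[OF mod_hom_comp[OF fun_module_eval_hom dmap_mod_hom] mod_hom_scale]) auto
    with True show ?thesis by (simp add: kdiff_def)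
  next
    case False
    then show ?thesis using mod_hom_zero_map[OF KD_module D_module] by (simp add: kdiff_def)
  qed
  show ?thesis
  proof (rule mod_homI)
    fix u assume "u \<in> carrier KD"
    then show "kdiff u \<in> carrier KD" using mod_homD(1)[OF *] by (auto simp: fun_module_carrier kdiff_def)
  qed (auto simp: fun_eq_iff mod_homD(2,3)[OF *, unfolded fun_module_simps])
qed

lemma kdiff_closed: "u \<in> carrier KD \<Longrightarrow> kdiff u T \<in> carrier D"
  using mod_homD(1)[OF kdiff_hom] KD_closed by blast

text \<open>The component of degree \<open>m\<close> of the complex on the first \<open>j\<close>
  variables. As \<open>e_S\<close> has degree \<open>set_deg S\<close>, its coefficient has the
  remaining degree. All these pieces lie in \<open>KD\<close>.\<close>

definition Khom :: "nat \<Rightarrow> mdeg \<Rightarrow> (nat set \<Rightarrow> 'm) set" where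
  "Khom j m = {u. \<forall>S. if S \<subseteq> {..<j} then u S \<in> hcomp D (m - set_deg S) else u S = \<zero>\<^bsub>D\<^esub>}"

context
  fixes j m assumes j: "j \<le> d" and m: "m \<in> mdegs d"
begin

lemma Khom_deg: "S \<subseteq> {..<j} \<Longrightarrow> m - set_deg S \<in> mdegs d"
  using j m by (intro mdegs_intros set_deg_mdegs) auto

lemma Khom_KD: "u \<in> Khom j m \<Longrightarrow> u \<in> carrier KD"
proof -
  assume u: "u \<in> Khom j m"
  have "u S \<in> carrier D" for S
    using u hcomp_carrier[OF Khom_deg] M.zero_closed by (cases "S \<subseteq> {..<j}") (auto simp: Khom_def)
  moreover have "u S = \<zero>\<^bsub>D\<^esub>" if "\<not> S \<subseteq> {..<d}" for S
  proof -
    have "\<not> S \<subseteq> {..<j}" using that j by auto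
    with u show ?thesis by (simp add: Khom_def)
  qed
  ultimately show "u \<in> carrier KD" by (simp add: fun_module_carrier)
qed

lemma Khom_zero: "(\<lambda>_. \<zero>\<^bsub>D\<^esub>) \<in> Khom j m"
  by (auto simp: Khom_def hcomp_zero[OF Khom_deg])

lemma Khom_add: "\<lbrakk>u \<in> Khom j m; v \<in> Khom j m\<rbrakk> \<Longrightarrow> (\<lambda>S. u S \<oplus>\<^bsub>D\<^esub> v S) \<in> Khom j m"
  by (auto simp: Khom_def hcomp_add[OF Khom_deg])

lemma Khom_a_inv: "u \<in> Khom j m \<Longrightarrow> (\<lambda>S. \<ominus>\<^bsub>D\<^esub> u S) \<in> Khom j m"
  by (auto simp: Khom_def hcomp_a_inv[OF Khom_deg])

lemma Khom_const_smult: "u \<in> Khom j m \<Longrightarrow> (\<lambda>S. Poly_Mapping.single 0 c \<odot>\<^bsub>D\<^esub> u S) \<in> Khom j m"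
  by (auto simp: Khom_def const_smult_hcomp[OF Khom_deg])

text \<open>An entry at \<open>T\<close> receives contributions only from sets containing
  \<open>T\<close>, so no index outside \<open>{..<j}\<close> appears; multiplication by
  \<open>x_i\<close> makes up for the degree lost with \<open>e_i\<close>, and \<open>dmap D\<close>
  has degree 0.\<close>

lemma Khom_kdiff:
  assumes u: "u \<in> Khom j m"
  shows "kdiff u \<in> Khom j m"
proof -
  have uT: "u T = \<zero>\<^bsub>D\<^esub>" if "\<not> T \<subseteq> {..<j}" for T using u that by (simp add: Khom_def)
  have uT': "u T \<in> hcomp D (m - set_deg T)" if "T \<subseteq> {..<j}" for T using u that by (simp add: Khom_def)
  have "kdiff u T \<in> hcomp D (m - set_deg T)" if T: "T \<subseteq> {..<j}" for T
  proof -
    note deg = Khom_deg[OF T]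
    have fin: "finite T" using T finite_subset by blast
    have "koszul_coeff i T \<odot>\<^bsub>D\<^esub> u (insert i T) \<in> hcomp D (m - set_deg T)" if i: "i \<in> {..<d} - T" for i
    proof (cases "i < j")
      case True
      then have iT: "insert i T \<subseteq> {..<j}" using T by auto
      have eq: "m - set_deg T = Poly_Mapping.single i 1 + (m - set_deg (insert i T))"
        using i fin by (simp add: set_deg_insert)
      show ?thesis unfolding eq koszul_coeff_def
        by (rule single_smult_hcomp[OF _ Khom_deg[OF iT] uT'[OF iT]]) (use i in simp)
    next
      case False
      then show ?thesis using uT[of "insert i T"] i hcomp_zero[OF deg] by simp
    qed
    moreover have "(- 1) ^ card T \<odot>\<^bsub>D\<^esub> dmap D (u T) \<in> hcomp D (m - set_deg T)"
      using dmap_hcomp[OF deg uT'[OF T]] hcomp_a_inv[OF deg] hcomp_carrier[OF deg] by (simp add: sign_smult)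
    ultimately show ?thesis
      using T j by (auto simp: kdiff_def intro!: hcomp_add[OF deg] hcomp_finsum[OF deg])
  qed
  moreover have "kdiff u T = \<zero>\<^bsub>D\<^esub>" if "\<not> T \<subseteq> {..<j}" for T
  proof (cases "T \<subseteq> {..<d}")
    case True
    have "koszul_coeff i T \<odot>\<^bsub>D\<^esub> u (insert i T) = \<zero>\<^bsub>D\<^esub>" if "i \<in> {..<d} - T" for i
      using that uT[of "insert i T"] \<open>\<not> T \<subseteq> {..<j}\<close> by simp
    then have "(\<Oplus>\<^bsub>D\<^esub>i\<in>{..<d} - T. koszul_coeff i T \<odot>\<^bsub>D\<^esub> u (insert i T)) = \<zero>\<^bsub>D\<^esub>"
      by (intro M.add.finprod_one_eqI)
    then show ?thesis
      using that True by (simp add: kdiff_def uT mod_hom_zero[OF D_module D_module dmap_mod_hom])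
  qed (simp add: kdiff_def)
  ultimately show ?thesis by (simp add: Khom_def)
qed

end

lemma Khom_var:
  assumes j: "j < d" and m: "m \<in> mdegs d" and u: "u \<in> Khom j (m - Poly_Mapping.single j 1)"
  shows "(\<lambda>S. mpoly_var j \<odot>\<^bsub>D\<^esub> u S) \<in> Khom j m"
proof -
  have m': "m - Poly_Mapping.single j 1 \<in> mdegs d" using j m by (intro mdegs_intros)
  have "mpoly_var j \<odot>\<^bsub>D\<^esub> u S \<in> hcomp D (m - set_deg S)" if S: "S \<subseteq> {..<j}" for S
  proof -
    have "u S \<in> hcomp D (m - Poly_Mapping.single j 1 - set_deg S)" using u S by (simp add: Khom_def)
    from single_smult_hcomp[OF j Khom_deg[OF less_imp_le[OF j] m' S] this, of 1]
    show ?thesis by (simp add: mpoly_var_def)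
  qed
  with u show ?thesis using j by (auto simp: Khom_def mpoly_var_closed)
qed

lemma kdiff_add:
  "\<lbrakk>u \<in> carrier KD; v \<in> carrier KD\<rbrakk> \<Longrightarrow> kdiff (\<lambda>S. u S \<oplus>\<^bsub>D\<^esub> v S) = (\<lambda>S. kdiff u S \<oplus>\<^bsub>D\<^esub> kdiff v S)"
  using mod_homD(2)[OF kdiff_hom] by simp

lemma kdiff_smult:
  "\<lbrakk>r \<in> carrier R; u \<in> carrier KD\<rbrakk> \<Longrightarrow> kdiff (\<lambda>S. r \<odot>\<^bsub>D\<^esub> u S) = (\<lambda>S. r \<odot>\<^bsub>D\<^esub> kdiff u S)"
  using mod_homD(3)[OF kdiff_hom] by simp

lemma kdiff_zero: "kdiff (\<lambda>_. \<zero>\<^bsub>D\<^esub>) = (\<lambda>_. \<zero>\<^bsub>D\<^esub>)"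
  using mod_hom_zero[OF KD_module KD_module kdiff_hom] by simp

lemma kdiff_a_inv:
  assumes "u \<in> carrier KD"
  shows "kdiff (\<lambda>S. \<ominus>\<^bsub>D\<^esub> u S) = (\<lambda>S. \<ominus>\<^bsub>D\<^esub> kdiff u S)"
  using kdiff_smult[of "(- 1) ^ 1" u] assms sign_smult[OF KD_closed[OF assms], of 1] sign_smult[OF kdiff_closed[OF assms], of 1]
  by simp

text \<open>The complex on the variables \<open>x\<^sub>0, \<dots>, x\<^sub>j\<close> is the mapping cone of the multiplication by \<open>x\<^sub>j\<close>
  on the complex on \<open>x\<^sub>0, \<dots>, x\<^sub>j\<^sub>-\<^sub>1\<close>.\<close>

definition cone :: "nat \<Rightarrow> (nat set \<Rightarrow> 'm) \<Rightarrow> (nat set \<Rightarrow> 'm) \<Rightarrow> nat set \<Rightarrow> 'm" where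
  "cone j u w S = (if j \<in> S then (- 1) ^ card (S - {j}) \<odot>\<^bsub>D\<^esub> w (S - {j}) else u S)"

lemma sign_cancel: "x \<in> carrier D \<Longrightarrow> (- 1) ^ n \<odot>\<^bsub>D\<^esub> ((- 1) ^ n \<odot>\<^bsub>D\<^esub> x) = x"
  by (simp add: sign_smult)

text \<open>Since \<open>j\<close> exceeds all elements of a set \<open>T\<close> below it, the
  coefficient of \<open>x_j\<close> at \<open>T\<close> has sign \<open>(-1)^(card T)\<close>. The
  sign built into \<open>cone\<close> cancels it, so the two parts are linked by plain
  multiplication by \<open>x_j\<close>. The extra element of \<open>insert j T\<close> accounts for
  the minus sign before \<open>kdiff w\<close>.\<close>

lemma kdiff_cone:
  assumes j: "j < d" and m: "m \<in> mdegs d" "m' \<in> mdegs d" and u: "u \<in> Khom j m" and w: "w \<in> Khom j m'"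
  shows "kdiff (cone j u w) = cone j (\<lambda>T. kdiff u T \<oplus>\<^bsub>D\<^esub> mpoly_var j \<odot>\<^bsub>D\<^esub> w T) (\<lambda>T. \<ominus>\<^bsub>D\<^esub> kdiff w T)"
proof
  fix S
  have uS: "u T = \<zero>\<^bsub>D\<^esub>" "w T = \<zero>\<^bsub>D\<^esub>" if "\<not> T \<subseteq> {..<j}" for T using u w that by (auto simp: Khom_def)
  have uKD: "u \<in> carrier KD" "w \<in> carrier KD" using Khom_KD u w m j less_imp_le by blast+
  note cl [simp] = KD_closed[OF uKD(1)] KD_closed[OF uKD(2)]
  have dS: "kdiff u T = \<zero>\<^bsub>D\<^esub>" "kdiff w T = \<zero>\<^bsub>D\<^esub>" if "\<not> T \<subseteq> {..<j}" for T
    using Khom_kdiff[OF less_imp_le[OF j] m(1) u] Khom_kdiff[OF less_imp_le[OF j] m(2) w] that by (auto simp: Khom_def)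
  have var: "mpoly_var j \<in> carrier R" using j by (rule mpoly_var_closed)
  have d0: "dmap D \<zero>\<^bsub>D\<^esub> = \<zero>\<^bsub>D\<^esub>" by (rule mod_hom_zero[OF D_module D_module dmap_mod_hom])
  have cc: "cone j u w T \<in> carrier D" for T by (simp add: cone_def)
  have dsign: "dmap D ((- 1) ^ n \<odot>\<^bsub>D\<^esub> x) = (- 1) ^ n \<odot>\<^bsub>D\<^esub> dmap D x" if "x \<in> carrier D" for n x
    using mod_homD(3)[OF dmap_mod_hom sign_closed that] .
  define T where "T = S - {j}"
  have jT: "j \<notin> T" by (simp add: T_def)
  show "kdiff (cone j u w) S = cone j (\<lambda>T. kdiff u T \<oplus>\<^bsub>D\<^esub> mpoly_var j \<odot>\<^bsub>D\<^esub> w T) (\<lambda>T. \<ominus>\<^bsub>D\<^esub> kdiff w T) S"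
  proof (cases "T \<subseteq> {..<j}")
    case False
    have z: "cone j u w (insert i S) = \<zero>\<^bsub>D\<^esub>" for i
    proof -
      have "\<not> insert i S - {j} \<subseteq> {..<j}" "\<not> insert i S \<subseteq> {..<j}" using False by (auto simp: T_def)
      then show ?thesis by (simp add: cone_def uS)
    qed
    have nS: "\<not> S - {j} \<subseteq> {..<j}" "\<not> S \<subseteq> {..<j}" using False by (auto simp: T_def)
    then have z': "cone j u w S = \<zero>\<^bsub>D\<^esub>" by (simp add: cone_def uS)
    have "kdiff (cone j u w) S = \<zero>\<^bsub>D\<^esub>"
      by (auto simp: kdiff_def z z' d0 intro!: M.add.finprod_one_eqI)
    moreover have "cone j (\<lambda>T. kdiff u T \<oplus>\<^bsub>D\<^esub> mpoly_var j \<odot>\<^bsub>D\<^esub> w T) (\<lambda>T. \<ominus>\<^bsub>D\<^esub> kdiff w T) S = \<zero>\<^bsub>D\<^esub>"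
      using nS var by (simp add: cone_def dS uS)
    ultimately show ?thesis by simp
  next
    case T: True
    then have fin: "finite T" using finite_subset by blast
    have Td: "T \<subseteq> {..<d}" "insert j T \<subseteq> {..<d}" using T j by auto
    show ?thesis
    proof (cases "j \<in> S")
      case False
      then have ST: "S = T" by (simp add: T_def)
      have eq: "{..<d} - T = insert j ({..<d} - insert j T)" using j jT by auto
      have "{l\<in>T. l < j} = T" using T by auto
      then have kc: "koszul_coeff j T * (- 1) ^ card T = (mpoly_var j :: 'k mpol)"
        by (simp add: koszul_coeff_def mpoly_var_def) (metis (no_types, lifting) left_minus_one_mult_self minus_one_power_iff mult.right_neutral mult_minus_right single_uminus)
      have "(\<Oplus>\<^bsub>D\<^esub>i\<in>{..<d} - T. koszul_coeff i T \<odot>\<^bsub>D\<^esub> cone j u w (insert i T)) =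
        koszul_coeff j T \<odot>\<^bsub>D\<^esub> cone j u w (insert j T) \<oplus>\<^bsub>D\<^esub>
          (\<Oplus>\<^bsub>D\<^esub>i\<in>{..<d} - insert j T. koszul_coeff i T \<odot>\<^bsub>D\<^esub> cone j u w (insert i T))"
        unfolding eq by (rule M.finsum_insert) (auto simp: cc j)
      also have "koszul_coeff j T \<odot>\<^bsub>D\<^esub> cone j u w (insert j T) = mpoly_var j \<odot>\<^bsub>D\<^esub> w T"
        using jT j by (simp add: cone_def smult_smult kc)
      also have "(\<Oplus>\<^bsub>D\<^esub>i\<in>{..<d} - insert j T. koszul_coeff i T \<odot>\<^bsub>D\<^esub> cone j u w (insert i T)) =
          (\<Oplus>\<^bsub>D\<^esub>i\<in>{..<d} - insert j T. koszul_coeff i T \<odot>\<^bsub>D\<^esub> u (insert i T))"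
        using jT by (intro M.finsum_cong') (auto simp: cone_def)
      \<comment> \<open>Restores the summand with index \<open>j\<close>, which is zero because
        \<open>u\<close> vanishes on sets that contain \<open>j\<close>; the sum then has the index
        set used by \<open>kdiff u\<close>.\<close>
      also have "\<dots> = \<zero>\<^bsub>D\<^esub> \<oplus>\<^bsub>D\<^esub> \<dots>" by (auto intro!: M.l_zero[symmetric] M.finsum_closed)
      also have "\<zero>\<^bsub>D\<^esub> = koszul_coeff j T \<odot>\<^bsub>D\<^esub> u (insert j T)" using uS[of "insert j T"] j by simp
      also have "\<dots> \<oplus>\<^bsub>D\<^esub> (\<Oplus>\<^bsub>D\<^esub>i\<in>{..<d} - insert j T. koszul_coeff i T \<odot>\<^bsub>D\<^esub> u (insert i T)) =
          (\<Oplus>\<^bsub>D\<^esub>i\<in>{..<d} - T. koszul_coeff i T \<odot>\<^bsub>D\<^esub> u (insert i T))"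
        unfolding eq by (rule M.finsum_insert[symmetric]) (auto simp: j)
      finally have "kdiff (cone j u w) T = mpoly_var j \<odot>\<^bsub>D\<^esub> w T \<oplus>\<^bsub>D\<^esub>
          (\<Oplus>\<^bsub>D\<^esub>i\<in>{..<d} - T. koszul_coeff i T \<odot>\<^bsub>D\<^esub> u (insert i T)) \<oplus>\<^bsub>D\<^esub> (- 1) ^ card T \<odot>\<^bsub>D\<^esub> dmap D (u T)"
        using Td jT by (simp add: kdiff_def cone_def[of _ _ _ T])
      also have "\<dots> = kdiff u T \<oplus>\<^bsub>D\<^esub> mpoly_var j \<odot>\<^bsub>D\<^esub> w T"
        using Td var by (simp add: kdiff_def M.a_ac M.finsum_closed)
      finally show ?thesis using ST jT by (simp add: cone_def)
    next
      case True
      then have ST: "S = insert j T" by (auto simp: T_def)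
      let ?s = "(- 1) ^ card T :: 'k mpol"
      \<comment> \<open>Below \<open>j\<close>, adding \<open>j\<close> to \<open>T\<close> leaves
        the coefficient alone while \<open>cone\<close> contributes the sign of a set with one more
        element; above \<open>j\<close>, the value of \<open>w\<close> is zero.\<close>
      have summand: "koszul_coeff i S \<odot>\<^bsub>D\<^esub> cone j u w (insert i S) =
          (- ?s) \<odot>\<^bsub>D\<^esub> (koszul_coeff i T \<odot>\<^bsub>D\<^esub> w (insert i T))" if i: "i \<in> {..<d} - S" for i
      proof (cases "i < j")
        case True
        have "{l\<in>S. l < i} = {l\<in>T. l < i}" using True by (auto simp: ST)
        then have "koszul_coeff i S = (koszul_coeff i T :: 'k mpol)" by (simp only: koszul_coeff_def)
        moreover have "insert i S - {j} = insert i T" using i ST jT by auto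
        then have "cone j u w (insert i S) = (- ?s) \<odot>\<^bsub>D\<^esub> w (insert i T)"
          using i fin ST by (simp add: cone_def)
        moreover have "- ?s \<in> carrier R" by simp
        ultimately show ?thesis using i by (simp add: smult_smult mult.commute)
      next
        case False
        then have "w (insert i T) = \<zero>\<^bsub>D\<^esub>" using uS(2)[of "insert i T"] by simp
        moreover have "insert i S - {j} = insert i T" using i ST jT by auto
        moreover have "- ?s \<in> carrier R" by simp
        ultimately show ?thesis using i ST by (simp add: cone_def del: mpoly_carrier_intros(5))
      qed
      have eq: "{..<d} - T = insert j ({..<d} - S)" using jT j ST by auto
      have "(\<Oplus>\<^bsub>D\<^esub>i\<in>{..<d} - T. koszul_coeff i T \<odot>\<^bsub>D\<^esub> w (insert i T)) =
          koszul_coeff j T \<odot>\<^bsub>D\<^esub> w (insert j T) \<oplus>\<^bsub>D\<^esub> (\<Oplus>\<^bsub>D\<^esub>i\<in>{..<d} - S. koszul_coeff i T \<odot>\<^bsub>D\<^esub> w (insert i T))"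
        unfolding eq by (rule M.finsum_insert) (use True j in \<open>auto simp: Pi_iff\<close>)
      also have "\<dots> = (\<Oplus>\<^bsub>D\<^esub>i\<in>{..<d} - S. koszul_coeff i T \<odot>\<^bsub>D\<^esub> w (insert i T))"
        using uS(2)[of "insert j T"] j by (simp add: M.finsum_closed)
      finally have sum: "(\<Oplus>\<^bsub>D\<^esub>i\<in>{..<d} - T. koszul_coeff i T \<odot>\<^bsub>D\<^esub> w (insert i T)) =
        (\<Oplus>\<^bsub>D\<^esub>i\<in>{..<d} - S. koszul_coeff i T \<odot>\<^bsub>D\<^esub> w (insert i T))" .
      have cS: "card S = Suc (card T)" using ST fin jT by simp
      have "(\<Oplus>\<^bsub>D\<^esub>i\<in>{..<d} - S. koszul_coeff i S \<odot>\<^bsub>D\<^esub> cone j u w (insert i S)) =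
          (\<Oplus>\<^bsub>D\<^esub>i\<in>{..<d} - S. (- ?s) \<odot>\<^bsub>D\<^esub> (koszul_coeff i T \<odot>\<^bsub>D\<^esub> w (insert i T)))"
        by (intro M.finsum_cong' refl summand) auto
      also have "\<dots> = (- ?s) \<odot>\<^bsub>D\<^esub> (\<Oplus>\<^bsub>D\<^esub>i\<in>{..<d} - S. koszul_coeff i T \<odot>\<^bsub>D\<^esub> w (insert i T))"
        by (intro finsum_smult_ldistr[symmetric]) auto
      finally have 1: "(\<Oplus>\<^bsub>D\<^esub>i\<in>{..<d} - S. koszul_coeff i S \<odot>\<^bsub>D\<^esub> cone j u w (insert i S)) =
         (- ?s) \<odot>\<^bsub>D\<^esub> (\<Oplus>\<^bsub>D\<^esub>i\<in>{..<d} - T. koszul_coeff i T \<odot>\<^bsub>D\<^esub> w (insert i T))" unfolding sum .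
      have "(- 1) ^ card S \<odot>\<^bsub>D\<^esub> dmap D (cone j u w S) = (- ?s) \<odot>\<^bsub>D\<^esub> (?s \<odot>\<^bsub>D\<^esub> dmap D (w T))"
        using True by (simp add: cone_def T_def[symmetric] dsign cS)
      then have "kdiff (cone j u w) S = (- ?s) \<odot>\<^bsub>D\<^esub> kdiff w T"
        using Td ST by (simp add: kdiff_def 1[unfolded ST] smult_r_distr M.finsum_closed)
      also have "\<dots> = ?s \<odot>\<^bsub>D\<^esub> (\<ominus>\<^bsub>D\<^esub> kdiff w T)"
        using smult_l_minus[of ?s "kdiff w T"] smult_r_minus[of ?s "kdiff w T"] kdiff_closed[OF uKD(2)]
        by (simp add: mpoly_a_inv)
      finally show ?thesis using True by (simp add: cone_def T_def)
    qed
  qed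
qed

end

section \<open>Homology\<close>

text \<open>The record of cycles that \<open>homology\<close> builds inline; the name lets the
  general quotient lemmas be applied to it.\<close>

definition cycle_module :: "('r, 'a, 'u) graded_diff_module_scheme \<Rightarrow> ('r, 'a, 'u) graded_diff_module_scheme" where
  "cycle_module E = E\<lparr>carrier := dker E, hcomp := (\<lambda>m. hcomp E m \<inter> dker E)\<rparr>"

lemma cycle_module_simps [simp]:
  "carrier (cycle_module E) = dker E" "\<zero>\<^bsub>cycle_module E\<^esub> = \<zero>\<^bsub>E\<^esub>"
  "x \<oplus>\<^bsub>cycle_module E\<^esub> y = x \<oplus>\<^bsub>E\<^esub> y" "r \<odot>\<^bsub>cycle_module E\<^esub> x = r \<odot>\<^bsub>E\<^esub> x"
  "hcomp (cycle_module E) m = hcomp E m \<inter> dker E"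
  by (simp_all add: cycle_module_def)

context
  fixes R :: "('r, 'y) ring_scheme" and E :: "('r, 'a, 'u) graded_diff_module_scheme"
  assumes E: "Module.module R E" and dmap: "dmap E \<in> mod_hom R E E"
    and dmap2: "\<forall>x\<in>carrier E. dmap E (dmap E x) = \<zero>\<^bsub>E\<^esub>"
begin

interpretation E: Module.module R E by (fact E)

lemma dker_submodule: "submodule (dker E) R E"
  unfolding dker_def by (rule mod_hom_kernel_submodule[OF E E dmap])

lemma cycle_module_is_module: "Module.module R (cycle_module E)"
  by (rule module_cong[OF submodule.submodule_is_module[OF dker_submodule E]]) simp_all

lemma boundaries_submodule: "submodule (dmap E ` carrier E) R (cycle_module E)"
proof -
  interpret Z: Module.module R "cycle_module E" by (rule cycle_module_is_module)
  have "dmap E \<in> mod_hom R E (cycle_module E)"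
    by (rule mod_homI) (auto simp: dker_def dmap2 mod_homD[OF dmap])
  then show ?thesis by (rule mod_hom_image_submodule[OF E cycle_module_is_module])
qed

lemma homology_module: "Module.module R (homology E)"
  by (rule module_cong[OF quotient_module_is_module[OF cycle_module_is_module boundaries_submodule]])
    (simp_all add: homology_def graded_quotient_def cycle_module_def)

lemma homology_proj:
  "(\<lambda>x. dmap E ` carrier E +>\<^bsub>cycle_module E\<^esub> x) \<in> mod_hom R (cycle_module E) (homology E)"
  using quotient_proj[OF cycle_module_is_module boundaries_submodule]
  by (simp add: homology_def graded_quotient_def cycle_module_def)

lemma homology_zero: "\<zero>\<^bsub>homology E\<^esub> = dmap E ` carrier E"
  by (simp add: homology_def graded_quotient_def quotient_zero[OF cycle_module_is_module boundaries_submodule, unfolded cycle_module_def])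

lemma homology_carrier:
  "carrier (homology E) = (\<lambda>x. dmap E ` carrier E +>\<^bsub>cycle_module E\<^esub> x) ` dker E"
  using quotient_carrier[OF cycle_module_is_module boundaries_submodule]
  by (simp add: homology_def graded_quotient_def cycle_module_def)

lemma homology_class_eq_zero:
  "x \<in> dker E \<Longrightarrow> dmap E ` carrier E +>\<^bsub>cycle_module E\<^esub> x = \<zero>\<^bsub>homology E\<^esub> \<longleftrightarrow> x \<in> dmap E ` carrier E"
  using coset_eq_self_iff[OF cycle_module_is_module boundaries_submodule, of x] by (simp add: homology_zero)

lemma homology_hcomp:
  "hcomp (homology E) m = (\<lambda>x. dmap E ` carrier E +>\<^bsub>cycle_module E\<^esub> x) ` (hcomp E m \<inter> dker E)"
  by (simp add: homology_def graded_quotient_def cycle_module_def)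

end

section \<open>Counting degrees\<close>

text \<open>The set \<open>A j\<close> is the set of degrees in which the homology of the Koszul complex on the first
  \<open>j\<close> variables lives. A step contributes at least the symmetric difference of \<open>A j\<close> and its
  translate; among the degrees that agree in the last coordinate \<open>t\<close> up to then, the ones with
  minimal \<open>t\<close> and the translates of the ones with maximal \<open>t\<close> survive.\<close>

lemma translate_count:
  fixes A :: "nat \<Rightarrow> mdeg set"
  assumes "A 0 \<noteq> {}" "\<And>i. i < n \<Longrightarrow> \<exists>a b. \<forall>m\<in>A 0. Poly_Mapping.lookup m i \<in> {a..b}"
    and "\<And>j m. \<lbrakk>j < n; m \<in> A (Suc j)\<rbrakk> \<Longrightarrow> m \<in> A j \<or> m - Poly_Mapping.single j 1 \<in> A j"
    and "\<And>j m. \<lbrakk>j < n; (m \<in> A j) \<noteq> (m - Poly_Mapping.single j 1 \<in> A j)\<rbrakk> \<Longrightarrow> m \<in> A (Suc j)"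
  shows "\<exists>F\<subseteq>A n. finite F \<and> card F = 2 ^ n"
  using assms
proof (induction n arbitrary: A)
  case 0
  then obtain m where "m \<in> A 0" by blast
  then show ?case by (intro exI[of _ "{m}"]) simp
next
  case (Suc n)
  let ?c = "\<lambda>m. Poly_Mapping.lookup m n" and ?e = "\<lambda>j. Poly_Mapping.single j 1 :: mdeg"
  note step = Suc.prems(3)
  define L where "L = ?c ` A 0"
  obtain a b where "\<forall>m\<in>A 0. ?c m \<in> {a..b}" using Suc.prems(2)[of n] by blast
  then have "L \<subseteq> {a..b}" by (auto simp: L_def)
  then have L: "finite L" "L \<noteq> {}" using Suc.prems(1) finite_subset by (auto simp: L_def)
  define t0 where "t0 = Min L"
  define t1 where "t1 = Max L"
  have t: "t0 \<in> L" "t1 \<in> L" using L by (simp_all add: t0_def t1_def)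
  \<comment> \<open>Steps with an index below \<open>n\<close> translate in other directions, so the
    bounds for the last coordinate persist from \<open>A 0\<close> to \<open>A n\<close>.\<close>
  have range: "t0 \<le> ?c m \<and> ?c m \<le> t1" if "j \<le> n" "m \<in> A j" for j m
    using that
  proof (induction j arbitrary: m)
    case 0
    then show ?case using L by (auto simp: t0_def t1_def L_def)
  next
    case (Suc j)
    have "m \<in> A j \<or> m - ?e j \<in> A j" using Suc.prems step[of j m] by simp
    moreover have "?c (m - ?e j) = ?c m" using Suc.prems(1) by (simp add: lookup_minus lookup_single)
    ultimately show ?case using Suc.IH[of m] Suc.IH[of "m - ?e j"] Suc.prems(1) by auto
  qed
  \<comment> \<open>Fixing the last coordinate is compatible with the first \<open>n\<close> steps,
    so the induction hypothesis applies to each slice that is nonempty at the start.\<close>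
  have "\<exists>F\<subseteq>{m \<in> A n. ?c m = t}. finite F \<and> card F = 2 ^ n" if "t \<in> L" for t
  proof (rule Suc.IH[of "\<lambda>j. {m \<in> A j. ?c m = t}"])
    show "{m \<in> A 0. ?c m = t} \<noteq> {}" using that by (auto simp: L_def)
    show "\<exists>a b. \<forall>m\<in>{m \<in> A 0. ?c m = t}. Poly_Mapping.lookup m i \<in> {a..b}" if i: "i < n" for i
    proof -
      obtain a b where "\<forall>m\<in>A 0. Poly_Mapping.lookup m i \<in> {a..b}" using Suc.prems(2)[of i] i by auto
      then show ?thesis by (intro exI[of _ a] exI[of _ b]) auto
    qed
    fix j m assume j: "j < n"
    have c: "?c (m - ?e j) = ?c m" using j by (simp add: lookup_minus lookup_single)
    show "m \<in> {m \<in> A j. ?c m = t} \<or> m - ?e j \<in> {m \<in> A j. ?c m = t}" if "m \<in> {m \<in> A (Suc j). ?c m = t}"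
      using Suc.prems(3)[of j m] j that c by auto
    show "m \<in> {m \<in> A (Suc j). ?c m = t}"
      if "(m \<in> {m \<in> A j. ?c m = t}) \<noteq> (m - ?e j \<in> {m \<in> A j. ?c m = t})"
      using Suc.prems(4)[of j m] j that c by auto
  qed
  note slice = this
  obtain F0 where F0: "F0 \<subseteq> {m \<in> A n. ?c m = t0}" "finite F0" "card F0 = 2 ^ n"
    using slice[OF t(1)] by blast
  obtain F1 where F1: "F1 \<subseteq> {m \<in> A n. ?c m = t1}" "finite F1" "card F1 = 2 ^ n"
    using slice[OF t(2)] by blast
  let ?F = "F0 \<union> (\<lambda>m. m + ?e n) ` F1"
  have "F0 \<subseteq> A (Suc n)"
  proof
    fix m assume m: "m \<in> F0"
    \<comment> \<open>One step below the lowest slice lies outside \<open>A n\<close>, so exactly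
      one of the two degrees belongs to \<open>A n\<close>.\<close>
    have "?c (m - ?e n) = t0 - 1" using F0(1) m by (auto simp: lookup_minus)
    then have "m - ?e n \<notin> A n" using range[of n "m - ?e n"] by auto
    then show "m \<in> A (Suc n)" using Suc.prems(4)[of n m] F0(1) m by auto
  qed
  moreover have "m + ?e n \<in> A (Suc n)" if m: "m \<in> F1" for m
  proof -
    have "?c (m + ?e n) = t1 + 1" using F1(1) m by (auto simp: lookup_add)
    then have "m + ?e n \<notin> A n" using range[of n "m + ?e n"] by auto
    then show ?thesis using Suc.prems(4)[of n "m + ?e n"] F1(1) m by auto
  qed
  ultimately have "?F \<subseteq> A (Suc n)" by auto
  moreover have "F0 \<inter> (\<lambda>m. m + ?e n) ` F1 = {}"
  proof -
    \<comment> \<open>The two families differ in the last coordinate, \<open>t0\<close> against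
      \<open>t1 + 1\<close>, even when there is only one slice and \<open>t0 = t1\<close>.\<close>
    have "t0 \<le> t1" using L t by (simp add: t1_def)
    moreover have "?c m = t0" if "m \<in> F0" for m using F0(1) that by auto
    moreover have "?c (m + ?e n) = t1 + 1" if "m \<in> F1" for m using F1(1) that by (auto simp: lookup_add)
    ultimately show ?thesis by fastforce
  qed
  then have "card ?F = 2 ^ n + 2 ^ n"
    using F0 F1 by (simp add: card_Un_disjoint card_image inj_on_def)
  ultimately show ?case using F0 F1 by (intro exI[of _ ?F]) simp
qed

context koszul_tensor
begin

section \<open>Homogeneous components\<close>

definition decomposes :: "'m \<Rightarrow> (mdeg \<Rightarrow> 'm) \<Rightarrow> bool" where
  "decomposes x f \<longleftrightarrow> (\<forall>m\<in>mdegs d. f m \<in> hcomp D m) \<and> (\<forall>m. m \<notin> mdegs d \<longrightarrow> f m = \<zero>\<^bsub>D\<^esub>)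
         \<and> finite {m. f m \<noteq> \<zero>\<^bsub>D\<^esub>} \<and> x = (\<Oplus>\<^bsub>D\<^esub>m\<in>{m. f m \<noteq> \<zero>\<^bsub>D\<^esub>}. f m)"

definition component :: "mdeg \<Rightarrow> 'm \<Rightarrow> 'm" where
  "component m x = (THE f. decomposes x f) m"

lemma decomposes_ex1: "x \<in> carrier D \<Longrightarrow> \<exists>!f. decomposes x f"
  unfolding decomposes_def by (rule hcomp_direct_sum)

lemma component_props:
  assumes "x \<in> carrier D"
  shows component_hcomp: "m \<in> mdegs d \<Longrightarrow> component m x \<in> hcomp D m"
    and component_outside: "m \<notin> mdegs d \<Longrightarrow> component m x = \<zero>\<^bsub>D\<^esub>"
    and component_finite: "finite {m. component m x \<noteq> \<zero>\<^bsub>D\<^esub>}"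
    and component_sum: "x = (\<Oplus>\<^bsub>D\<^esub>m\<in>{m. component m x \<noteq> \<zero>\<^bsub>D\<^esub>}. component m x)"
  using theI'[OF decomposes_ex1[OF assms]] unfolding component_def decomposes_def by blast+

text \<open>Uniqueness of the homogeneous decomposition. The index set may exceed the support, as
  sums of decompositions are naturally taken over such sets.\<close>

lemma component_eqI:
  assumes A: "finite A" "A \<subseteq> mdegs d" "\<And>m. m \<in> A \<Longrightarrow> f m \<in> hcomp D m" "\<And>m. m \<notin> A \<Longrightarrow> f m = \<zero>\<^bsub>D\<^esub>"
    and x: "x = (\<Oplus>\<^bsub>D\<^esub>m\<in>A. f m)"
  shows "component m x = f m"
proof -
  have cl: "f \<in> A \<rightarrow> carrier D" using A by (auto intro: hcomp_carrier)
  then have xD: "x \<in> carrier D" unfolding x by (rule M.finsum_closed)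
  have sub: "{m. f m \<noteq> \<zero>\<^bsub>D\<^esub>} \<subseteq> A" using A(4) by auto
  have "(\<Oplus>\<^bsub>D\<^esub>m\<in>{m. f m \<noteq> \<zero>\<^bsub>D\<^esub>}. f m) = (\<Oplus>\<^bsub>D\<^esub>m\<in>A. f m)"
    by (rule M.add.finprod_mono_neutral_cong_left) (use A sub cl in auto)
  moreover have "f m \<in> hcomp D m" if "m \<in> mdegs d" for m
    using A(3,4) hcomp_zero[OF that] by (cases "m \<in> A") auto
  moreover have "f m = \<zero>\<^bsub>D\<^esub>" if "m \<notin> mdegs d" for m using A(2,4) that by auto
  ultimately have "decomposes x f"
    unfolding decomposes_def using finite_subset[OF sub A(1)] x by simp
  then have "(THE f. decomposes x f) = f" by (rule the1_equality[OF decomposes_ex1[OF xD]])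
  then show ?thesis by (simp add: component_def)
qed

lemma component_closed: "x \<in> carrier D \<Longrightarrow> component m x \<in> carrier D"
  using component_hcomp[of x m] component_outside[of x m] hcomp_carrier by (cases "m \<in> mdegs d") auto

lemma component_homogeneous:
  assumes "n \<in> mdegs d" "x \<in> hcomp D n"
  shows "component m x = (if m = n then x else \<zero>\<^bsub>D\<^esub>)"
  by (rule component_eqI[of "{n}"]) (use assms hcomp_carrier in auto)

lemma component_zero: "component m \<zero>\<^bsub>D\<^esub> = \<zero>\<^bsub>D\<^esub>"
  using component_homogeneous[of 0 "\<zero>\<^bsub>D\<^esub>" m] hcomp_zero[of 0] mdegs_intros(4)[of d] by simp

lemma component_superset:
  assumes x: "x \<in> carrier D" and A: "finite A" "{m. component m x \<noteq> \<zero>\<^bsub>D\<^esub>} \<subseteq> A"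
  shows "x = (\<Oplus>\<^bsub>D\<^esub>m\<in>A. component m x)"
proof -
  have "(\<Oplus>\<^bsub>D\<^esub>m\<in>{m. component m x \<noteq> \<zero>\<^bsub>D\<^esub>}. component m x) = (\<Oplus>\<^bsub>D\<^esub>m\<in>A. component m x)"
    by (rule M.add.finprod_mono_neutral_cong_left) (use A x component_closed in auto)
  then show ?thesis using component_sum[OF x] by simp
qed

text \<open>An additive map of degree \<open>e\<close> carries the decomposition of \<open>x\<close>
  to that of \<open>h x\<close>, translated by \<open>e\<close>; uniqueness does the rest. It is
  applied to the differential and to constants with \<open>e = 0\<close>, and to terms
  \<open>c x_i\<close> with the degree of \<open>x_i\<close>.\<close>

lemma component_hom:
  assumes h: "\<And>x. x \<in> carrier D \<Longrightarrow> h x \<in> carrier D"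
    "\<And>x y. \<lbrakk>x \<in> carrier D; y \<in> carrier D\<rbrakk> \<Longrightarrow> h (x \<oplus>\<^bsub>D\<^esub> y) = h x \<oplus>\<^bsub>D\<^esub> h y"
    and e: "e \<in> mdegs d" "\<And>m x. \<lbrakk>m \<in> mdegs d; x \<in> hcomp D m\<rbrakk> \<Longrightarrow> h x \<in> hcomp D (e + m)"
    and x: "x \<in> carrier D"
  shows "component (e + m) (h x) = h (component m x)"
proof -
  let ?S = "{m. component m x \<noteq> \<zero>\<^bsub>D\<^esub>}"
  interpret h: abelian_group_hom D D h
    by (intro abelian_group_homI group_hom.intro group_hom_axioms.intro homI M.abelian_group_axioms M.add.is_group)
      (use h in auto)
  have S: "finite ?S" "?S \<subseteq> mdegs d" using component_finite[OF x] component_outside[OF x] by auto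
  have sum: "h (\<Oplus>\<^bsub>D\<^esub>m\<in>B. component m x) = (\<Oplus>\<^bsub>D\<^esub>m\<in>B. h (component m x))" if "finite B" for B
    using that
  proof (induction B rule: finite_induct)
    case (insert b B)
    have "(\<lambda>m. component m x) \<in> B \<rightarrow> carrier D" "(\<lambda>m. h (component m x)) \<in> B \<rightarrow> carrier D"
      using component_closed[OF x] h(1) by auto
    with insert show ?case using component_closed[OF x] h by (simp add: M.finsum_closed)
  qed simp
  have "h x = (\<Oplus>\<^bsub>D\<^esub>m\<in>?S. h (component m x))"
    using component_sum[OF x] sum[OF S(1)] by simp
  \<comment> \<open>Prepares the translation by \<open>e\<close> as a reindexing.\<close>
  also have "\<dots> = (\<Oplus>\<^bsub>D\<^esub>m\<in>?S. h (component (e + m - e) x))" by simp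
  also have "\<dots> = (\<Oplus>\<^bsub>D\<^esub>m\<in>(+) e ` ?S. h (component (m - e) x))"
    by (rule M.finsum_reindex[symmetric]) (auto simp: component_closed[OF x] h(1))
  finally have hx: "h x = (\<Oplus>\<^bsub>D\<^esub>m\<in>(+) e ` ?S. h (component (m - e) x))" .
  have "component (e + m) (h x) = h (component (e + m - e) x)"
  proof (rule component_eqI[OF _ _ _ _ hx])
    show "finite ((+) e ` ?S)" using S by simp
    show "(+) e ` ?S \<subseteq> mdegs d" using S(2) mdegs_intros(1)[OF e(1)] by blast
    fix m
    show "h (component (m - e) x) \<in> hcomp D m" if "m \<in> (+) e ` ?S"
      using that S(2) e(2) component_hcomp[OF x] by fastforce
    show "h (component (m - e) x) = \<zero>\<^bsub>D\<^esub>" if "m \<notin> (+) e ` ?S"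
    proof -
      have "m = e + (m - e)" by simp
      with that have "m - e \<notin> ?S" by (metis image_eqI)
      then show ?thesis by simp
    qed
  qed
  then show ?thesis by simp
qed

lemma component_add:
  assumes x: "x \<in> carrier D" and y: "y \<in> carrier D"
  shows "component m (x \<oplus>\<^bsub>D\<^esub> y) = component m x \<oplus>\<^bsub>D\<^esub> component m y"
proof -
  let ?A = "{m. component m x \<noteq> \<zero>\<^bsub>D\<^esub>} \<union> {m. component m y \<noteq> \<zero>\<^bsub>D\<^esub>}"
  have A: "finite ?A" using component_finite[OF x] component_finite[OF y] by simp
  have sub: "?A \<subseteq> mdegs d" using component_outside[OF x] component_outside[OF y] by auto
  have "(\<Oplus>\<^bsub>D\<^esub>m\<in>?A. component m x \<oplus>\<^bsub>D\<^esub> component m y) = (\<Oplus>\<^bsub>D\<^esub>m\<in>?A. component m x) \<oplus>\<^bsub>D\<^esub> (\<Oplus>\<^bsub>D\<^esub>m\<in>?A. component m y)"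
    by (rule M.finsum_addf) (auto simp: component_closed x y)
  also have "\<dots> = x \<oplus>\<^bsub>D\<^esub> y"
    using component_superset[OF x A] component_superset[OF y A] by simp
  finally show ?thesis
    by (intro component_eqI[OF A sub]) (use sub in \<open>auto intro!: hcomp_add component_hcomp x y\<close>)
qed

lemma component_finsum:
  assumes "\<And>a. a \<in> A \<Longrightarrow> f a \<in> carrier D"
  shows "component m (\<Oplus>\<^bsub>D\<^esub>a\<in>A. f a) = (\<Oplus>\<^bsub>D\<^esub>a\<in>A. component m (f a))"
  using assms
proof (induction A rule: infinite_finite_induct)
  case (insert a A)
  then have "f \<in> A \<rightarrow> carrier D" "(\<lambda>a. component m (f a)) \<in> A \<rightarrow> carrier D"
    by (auto simp: component_closed)
  with insert show ?case by (simp add: component_add component_closed M.finsum_closed)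
qed (simp_all add: component_zero M.finsum_infinite)

lemma component_dmap: "x \<in> carrier D \<Longrightarrow> component m (dmap D x) = dmap D (component m x)"
  using component_hom[of "dmap D" 0 x m] mod_homD[OF dmap_mod_hom] dmap_hcomp mdegs_intros(4) by simp

lemma component_const_smult:
  "x \<in> carrier D \<Longrightarrow> component m (Poly_Mapping.single 0 c \<odot>\<^bsub>D\<^esub> x) = Poly_Mapping.single 0 c \<odot>\<^bsub>D\<^esub> component m x"
  using component_hom[of "\<lambda>x. Poly_Mapping.single 0 c \<odot>\<^bsub>D\<^esub> x" 0 x m] const_smult_hcomp mdegs_intros(4)
  by (simp add: smult_r_distr)

lemma component_single_smult:
  "\<lbrakk>i < d; x \<in> carrier D\<rbrakk> \<Longrightarrow> component (Poly_Mapping.single i 1 + m) (Poly_Mapping.single (Poly_Mapping.single i 1) c \<odot>\<^bsub>D\<^esub> x) =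
    Poly_Mapping.single (Poly_Mapping.single i 1) c \<odot>\<^bsub>D\<^esub> component m x"
  by (rule component_hom) (simp_all add: smult_r_distr single_smult_hcomp mdegs_intros del: One_nat_def)

lemma component_sign_smult:
  "x \<in> carrier D \<Longrightarrow> component m ((- 1) ^ n \<odot>\<^bsub>D\<^esub> x) = (- 1) ^ n \<odot>\<^bsub>D\<^esub> component m x"
  using component_const_smult[of x m "(- 1) ^ n"]
  by (cases "even n") (simp_all add: single_uminus)

definition Kcomponent :: "mdeg \<Rightarrow> (nat set \<Rightarrow> 'm) \<Rightarrow> nat set \<Rightarrow> 'm" where
  "Kcomponent m u S = component (m - set_deg S) (u S)"

lemma Kcomponent_Khom: "\<lbrakk>m \<in> mdegs d; u \<in> carrier KD\<rbrakk> \<Longrightarrow> Kcomponent m u \<in> Khom d m"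
  using component_hcomp[OF KD_closed] mdegs_intros(2)[OF _ set_deg_mdegs]
  by (auto simp: Khom_def Kcomponent_def fun_module_carrier component_zero)

text \<open>The projection to a fixed degree is a chain map. It turns an arbitrary element with a
  given homogeneous boundary into a homogeneous one.\<close>

lemma Kcomponent_kdiff:
  assumes u: "u \<in> carrier KD"
  shows "Kcomponent m (kdiff u) = kdiff (Kcomponent m u)"
proof
  fix T
  note cl = KD_closed[OF u]
  show "Kcomponent m (kdiff u) T = kdiff (Kcomponent m u) T"
  proof (cases "T \<subseteq> {..<d}")
    case True
    then have fin: "finite T" using finite_subset by blast
    let ?n = "m - set_deg T"
    have s: "component ?n (koszul_coeff i T \<odot>\<^bsub>D\<^esub> u (insert i T)) =
        koszul_coeff i T \<odot>\<^bsub>D\<^esub> component (m - set_deg (insert i T)) (u (insert i T))" if i: "i \<in> {..<d} - T" for i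
    proof -
      have eq: "?n = Poly_Mapping.single i 1 + (m - set_deg (insert i T))"
        using i fin by (simp add: set_deg_insert)
      show ?thesis unfolding eq koszul_coeff_def
        by (rule component_single_smult) (use i cl in auto)
    qed
    have "component ?n (kdiff u T) = component ?n (\<Oplus>\<^bsub>D\<^esub>i\<in>{..<d} - T. koszul_coeff i T \<odot>\<^bsub>D\<^esub> u (insert i T)) \<oplus>\<^bsub>D\<^esub>
        component ?n ((- 1) ^ card T \<odot>\<^bsub>D\<^esub> dmap D (u T))"
      using True cl by (simp add: kdiff_def component_add M.finsum_closed)
    also have "component ?n (\<Oplus>\<^bsub>D\<^esub>i\<in>{..<d} - T. koszul_coeff i T \<odot>\<^bsub>D\<^esub> u (insert i T)) =
        (\<Oplus>\<^bsub>D\<^esub>i\<in>{..<d} - T. component ?n (koszul_coeff i T \<odot>\<^bsub>D\<^esub> u (insert i T)))"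
      by (rule component_finsum) (use cl in auto)
    also have "\<dots> = (\<Oplus>\<^bsub>D\<^esub>i\<in>{..<d} - T. koszul_coeff i T \<odot>\<^bsub>D\<^esub> Kcomponent m u (insert i T))"
      by (rule M.finsum_cong') (use cl s in \<open>auto simp: Kcomponent_def component_closed\<close>)
    also have "component ?n ((- 1) ^ card T \<odot>\<^bsub>D\<^esub> dmap D (u T)) = (- 1) ^ card T \<odot>\<^bsub>D\<^esub> dmap D (Kcomponent m u T)"
      using cl by (simp add: component_sign_smult component_dmap Kcomponent_def)
    finally show ?thesis using True by (simp add: Kcomponent_def[of _ "kdiff u"] kdiff_def[of "Kcomponent m u"])
  qed (simp add: Kcomponent_def kdiff_def component_zero)
qed

section \<open>The degrees of the Koszul homology\<close>

lemma cone_Khom: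
  assumes j: "j < d" and m: "m \<in> mdegs d" and u: "u \<in> Khom j m" and w: "w \<in> Khom j (m - Poly_Mapping.single j 1)"
  shows "cone j u w \<in> Khom (Suc j) m"
proof -
  have m': "m - Poly_Mapping.single j 1 \<in> mdegs d" using j m by (intro mdegs_intros)
  have "cone j u w S \<in> hcomp D (m - set_deg S)" if S: "S \<subseteq> {..<Suc j}" for S
  proof (cases "j \<in> S")
    case True
    have fin: "finite (S - {j})" using S finite_subset by blast
    have sub: "S - {j} \<subseteq> {..<j}" using S by (auto simp: less_Suc_eq)
    have "set_deg S = Poly_Mapping.single j 1 + set_deg (S - {j})"
      using set_deg_insert[OF fin, of j] True by (simp add: insert_absorb)
    then have deg: "m - set_deg S = m - Poly_Mapping.single j 1 - set_deg (S - {j})" by simp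
    note D = Khom_deg[OF less_imp_le[OF j] m' sub]
    have w': "w (S - {j}) \<in> hcomp D (m - Poly_Mapping.single j 1 - set_deg (S - {j}))"
      using w sub by (simp add: Khom_def)
    then show ?thesis
      unfolding deg using True hcomp_carrier[OF D w'] hcomp_a_inv[OF D w'] by (simp add: cone_def sign_smult)
  next
    case False
    then have "S \<subseteq> {..<j}" using S by (auto simp: less_Suc_eq)
    then show ?thesis using False u by (simp add: cone_def Khom_def)
  qed
  moreover have "cone j u w S = \<zero>\<^bsub>D\<^esub>" if S: "\<not> S \<subseteq> {..<Suc j}" for S
  proof -
    have "\<not> S - {j} \<subseteq> {..<j}" "\<not> S \<subseteq> {..<j}" using S by (auto simp: less_Suc_eq)
    then show ?thesis using u w by (simp add: cone_def Khom_def)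
  qed
  ultimately show ?thesis by (simp add: Khom_def)
qed

text \<open>Split the entries according to whether the set contains \<open>j\<close>. The sign in
  \<open>w\<close> undoes the one in \<open>cone\<close>, as its square is 1.\<close>

lemma cone_cases:
  assumes j: "j < d" and m: "m \<in> mdegs d" and v: "v \<in> Khom (Suc j) m"
  obtains u w where "u \<in> Khom j m" "w \<in> Khom j (m - Poly_Mapping.single j 1)" "v = cone j u w"
proof -
  define u where "u S = (if j \<in> S then \<zero>\<^bsub>D\<^esub> else v S)" for S
  define w where "w S = (if j \<in> S then \<zero>\<^bsub>D\<^esub> else (- 1) ^ card S \<odot>\<^bsub>D\<^esub> v (insert j S))" for S
  have jd: "Suc j \<le> d" using j by simp
  have vS: "v S \<in> hcomp D (m - set_deg S)" if "S \<subseteq> {..<Suc j}" for S using v that by (simp add: Khom_def)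
  have v0: "v S = \<zero>\<^bsub>D\<^esub>" if "\<not> S \<subseteq> {..<Suc j}" for S using v that by (simp add: Khom_def)
  have "u \<in> Khom j m"
    unfolding Khom_def
  proof (intro CollectI allI)
    fix S
    have "S \<subseteq> {..<j} \<Longrightarrow> S \<subseteq> {..<Suc j} \<and> j \<notin> S" "j \<notin> S \<Longrightarrow> \<not> S \<subseteq> {..<j} \<Longrightarrow> \<not> S \<subseteq> {..<Suc j}"
      by (auto simp: less_Suc_eq)
    then show "if S \<subseteq> {..<j} then u S \<in> hcomp D (m - set_deg S) else u S = \<zero>\<^bsub>D\<^esub>"
      using vS[of S] v0[of S] by (auto simp: u_def)
  qed
  moreover have "w \<in> Khom j (m - Poly_Mapping.single j 1)"
    unfolding Khom_def
  proof (intro CollectI allI)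
    fix S
    show "if S \<subseteq> {..<j} then w S \<in> hcomp D (m - Poly_Mapping.single j 1 - set_deg S) else w S = \<zero>\<^bsub>D\<^esub>"
    proof (cases "S \<subseteq> {..<j}")
      case True
      then have S: "finite S" "j \<notin> S" "insert j S \<subseteq> {..<Suc j}" using finite_subset by (auto simp: less_Suc_eq)
      have deg: "m - Poly_Mapping.single j 1 - set_deg S = m - set_deg (insert j S)"
        using S by (simp add: set_deg_insert)
      note D = Khom_deg[OF jd m S(3)]
      show ?thesis
        using True S(2) hcomp_carrier[OF D vS[OF S(3)]] hcomp_a_inv[OF D vS[OF S(3)]] vS[OF S(3)]
        unfolding deg by (simp add: w_def sign_smult)
    next
      case False
      then have "j \<notin> S \<Longrightarrow> \<not> insert j S \<subseteq> {..<Suc j}" by (auto simp: less_Suc_eq)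
      with False show ?thesis using v0[of "insert j S"] by (simp add: w_def)
    qed
  qed
  moreover have "v = cone j u w"
    using KD_closed[OF Khom_KD[OF jd m v]]
    by (auto simp: fun_eq_iff cone_def u_def w_def sign_cancel insert_absorb)
  ultimately show thesis by (rule that)
qed

lemma cone_inj:
  assumes u: "u \<in> Khom j m" "u' \<in> Khom j m" and w: "w \<in> Khom j m'" "w' \<in> Khom j m'"
    and j: "j < d" and m': "m' \<in> mdegs d" and eq: "cone j u w = cone j u' w'"
  shows "u = u'" "w = w'"
proof -
  have z: "u S = \<zero>\<^bsub>D\<^esub>" "u' S = \<zero>\<^bsub>D\<^esub>" "w S = \<zero>\<^bsub>D\<^esub>" "w' S = \<zero>\<^bsub>D\<^esub>" if "j \<in> S" for S
  proof -
    have "\<not> S \<subseteq> {..<j}" using that by auto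
    then show "u S = \<zero>\<^bsub>D\<^esub>" "u' S = \<zero>\<^bsub>D\<^esub>" "w S = \<zero>\<^bsub>D\<^esub>" "w' S = \<zero>\<^bsub>D\<^esub>" using u w by (auto simp: Khom_def)
  qed
  show "u = u'"
  proof
    fix S show "u S = u' S" using fun_cong[OF eq, of S] z by (cases "j \<in> S") (auto simp: cone_def)
  qed
  have wD: "w S \<in> carrier D" "w' S \<in> carrier D" for S
    using KD_closed Khom_KD[OF less_imp_le[OF j] m'] w by blast+
  show "w = w'"
  proof
    fix S
    show "w S = w' S"
    proof (cases "j \<in> S")
      case False
      then have "(- 1) ^ card S \<odot>\<^bsub>D\<^esub> w S = (- 1) ^ card S \<odot>\<^bsub>D\<^esub> w' S"
        using fun_cong[OF eq, of "insert j S"] by (simp add: cone_def)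
      then show ?thesis using sign_cancel[OF wD(1)] sign_cancel[OF wD(2)] by metis
    qed (simp add: z)
  qed
qed

text \<open>The degrees in which the homology of the complex on the first \<open>j\<close> variables
  is nonzero. It is phrased by cycles and boundaries within a single degree, so no quotient is
  formed.\<close>

definition Hdeg :: "nat \<Rightarrow> mdeg set" where
  "Hdeg j = {m \<in> mdegs d. \<exists>u\<in>Khom j m. kdiff u = (\<lambda>_. \<zero>\<^bsub>D\<^esub>) \<and> (\<forall>w\<in>Khom j m. kdiff w \<noteq> u)}"

lemma Hdeg_exact:
  assumes "m \<in> mdegs d" "m \<notin> Hdeg j" "u \<in> Khom j m" "kdiff u = (\<lambda>_. \<zero>\<^bsub>D\<^esub>)"
  obtains w where "w \<in> Khom j m" "kdiff w = u"
  using assms by (auto simp: Hdeg_def)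

context
  fixes j m m' assumes j: "j < d" and m: "m \<in> mdegs d" and m'_def: "m' = m - Poly_Mapping.single j 1"
begin

lemma m': "m' \<in> mdegs d"
  unfolding m'_def using j m by (intro mdegs_intros)

lemmas jd = less_imp_le[OF j]
lemmas KDm = Khom_KD[OF jd m] and KDm' = Khom_KD[OF jd m']

lemma var_Khom: "w \<in> Khom j m' \<Longrightarrow> (\<lambda>S. mpoly_var j \<odot>\<^bsub>D\<^esub> w S) \<in> Khom j m"
  using Khom_var[OF j m] by (simp add: m'_def)

lemma kdiff_var: "w \<in> Khom j m' \<Longrightarrow> kdiff (\<lambda>S. mpoly_var j \<odot>\<^bsub>D\<^esub> w S) = (\<lambda>S. mpoly_var j \<odot>\<^bsub>D\<^esub> kdiff w S)"
  by (rule kdiff_smult[OF mpoly_var_closed[OF j] KDm'])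

lemma kdiff_cone_parts:
  assumes u: "u \<in> Khom j m" and w: "w \<in> Khom j m'" and a: "a \<in> Khom j m" and b: "b \<in> Khom j m'"
    and eq: "kdiff (cone j u w) = cone j a b"
  shows "\<And>S. a S = kdiff u S \<oplus>\<^bsub>D\<^esub> mpoly_var j \<odot>\<^bsub>D\<^esub> w S" "b = (\<lambda>S. \<ominus>\<^bsub>D\<^esub> kdiff w S)"
proof -
  note 1 = Khom_add[OF jd m Khom_kdiff[OF jd m u] var_Khom[OF w]]
  note 2 = Khom_a_inv[OF jd m' Khom_kdiff[OF jd m' w]]
  from cone_inj[OF a 1 b 2 j m' eq[symmetric, unfolded kdiff_cone[OF j m m' u w]]]
  show "\<And>S. a S = kdiff u S \<oplus>\<^bsub>D\<^esub> mpoly_var j \<odot>\<^bsub>D\<^esub> w S" "b = (\<lambda>S. \<ominus>\<^bsub>D\<^esub> kdiff w S)" by simp_all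
qed

lemma cone_zero: "cone j (\<lambda>_. \<zero>\<^bsub>D\<^esub>) (\<lambda>_. \<zero>\<^bsub>D\<^esub>) = (\<lambda>_. \<zero>\<^bsub>D\<^esub>)"
  by (auto simp: cone_def fun_eq_iff)

lemma neg_zero_fun:
  assumes "u \<in> carrier KD" "(\<lambda>_. \<zero>\<^bsub>D\<^esub>) = (\<lambda>S. \<ominus>\<^bsub>D\<^esub> kdiff u S)"
  shows "kdiff u = (\<lambda>_. \<zero>\<^bsub>D\<^esub>)"
proof
  fix S
  have "\<ominus>\<^bsub>D\<^esub> kdiff u S = \<zero>\<^bsub>D\<^esub>" using fun_cong[OF assms(2), of S] by simp
  then show "kdiff u S = \<zero>\<^bsub>D\<^esub>" using kdiff_closed[OF assms(1)] M.minus_minus M.a_inv_zero by metis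
qed

text \<open>If \<open>cone j u 0\<close> is the boundary of \<open>cone j a b\<close>, then
  \<open>b\<close> is a cycle of degree \<open>m'\<close>, hence the boundary of some
  \<open>c\<close>, and \<open>u\<close> is the boundary of \<open>a + x_j c\<close>. In the long
  exact sequence of the cone: the homology in degree \<open>m\<close> injects when the homology in
  degree \<open>m'\<close> vanishes.\<close>

lemma Hdeg_Suc_lower:
  assumes "m \<in> Hdeg j" "m' \<notin> Hdeg j"
  shows "m \<in> Hdeg (Suc j)"
proof -
  obtain u where u: "u \<in> Khom j m" "kdiff u = (\<lambda>_. \<zero>\<^bsub>D\<^esub>)" "\<And>w. w \<in> Khom j m \<Longrightarrow> kdiff w \<noteq> u"
    using assms(1) by (auto simp: Hdeg_def)
  note zero = Khom_zero[OF jd m']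
  let ?v = "cone j u (\<lambda>_. \<zero>\<^bsub>D\<^esub>)"
  have var0: "mpoly_var j \<odot>\<^bsub>D\<^esub> \<zero>\<^bsub>D\<^esub> = \<zero>\<^bsub>D\<^esub>" by (rule smult_r_null[OF mpoly_var_closed[OF j]])
  have "kdiff ?v = (\<lambda>_. \<zero>\<^bsub>D\<^esub>)"
    unfolding kdiff_cone[OF j m m' u(1) zero] by (simp add: u(2) kdiff_zero var0 cone_zero)
  moreover have "?v \<in> Khom (Suc j) m" using cone_Khom[OF j m u(1)] zero by (simp add: m'_def)
  moreover have "kdiff v \<noteq> ?v" if v: "v \<in> Khom (Suc j) m" for v
  proof
    assume eq: "kdiff v = ?v"
    obtain a b where ab: "a \<in> Khom j m" "b \<in> Khom j m'" "v = cone j a b"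
      using cone_cases[OF j m v] by (auto simp: m'_def)
    note parts = kdiff_cone_parts[OF ab(1,2) u(1) zero eq[unfolded ab(3)]]
    have "kdiff b = (\<lambda>_. \<zero>\<^bsub>D\<^esub>)" by (rule neg_zero_fun[OF KDm'[OF ab(2)] parts(2)])
    then obtain c where c: "c \<in> Khom j m'" "kdiff c = b" using Hdeg_exact[OF m' assms(2) ab(2)] by blast
    have "kdiff (\<lambda>S. a S \<oplus>\<^bsub>D\<^esub> mpoly_var j \<odot>\<^bsub>D\<^esub> c S) = u"
      using kdiff_add[OF KDm[OF ab(1)] KDm[OF var_Khom[OF c(1)]]] kdiff_var[OF c(1)] parts(1) c(2) by (auto simp: fun_eq_iff)
    moreover have "(\<lambda>S. a S \<oplus>\<^bsub>D\<^esub> mpoly_var j \<odot>\<^bsub>D\<^esub> c S) \<in> Khom j m"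
      by (rule Khom_add[OF jd m ab(1) var_Khom[OF c(1)]])
    ultimately show False using u(3) by blast
  qed
  ultimately show ?thesis using m by (auto simp: Hdeg_def)
qed

text \<open>If the homology in degree \<open>m\<close> vanishes, then \<open>x_j w\<close> is the
  boundary of some \<open>c\<close>, and \<open>cone j (-c) w\<close> is a cycle lifting
  \<open>w\<close>. A cone with this boundary would exhibit \<open>w\<close> itself as a
  boundary.\<close>

lemma Hdeg_Suc_upper:
  assumes "m \<notin> Hdeg j" "m' \<in> Hdeg j"
  shows "m \<in> Hdeg (Suc j)"
proof -
  obtain w where w: "w \<in> Khom j m'" "kdiff w = (\<lambda>_. \<zero>\<^bsub>D\<^esub>)" "\<And>c. c \<in> Khom j m' \<Longrightarrow> kdiff c \<noteq> w"
    using assms(2) by (auto simp: Hdeg_def)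
  have var0: "mpoly_var j \<odot>\<^bsub>D\<^esub> \<zero>\<^bsub>D\<^esub> = \<zero>\<^bsub>D\<^esub>" by (rule smult_r_null[OF mpoly_var_closed[OF j]])
  have "kdiff (\<lambda>S. mpoly_var j \<odot>\<^bsub>D\<^esub> w S) = (\<lambda>_. \<zero>\<^bsub>D\<^esub>)" by (simp add: kdiff_var[OF w(1)] w(2) var0)
  then obtain c where c: "c \<in> Khom j m" "kdiff c = (\<lambda>S. mpoly_var j \<odot>\<^bsub>D\<^esub> w S)"
    using Hdeg_exact[OF m assms(1) var_Khom[OF w(1)]] by blast
  let ?u = "\<lambda>S. \<ominus>\<^bsub>D\<^esub> c S"
  have u: "?u \<in> Khom j m" by (rule Khom_a_inv[OF jd m c(1)])
  let ?v = "cone j ?u w"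
  have "kdiff ?v = (\<lambda>_. \<zero>\<^bsub>D\<^esub>)"
    unfolding kdiff_cone[OF j m m' u w(1)]
    using KD_closed[OF KDm[OF var_Khom[OF w(1)]]]
    by (simp add: kdiff_a_inv[OF KDm[OF c(1)]] c(2) w(2) cone_zero M.l_neg)
  moreover have "?v \<in> Khom (Suc j) m" using cone_Khom[OF j m u] w(1) by (simp add: m'_def)
  moreover have "kdiff v \<noteq> ?v" if v: "v \<in> Khom (Suc j) m" for v
  proof
    assume eq: "kdiff v = ?v"
    obtain a b where ab: "a \<in> Khom j m" "b \<in> Khom j m'" "v = cone j a b"
      using cone_cases[OF j m v] by (auto simp: m'_def)
    note parts = kdiff_cone_parts[OF ab(1,2) u w(1) eq[unfolded ab(3)]]
    have "kdiff (\<lambda>S. \<ominus>\<^bsub>D\<^esub> b S) = w" using kdiff_a_inv[OF KDm'[OF ab(2)]] parts(2) by simp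
    then show False using w(3) Khom_a_inv[OF jd m' ab(2)] by blast
  qed
  ultimately show ?thesis using m by (auto simp: Hdeg_def)
qed

text \<open>In the exact sequence of the cone, the homology in degree \<open>m\<close> stands
  between two groups that vanish.\<close>

lemma Hdeg_Suc_subset:
  assumes "m \<notin> Hdeg j" "m' \<notin> Hdeg j"
  shows "m \<notin> Hdeg (Suc j)"
proof
  assume "m \<in> Hdeg (Suc j)"
  then obtain v where v: "v \<in> Khom (Suc j) m" "kdiff v = (\<lambda>_. \<zero>\<^bsub>D\<^esub>)" "\<And>w. w \<in> Khom (Suc j) m \<Longrightarrow> kdiff w \<noteq> v"
    by (auto simp: Hdeg_def)
  obtain a b where ab: "a \<in> Khom j m" "b \<in> Khom j m'" "v = cone j a b"
    using cone_cases[OF j m v(1)] by (auto simp: m'_def)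
  note parts = kdiff_cone_parts[OF ab(1,2) Khom_zero[OF jd m] Khom_zero[OF jd m'], unfolded cone_zero, OF v(2)[unfolded ab(3)]]
  have "kdiff b = (\<lambda>_. \<zero>\<^bsub>D\<^esub>)" by (rule neg_zero_fun[OF KDm'[OF ab(2)] parts(2)])
  then obtain c where c: "c \<in> Khom j m'" "kdiff c = b" using Hdeg_exact[OF m' assms(2) ab(2)] by blast
  \<comment> \<open>Subtracting the boundary of \<open>cone j 0 (-c)\<close> removes the second part
    of \<open>v\<close>; the corrected first part is this cycle, which bounds by exactness in degree
    \<open>m\<close>.\<close>
  let ?e = "\<lambda>S. a S \<oplus>\<^bsub>D\<^esub> mpoly_var j \<odot>\<^bsub>D\<^esub> c S"
  have e: "?e \<in> Khom j m" by (rule Khom_add[OF jd m ab(1) var_Khom[OF c(1)]])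
  have "kdiff ?e = (\<lambda>_. \<zero>\<^bsub>D\<^esub>)"
    using kdiff_add[OF KDm[OF ab(1)] KDm[OF var_Khom[OF c(1)]]] kdiff_var[OF c(1)] parts(1) c(2) by (auto simp: fun_eq_iff)
  then obtain f where f: "f \<in> Khom j m" "kdiff f = ?e" using Hdeg_exact[OF m assms(1) e] by blast
  let ?c = "\<lambda>S. \<ominus>\<^bsub>D\<^esub> c S"
  have nc: "?c \<in> Khom j m'" by (rule Khom_a_inv[OF jd m' c(1)])
  have "kdiff (cone j f ?c) = v"
  proof -
    note cl = KD_closed[OF KDm[OF ab(1)]] KD_closed[OF KDm'[OF ab(2)]] KD_closed[OF KDm'[OF c(1)]]
    have "kdiff f S \<oplus>\<^bsub>D\<^esub> mpoly_var j \<odot>\<^bsub>D\<^esub> ?c S = a S" for S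
    proof -
      have "mpoly_var j \<in> carrier R" by (rule mpoly_var_closed[OF j])
      then show ?thesis using cl by (simp add: f(2) smult_r_minus M.a_assoc M.r_neg)
    qed
    then show ?thesis
      unfolding kdiff_cone[OF j m m' f(1) nc] ab(3) using cl
      by (simp add: kdiff_a_inv[OF KDm'[OF c(1)]] c(2))
  qed
  moreover have "cone j f ?c \<in> Khom (Suc j) m" using cone_Khom[OF j m f(1)] nc by (simp add: m'_def)
  ultimately show False using v(3) by blast
qed

end

section \<open>The complex on no variables, and the count of degrees\<close>

lemma dmap_zero: "dmap D \<zero>\<^bsub>D\<^esub> = \<zero>\<^bsub>D\<^esub>"
  by (rule mod_hom_zero[OF D_module D_module dmap_mod_hom])

text \<open>The identification of \<open>D\<close> with the Koszul complex on no variables.\<close>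

definition at_empty :: "'m \<Rightarrow> nat set \<Rightarrow> 'm" where
  "at_empty x S = (if S = {} then x else \<zero>\<^bsub>D\<^esub>)"

lemma at_empty_Khom: "at_empty x \<in> Khom 0 m \<longleftrightarrow> x \<in> hcomp D m"
  by (auto simp: Khom_def at_empty_def set_deg_def)

lemma Khom_0_at_empty: "u \<in> Khom 0 m \<Longrightarrow> u = at_empty (u {})"
  by (auto simp: Khom_def at_empty_def fun_eq_iff)

lemma kdiff_at_empty:
  assumes "x \<in> carrier D"
  shows "kdiff (at_empty x) = at_empty (dmap D x)"
proof
  fix T
  have "(\<Oplus>\<^bsub>D\<^esub>i\<in>{..<d} - T. koszul_coeff i T \<odot>\<^bsub>D\<^esub> at_empty x (insert i T)) = \<zero>\<^bsub>D\<^esub>"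
    by (rule M.add.finprod_one_eqI) (auto simp: at_empty_def)
  then show "kdiff (at_empty x) T = at_empty (dmap D x) T"
    using assms smult_one[of "dmap D x"] by (auto simp: kdiff_def at_empty_def dmap_zero)
qed

lemma Hdeg_0:
  "m \<in> Hdeg 0 \<longleftrightarrow> m \<in> mdegs d \<and> (\<exists>x\<in>hcomp D m. dmap D x = \<zero>\<^bsub>D\<^esub> \<and> (\<forall>y\<in>hcomp D m. dmap D y \<noteq> x))"
proof (cases "m \<in> mdegs d")
  case True
  have inj: "at_empty x = at_empty y \<longleftrightarrow> x = y" for x y
    by (auto simp: at_empty_def fun_eq_iff split: if_splits)
  have zero: "(\<lambda>_. \<zero>\<^bsub>D\<^esub>) = at_empty \<zero>\<^bsub>D\<^esub>" by (auto simp: at_empty_def)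
  have K: "Khom 0 m = at_empty ` hcomp D m"
    using at_empty_Khom Khom_0_at_empty by (auto simp: image_iff) metis
  have "kdiff (at_empty x) = at_empty (dmap D x)" if "x \<in> hcomp D m" for x
    using kdiff_at_empty hcomp_carrier[OF True that] by blast
  then show ?thesis unfolding Hdeg_def mem_Collect_eq K zero using True by (auto simp: inj)
qed (simp add: Hdeg_def)

lemma dmap_dmap_zero: "\<forall>x\<in>carrier D. dmap D (dmap D x) = \<zero>\<^bsub>D\<^esub>"
  using dmap_dmap by blast

text \<open>As the differential has degree 0, the components of a cycle are cycles. If each of them
  bounds in its own degree, the finite sum of the chosen preimages bounds the whole cycle.\<close>

lemma Hdeg_0_nonempty:
  assumes "carrier (homology D) \<noteq> {\<zero>\<^bsub>homology D\<^esub>}"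
  shows "Hdeg 0 \<noteq> {}"
proof
  assume empty: "Hdeg 0 = {}"
  have "z \<in> dmap D ` carrier D" if z: "z \<in> dker D" for z
  proof -
    have zD: "z \<in> carrier D" "dmap D z = \<zero>\<^bsub>D\<^esub>" using z by (auto simp: dker_def)
    let ?S = "{m. component m z \<noteq> \<zero>\<^bsub>D\<^esub>}"
    have S: "?S \<subseteq> mdegs d" using component_outside[OF zD(1)] by auto
    have "\<exists>y\<in>hcomp D m. dmap D y = component m z" if "m \<in> ?S" for m
    proof -
      have "dmap D (component m z) = \<zero>\<^bsub>D\<^esub>"
        using component_dmap[OF zD(1), of m] by (simp add: zD(2) component_zero)
      then show ?thesis using empty Hdeg_0[of m] S that component_hcomp[OF zD(1)] by blast
    qed
    then obtain y where y: "\<And>m. m \<in> ?S \<Longrightarrow> y m \<in> hcomp D m \<and> dmap D (y m) = component m z" by metis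
    then have yD: "y \<in> ?S \<rightarrow> carrier D" using S hcomp_carrier by blast
    have "dmap D (\<Oplus>\<^bsub>D\<^esub>m\<in>?S. y m) = (\<Oplus>\<^bsub>D\<^esub>m\<in>?S. dmap D (y m))"
      by (rule mod_hom_finsum[OF D_module D_module dmap_mod_hom yD])
    also have "\<dots> = (\<Oplus>\<^bsub>D\<^esub>m\<in>?S. component m z)"
      by (rule M.finsum_cong') (use y component_closed[OF zD(1)] in auto)
    also have "\<dots> = z" using component_sum[OF zD(1)] by simp
    finally have "z = dmap D (\<Oplus>\<^bsub>D\<^esub>m\<in>?S. y m)" by (rule sym)
    then show ?thesis by (rule image_eqI) (rule M.finsum_closed[OF yD])
  qed
  then have zero: "dmap D ` carrier D +>\<^bsub>cycle_module D\<^esub> z = \<zero>\<^bsub>homology D\<^esub>" if "z \<in> dker D" for z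
    using homology_class_eq_zero[OF D_module dmap_mod_hom dmap_dmap_zero that] that by blast
  have "\<zero>\<^bsub>D\<^esub> \<in> dker D" by (simp add: dker_def dmap_zero)
  then have "carrier (homology D) = {\<zero>\<^bsub>homology D\<^esub>}"
    unfolding homology_carrier[OF D_module dmap_mod_hom dmap_dmap_zero] using zero by (simp add: image_constant_conv cong: image_cong) blast
  with assms show False by simp
qed

text \<open>Vanishing of a component of the homology yields a preimage \<open>y\<close> of unknown
  degree, whereas \<open>Hdeg\<close> speaks of preimages of degree \<open>m\<close>; the component
  of \<open>y\<close> in degree \<open>m\<close> is one.\<close>

lemma Hdeg_0_bounded:
  assumes "bounded_in_direction d (homology D) i"
  shows "\<exists>a b. \<forall>m\<in>Hdeg 0. Poly_Mapping.lookup m i \<in> {a..b}"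
proof -
  obtain a b where "\<forall>m\<in>mdegs d. Poly_Mapping.lookup m i \<notin> {a..b} \<longrightarrow> hcomp (homology D) m = {\<zero>\<^bsub>homology D\<^esub>}"
    using assms unfolding bounded_in_direction_def by blast
  then have ab: "hcomp (homology D) m = {\<zero>\<^bsub>homology D\<^esub>}" if "m \<in> mdegs d" "Poly_Mapping.lookup m i \<notin> {a..b}" for m
    using that by blast
  have "Poly_Mapping.lookup m i \<in> {a..b}" if m: "m \<in> Hdeg 0" for m
  proof (rule ccontr)
    assume out: "Poly_Mapping.lookup m i \<notin> {a..b}"
    obtain x where x: "m \<in> mdegs d" "x \<in> hcomp D m" "dmap D x = \<zero>\<^bsub>D\<^esub>" "\<And>y. y \<in> hcomp D m \<Longrightarrow> dmap D y \<noteq> x"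
      using m by (auto simp: Hdeg_0)
    then have xk: "x \<in> dker D" using hcomp_carrier by (simp add: dker_def)
    have "dmap D ` carrier D +>\<^bsub>cycle_module D\<^esub> x \<in> hcomp (homology D) m"
      unfolding homology_hcomp[OF D_module dmap_mod_hom dmap_dmap_zero] using x(2) xk by blast
    then have "dmap D ` carrier D +>\<^bsub>cycle_module D\<^esub> x = \<zero>\<^bsub>homology D\<^esub>" using ab[OF x(1) out] by simp
    then obtain y where y: "y \<in> carrier D" "x = dmap D y"
      using homology_class_eq_zero[OF D_module dmap_mod_hom dmap_dmap_zero xk] by blast
    have "dmap D (component m y) = component m x" using component_dmap[OF y(1)] y(2) by simp
    also have "\<dots> = x" using component_homogeneous[OF x(1,2)] by simp
    finally show False using x(4)[OF component_hcomp[OF y(1) x(1)]] by simp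
  qed
  then show ?thesis by blast
qed

lemma Hdeg_count:
  assumes "carrier (homology D) \<noteq> {\<zero>\<^bsub>homology D\<^esub>}" "\<forall>i<d. bounded_in_direction d (homology D) i"
  shows "\<exists>F\<subseteq>Hdeg d. finite F \<and> card F = 2 ^ d"
proof (rule translate_count[of Hdeg d])
  show "Hdeg 0 \<noteq> {}" by (rule Hdeg_0_nonempty[OF assms(1)])
  show "\<exists>a b. \<forall>m\<in>Hdeg 0. Poly_Mapping.lookup m i \<in> {a..b}" if "i < d" for i
    using Hdeg_0_bounded assms(2) that by blast
  fix j m assume j: "j < d"
  have mdegs: "n \<in> mdegs d" if "n \<in> Hdeg j" for n j using that by (simp add: Hdeg_def)
  show "m \<in> Hdeg j \<or> m - Poly_Mapping.single j 1 \<in> Hdeg j" if "m \<in> Hdeg (Suc j)"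
    using Hdeg_Suc_subset[OF j mdegs[OF that] refl] that by blast
  show "m \<in> Hdeg (Suc j)" if ne: "(m \<in> Hdeg j) \<noteq> (m - Poly_Mapping.single j 1 \<in> Hdeg j)"
  proof -
    have "m \<in> mdegs d"
    proof (cases "m \<in> Hdeg j")
      case False
      then have "m - Poly_Mapping.single j 1 + Poly_Mapping.single j 1 \<in> mdegs d"
        using ne j by (intro mdegs_intros(1) mdegs_intros(3) mdegs) simp
      then show ?thesis by simp
    qed (rule mdegs)
    then show ?thesis using Hdeg_Suc_lower[OF j _ refl] Hdeg_Suc_upper[OF j _ refl] ne by blast
  qed
qed

end

section \<open>Linear independence\<close>

lemma (in abelian_monoid) finsum_swap:
  assumes "finite A" "finite B" "\<And>a b. \<lbrakk>a \<in> A; b \<in> B\<rbrakk> \<Longrightarrow> f a b \<in> carrier G"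
  shows "(\<Oplus>a\<in>A. \<Oplus>b\<in>B. f a b) = (\<Oplus>b\<in>B. \<Oplus>a\<in>A. f a b)"
  using assms(1,3)
proof (induction A rule: finite_induct)
  case empty
  then show ?case by simp
next
  case (insert x A)
  have cl: "(\<lambda>a. \<Oplus>b\<in>B. f a b) \<in> A \<rightarrow> carrier G" "(\<Oplus>b\<in>B. f x b) \<in> carrier G"
    "(\<lambda>b. f x b) \<in> B \<rightarrow> carrier G" "(\<lambda>b. \<Oplus>a\<in>A. f a b) \<in> B \<rightarrow> carrier G"
    using insert.prems by (auto intro!: finsum_closed)
  have "(\<Oplus>a\<in>insert x A. \<Oplus>b\<in>B. f a b) = (\<Oplus>b\<in>B. f x b) \<oplus> (\<Oplus>b\<in>B. \<Oplus>a\<in>A. f a b)"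
    using insert cl by simp
  also have "\<dots> = (\<Oplus>b\<in>B. f x b \<oplus> (\<Oplus>a\<in>A. f a b))"
    by (rule finsum_addf[symmetric]) (use cl in auto)
  also have "\<dots> = (\<Oplus>b\<in>B. \<Oplus>a\<in>insert x A. f a b)"
  proof (rule finsum_cong'[OF refl])
    show "(\<lambda>b. \<Oplus>a\<in>insert x A. f a b) \<in> B \<rightarrow> carrier G"
      using insert.prems by (auto intro!: finsum_closed)
    show "f x b \<oplus> (\<Oplus>a\<in>A. f a b) = (\<Oplus>a\<in>insert x A. f a b)" if "b \<in> B" for b
      by (rule finsum_insert[symmetric]) (use insert that in auto)
  qed
  finally show ?case .
qed

text \<open>Gaussian elimination for a homogeneous system with unknowns \<open>I\<close> and
  equations \<open>B\<close>: the equation \<open>b\<close> with pivot \<open>j\<close> eliminates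
  one unknown from the others.\<close>

lemma exists_kernel_vector:
  fixes a :: "'i \<Rightarrow> 'b \<Rightarrow> 'k::field"
  assumes "finite B" "finite I" "card B < card I"
  shows "\<exists>c. (\<exists>i\<in>I. c i \<noteq> 0) \<and> (\<forall>b\<in>B. (\<Sum>i\<in>I. c i * a i b) = 0)"
  using assms
proof (induction B arbitrary: I a rule: finite_induct)
  case empty
  then obtain i where "i \<in> I" by fastforce
  then show ?case by (intro exI[of _ "\<lambda>_. 1"]) auto
next
  case (insert b B)
  show ?case
  proof (cases "\<forall>i\<in>I. a i b = 0")
    case True
    have "card B < card I" using insert by simp
    from insert.IH[OF insert.prems(1) this, of a] True show ?thesis by auto
  next
    case False
    then obtain j where j: "j \<in> I" "a j b \<noteq> 0" by blast
    let ?J = "I - {j}" and ?a = "\<lambda>i b'. a i b' - a i b / a j b * a j b'"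
    have "finite ?J" "card B < card ?J" using insert j by auto
    from insert.IH[OF this, of ?a] obtain c where
      c: "\<exists>i\<in>?J. c i \<noteq> 0" "\<And>b'. b' \<in> B \<Longrightarrow> (\<Sum>i\<in>?J. c i * ?a i b') = 0" by blast
    \<comment> \<open>The value \<open>- e\<close> of the eliminated unknown is forced by equation
      \<open>b\<close>.\<close>
    define e where "e = (\<Sum>i\<in>?J. c i * (a i b / a j b))"
    let ?c = "c(j := - e)"
    have sum: "(\<Sum>i\<in>I. ?c i * a i b') = - e * a j b' + (\<Sum>i\<in>?J. c i * a i b')" for b'
    proof -
      have "(\<Sum>i\<in>I. ?c i * a i b') = ?c j * a j b' + (\<Sum>i\<in>?J. ?c i * a i b')"
        by (rule sum.remove) (use insert.prems j in auto)
      also have "(\<Sum>i\<in>?J. ?c i * a i b') = (\<Sum>i\<in>?J. c i * a i b')" by (rule sum.cong) auto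
      finally show ?thesis by simp
    qed
    have "(\<Sum>i\<in>I. ?c i * a i b') = 0" if "b' \<in> insert b B" for b'
    proof (cases "b' = b")
      case True
      have "e * a j b = (\<Sum>i\<in>?J. c i * a i b)" unfolding e_def sum_distrib_right using j by simp
      then show ?thesis unfolding sum True by simp
    next
      case False
      with that have "(\<Sum>i\<in>?J. c i * ?a i b') = 0" using c(2) by blast
      then have "(\<Sum>i\<in>?J. c i * a i b') = (\<Sum>i\<in>?J. c i * (a i b / a j b) * a j b')"
        by (simp add: algebra_simps sum_subtractf)
      also have "\<dots> = e * a j b'" by (simp only: e_def sum_distrib_right)
      finally show ?thesis unfolding sum by simp
    qed
    moreover have "\<exists>i\<in>I. ?c i \<noteq> 0" using c(1) by auto
    ultimately show ?thesis by blast
  qed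
qed

section \<open>The ground field as a ring, dimension and restriction of scalars\<close>

lemma field_ring_simps [simp]:
  "carrier field_ring = UNIV" "\<zero>\<^bsub>field_ring\<^esub> = 0" "\<one>\<^bsub>field_ring\<^esub> = 1"
  "a \<oplus>\<^bsub>field_ring\<^esub> b = a + b" "a \<otimes>\<^bsub>field_ring\<^esub> b = a * b"
  by (simp_all add: field_ring_def)

lemma field_ring_cring: "cring (field_ring :: 'k::field ring)"
proof (rule cringI)
  show "abelian_group (field_ring :: 'k ring)"
  proof (rule abelian_groupI)
    fix p :: 'k
    show "\<exists>q\<in>carrier field_ring. q \<oplus>\<^bsub>field_ring\<^esub> p = \<zero>\<^bsub>field_ring\<^esub>"
      by (intro bexI[of _ "- p"]) simp_all
  qed (simp_all add: ac_simps)
  show "comm_monoid (field_ring :: 'k ring)"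
    by (rule comm_monoidI) (simp_all add: ac_simps)
qed (simp add: algebra_simps)

text \<open>Expressed in the basis, a linear relation among the \<open>w i\<close> is a system with
  \<open>card B\<close> equations and \<open>card I\<close> unknowns; were there more unknowns, a
  nontrivial solution would contradict independence.\<close>

lemma dimension_bound:
  fixes V :: "('k::field, 'v) module"
  assumes V: "Module.module field_ring V" and B: "module_basis field_ring V B" "finite B"
    and I: "finite I" "\<And>i. i \<in> I \<Longrightarrow> w i \<in> carrier V"
    and indep: "\<And>c i. \<lbrakk>(\<Oplus>\<^bsub>V\<^esub>i\<in>I. c i \<odot>\<^bsub>V\<^esub> w i) = \<zero>\<^bsub>V\<^esub>; i \<in> I\<rbrakk> \<Longrightarrow> c i = 0"
  shows "card I \<le> card B"
proof (rule ccontr)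
  assume "\<not> card I \<le> card B"
  interpret V: Module.module field_ring V by (fact V)
  have BV: "B \<subseteq> carrier V" using B by (simp add: module_basis_def)
  have "\<exists>a. w i = (\<Oplus>\<^bsub>V\<^esub>b\<in>B. a b \<odot>\<^bsub>V\<^esub> b)" if i: "i \<in> I" for i
  proof -
    obtain f where f: "\<And>b. b \<notin> B \<Longrightarrow> f b = 0" "w i = (\<Oplus>\<^bsub>V\<^esub>b\<in>{b. f b \<noteq> 0}. f b \<odot>\<^bsub>V\<^esub> b)"
      using B(1) I(2)[OF i] unfolding module_basis_def by (force dest!: bspec ex1_implies_ex)
    have "(\<Oplus>\<^bsub>V\<^esub>b\<in>{b. f b \<noteq> 0}. f b \<odot>\<^bsub>V\<^esub> b) = (\<Oplus>\<^bsub>V\<^esub>b\<in>B. f b \<odot>\<^bsub>V\<^esub> b)"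
    proof (rule V.M.add.finprod_mono_neutral_cong_left[OF B(2)])
      show "{b. f b \<noteq> 0} \<subseteq> B" using f(1) by auto
      show "(\<lambda>b. f b \<odot>\<^bsub>V\<^esub> b) \<in> B \<rightarrow> carrier V" using BV by auto
      show "f b \<odot>\<^bsub>V\<^esub> b = \<zero>\<^bsub>V\<^esub>" if "b \<in> B - {b. f b \<noteq> 0}" for b
        using that BV V.smult_l_null[of b] by auto
    qed simp
    with f(2) show ?thesis by metis
  qed
  then obtain a where a: "\<And>i. i \<in> I \<Longrightarrow> w i = (\<Oplus>\<^bsub>V\<^esub>b\<in>B. a i b \<odot>\<^bsub>V\<^esub> b)" by metis
  obtain c where c: "\<exists>i\<in>I. c i \<noteq> 0" "\<And>b. b \<in> B \<Longrightarrow> (\<Sum>i\<in>I. c i * a i b) = 0"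
    using exists_kernel_vector[OF B(2) I(1), of a] \<open>\<not> card I \<le> card B\<close> by auto
  have sum_smult: "(\<Oplus>\<^bsub>V\<^esub>i\<in>J. r i \<odot>\<^bsub>V\<^esub> x) = sum r J \<odot>\<^bsub>V\<^esub> x" if x: "x \<in> carrier V" for J r x
  proof (induction J rule: infinite_finite_induct)
    case (insert j J)
    then show ?case using x V.smult_l_distr[of "r j" "sum r J" x] by simp
  qed (use x V.smult_l_null[of x] in \<open>simp_all add: V.M.finsum_infinite\<close>)
  have "(\<Oplus>\<^bsub>V\<^esub>i\<in>I. c i \<odot>\<^bsub>V\<^esub> w i) = (\<Oplus>\<^bsub>V\<^esub>i\<in>I. \<Oplus>\<^bsub>V\<^esub>b\<in>B. (c i * a i b) \<odot>\<^bsub>V\<^esub> b)"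
  proof (rule V.M.finsum_cong'[OF refl])
    show "(\<lambda>i. \<Oplus>\<^bsub>V\<^esub>b\<in>B. (c i * a i b) \<odot>\<^bsub>V\<^esub> b) \<in> I \<rightarrow> carrier V"
      using BV by (auto intro!: V.M.finsum_closed)
    fix i assume i: "i \<in> I"
    have "c i \<odot>\<^bsub>V\<^esub> w i = (\<Oplus>\<^bsub>V\<^esub>b\<in>B. c i \<odot>\<^bsub>V\<^esub> (a i b \<odot>\<^bsub>V\<^esub> b))"
      unfolding a[OF i] by (rule V.finsum_smult_ldistr) (use B BV in auto)
    also have "\<dots> = (\<Oplus>\<^bsub>V\<^esub>b\<in>B. (c i * a i b) \<odot>\<^bsub>V\<^esub> b)"
      by (rule V.M.finsum_cong') (use BV V.smult_assoc1 in auto)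
    finally show "c i \<odot>\<^bsub>V\<^esub> w i = (\<Oplus>\<^bsub>V\<^esub>b\<in>B. (c i * a i b) \<odot>\<^bsub>V\<^esub> b)" .
  qed
  also have "\<dots> = (\<Oplus>\<^bsub>V\<^esub>b\<in>B. \<Oplus>\<^bsub>V\<^esub>i\<in>I. (c i * a i b) \<odot>\<^bsub>V\<^esub> b)"
    by (rule V.M.finsum_swap[OF I(1) B(2)]) (use BV in auto)
  also have "\<dots> = \<zero>\<^bsub>V\<^esub>"
  proof (rule V.M.add.finprod_one_eqI)
    fix b assume b: "b \<in> B"
    then have "b \<in> carrier V" using BV by blast
    then show "(\<Oplus>\<^bsub>V\<^esub>i\<in>I. (c i * a i b) \<odot>\<^bsub>V\<^esub> b) = \<zero>\<^bsub>V\<^esub>"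
      using V.smult_l_null[of b] by (simp add: sum_smult c(2)[OF b])
  qed
  finally show False using indep[of c] c(1) by blast
qed

text \<open>Finite sums depend only on the additive structure, so they agree before and after
  restricting scalars to the field.\<close>

lemma finsum_struct_cong:
  assumes "carrier G = carrier H" "\<zero>\<^bsub>G\<^esub> = \<zero>\<^bsub>H\<^esub>" "\<And>x y. x \<oplus>\<^bsub>G\<^esub> y = x \<oplus>\<^bsub>H\<^esub> y"
  shows "finsum G f A = finsum H f A"
proof -
  have "add G = add H" using assms(3) by (intro ext)
  then show ?thesis using assms(1,2) by (simp add: finsum_def finprod_def)
qed

lemma restrict_to_field_simps [simp]:
  "carrier (restrict_to_field M) = carrier M" "\<zero>\<^bsub>restrict_to_field M\<^esub> = \<zero>\<^bsub>M\<^esub>"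
  "x \<oplus>\<^bsub>restrict_to_field M\<^esub> y = x \<oplus>\<^bsub>M\<^esub> y"
  "c \<odot>\<^bsub>restrict_to_field M\<^esub> x = Poly_Mapping.single 0 c \<odot>\<^bsub>M\<^esub> x"
  by (simp_all add: restrict_to_field_def)

lemma restrict_to_field_module:
  assumes "Module.module (mpoly_ring d) M"
  shows "Module.module field_ring (restrict_to_field M)"
proof -
  interpret M: Module.module "mpoly_ring d" M by fact
  have c: "Poly_Mapping.single 0 c \<in> carrier (mpoly_ring d)" for c :: 'a by simp
  have "\<exists>y\<in>carrier M. y \<oplus>\<^bsub>M\<^esub> x = \<zero>\<^bsub>M\<^esub>" if "x \<in> carrier M" for x
    using that M.l_neg by blast
  then have ag: "abelian_group (restrict_to_field M)"
    by (intro abelian_groupI) (simp_all add: M.a_ac)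
  show ?thesis
  proof (rule moduleI[OF field_ring_cring ag])
    fix a b :: 'a and x assume x: "x \<in> carrier (restrict_to_field M)"
    show "(a \<oplus>\<^bsub>field_ring\<^esub> b) \<odot>\<^bsub>restrict_to_field M\<^esub> x = a \<odot>\<^bsub>restrict_to_field M\<^esub> x \<oplus>\<^bsub>restrict_to_field M\<^esub> b \<odot>\<^bsub>restrict_to_field M\<^esub> x"
      using x M.smult_l_distr[OF c c, of x a b] by (simp add: single_add)
    show "(a \<otimes>\<^bsub>field_ring\<^esub> b) \<odot>\<^bsub>restrict_to_field M\<^esub> x = a \<odot>\<^bsub>restrict_to_field M\<^esub> (b \<odot>\<^bsub>restrict_to_field M\<^esub> x)"
      using x M.smult_assoc1[OF c c, of x a b] by (simp add: mult_single)
    show "\<one>\<^bsub>field_ring\<^esub> \<odot>\<^bsub>restrict_to_field M\<^esub> x = x" using x M.smult_one[of x] by simp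
  qed (simp_all add: c M.smult_r_distr)
qed

section \<open>The box product\<close>

lemma shift_simps [simp]:
  "carrier (shift e M) = carrier M" "\<zero>\<^bsub>shift e M\<^esub> = \<zero>\<^bsub>M\<^esub>"
  "x \<oplus>\<^bsub>shift e M\<^esub> y = x \<oplus>\<^bsub>M\<^esub> y" "r \<odot>\<^bsub>shift e M\<^esub> x = r \<odot>\<^bsub>M\<^esub> x"
  by (simp_all add: shift_def)

lemma tensor_module_shift: "tensor_module R (shift e M) N = tensor_module R M N"
  by (simp add: tensor_module_def tensor_rel_def tensor_free_def)

lemma box_summand_simps [simp]:
  "carrier (box_summand d C D i) = carrier (tensor_module (mpoly_ring d) (cobj C i) D)"
  "\<zero>\<^bsub>box_summand d C D i\<^esub> = \<zero>\<^bsub>tensor_module (mpoly_ring d) (cobj C i) D\<^esub>"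
  "x \<oplus>\<^bsub>box_summand d C D i\<^esub> y = x \<oplus>\<^bsub>tensor_module (mpoly_ring d) (cobj C i) D\<^esub> y"
  "r \<odot>\<^bsub>box_summand d C D i\<^esub> x = r \<odot>\<^bsub>tensor_module (mpoly_ring d) (cobj C i) D\<^esub> x"
  by (simp_all add: box_summand_def graded_tensor_def tensor_module_shift)

lemma box_summand_a_inv [simp]:
  "\<ominus>\<^bsub>box_summand d C D i\<^esub> x = \<ominus>\<^bsub>tensor_module (mpoly_ring d) (cobj C i) D\<^esub> x"
  by (simp add: a_inv_def m_inv_def)

lemma box_simps [simp]:
  "\<zero>\<^bsub>box d C D\<^esub> = (\<lambda>i. \<zero>\<^bsub>tensor_module (mpoly_ring d) (cobj C i) D\<^esub>)"
  "u \<oplus>\<^bsub>box d C D\<^esub> v = (\<lambda>i. u i \<oplus>\<^bsub>tensor_module (mpoly_ring d) (cobj C i) D\<^esub> v i)"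
  "r \<odot>\<^bsub>box d C D\<^esub> u = (\<lambda>i. r \<odot>\<^bsub>tensor_module (mpoly_ring d) (cobj C i) D\<^esub> u i)"
  "dmap (box d C D) = box_map d C D"
  by (simp_all add: box_def Let_def)

lemma box_carrier:
  "u \<in> carrier (box d C D) \<longleftrightarrow>
    (\<forall>i. u i \<in> carrier (tensor_module (mpoly_ring d) (cobj C i) D))
      \<and> finite {i. u i \<noteq> \<zero>\<^bsub>tensor_module (mpoly_ring d) (cobj C i) D\<^esub>}"
  by (simp add: box_def Let_def)

lemma scalar_mod_hom:
  assumes M: "Module.module (mpoly_ring d) M" and x: "x \<in> carrier M"
  shows "(\<lambda>r. r \<odot>\<^bsub>M\<^esub> x) \<in> mod_hom (mpoly_ring d) (poly_module d) M"
proof -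
  interpret M: Module.module "mpoly_ring d" M by fact
  show ?thesis
    by (rule mod_homI) (use x M.smult_l_distr[of _ _ x] M.smult_assoc1[of _ _ x] in auto)
qed

lemma sum_smult_module:
  assumes M: "Module.module (mpoly_ring d) M" and x: "x \<in> carrier M"
    and f: "\<And>a. a \<in> A \<Longrightarrow> f a \<in> carrier (mpoly_ring d :: 'k::field mpol ring)"
  shows "sum f A \<odot>\<^bsub>M\<^esub> x = (\<Oplus>\<^bsub>M\<^esub>a\<in>A. f a \<odot>\<^bsub>M\<^esub> x)"
proof -
  have f': "f \<in> A \<rightarrow> carrier (mpoly_ring d)" using f by auto
  have "(\<Oplus>\<^bsub>poly_module d\<^esub>a\<in>A. f a) \<odot>\<^bsub>M\<^esub> x = (\<Oplus>\<^bsub>M\<^esub>a\<in>A. f a \<odot>\<^bsub>M\<^esub> x)"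
    by (rule mod_hom_finsum[OF poly_module_is_module M scalar_mod_hom[OF M x]]) (use f in auto)
  then show ?thesis using poly_module_finsum[OF f'] by simp
qed

text \<open>Rewrites the Koszul part of \<open>kdiff\<close> as a matrix product. The entry at
  \<open>T\<close> and \<open>S\<close> is nonzero only if \<open>S\<close> is
  \<open>insert i T\<close> for a new index \<open>i\<close>, and then it is
  \<open>koszul_coeff i T\<close>. Chain maps and homotopies are expanded over basis elements, hence
  over all \<open>S\<close>.\<close>

lemma koszul_diff_matrix:
  assumes M: "Module.module (mpoly_ring d :: 'k::field mpol ring) M" and v: "\<And>S. v S \<in> carrier M"
    and T: "T \<in> subsets_of_card d n"
  shows "(\<Oplus>\<^bsub>M\<^esub>i\<in>{..<d} - T. koszul_coeff i T \<odot>\<^bsub>M\<^esub> v (insert i T)) =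
    (\<Oplus>\<^bsub>M\<^esub>S\<in>subsets_of_card d (Suc n). koszul_diff d (free_gen (mpoly_ring d) S) T \<odot>\<^bsub>M\<^esub> v S)"
proof -
  interpret M: Module.module "mpoly_ring d" M by fact
  let ?J = "{..<d} - T" and ?c = "\<lambda>S. koszul_diff d (free_gen (mpoly_ring d) S) T :: 'k mpol"
  have Td: "T \<subseteq> {..<d}" using T by (simp add: subsets_of_card_def)
  have inj: "inj_on (\<lambda>i. insert i T) ?J" by (auto simp: inj_on_def)
  have sub: "(\<lambda>i. insert i T) ` ?J \<subseteq> subsets_of_card d (Suc n)"
    using T insert_subsets_of_card[OF Td] by (auto simp: subsets_of_card_def)
  have c: "?c S = (\<Sum>i\<in>?J. koszul_coeff i T * (if insert i T = S then 1 else 0))" for S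
    using Td by (simp add: koszul_diff_def free_gen_def cong: if_cong)
  have c1: "?c (insert i T) = koszul_coeff i T" if i: "i \<in> ?J" for i
  proof -
    have "?c (insert i T) = (\<Sum>l\<in>?J. if l = i then koszul_coeff i T else 0)"
      unfolding c by (rule sum.cong) (use i inj in \<open>auto simp: inj_on_def\<close>)
    then show ?thesis using i by simp
  qed
  have c0: "?c S = 0" if "S \<notin> (\<lambda>i. insert i T) ` ?J" for S
    unfolding c by (rule sum.neutral) (use that in auto)
  have c_closed: "?c S \<in> carrier (mpoly_ring d)" for S
    unfolding c by (rule mpoly_carrier_sum) auto
  have "(\<Oplus>\<^bsub>M\<^esub>S\<in>(\<lambda>i. insert i T) ` ?J. ?c S \<odot>\<^bsub>M\<^esub> v S) = (\<Oplus>\<^bsub>M\<^esub>i\<in>?J. ?c (insert i T) \<odot>\<^bsub>M\<^esub> v (insert i T))"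
    by (rule M.M.finsum_reindex[OF _ inj]) (use v c_closed in auto)
  also have "\<dots> = (\<Oplus>\<^bsub>M\<^esub>i\<in>?J. koszul_coeff i T \<odot>\<^bsub>M\<^esub> v (insert i T))"
    by (rule M.M.finsum_cong') (use v c1 in auto)
  also have "(\<Oplus>\<^bsub>M\<^esub>S\<in>(\<lambda>i. insert i T) ` ?J. ?c S \<odot>\<^bsub>M\<^esub> v S) = (\<Oplus>\<^bsub>M\<^esub>S\<in>subsets_of_card d (Suc n). ?c S \<odot>\<^bsub>M\<^esub> v S)"
    by (rule M.M.add.finprod_mono_neutral_cong_left[OF _ sub])
      (use v c0 c_closed M.smult_l_null in auto)
  finally show ?thesis by simp
qed

locale koszul_box = koszul_tensor d D
  for d :: nat and D :: "('k::field mpol, 'm) graded_diff_module" +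
  fixes P :: "('k mpol, 'p) graded_complex"
  assumes P: "graded_complex d P" and P_neg: "\<And>i. i < 0 \<Longrightarrow> carrier (cobj P i) = {\<zero>\<^bsub>cobj P i\<^esub>}"
begin

abbreviation "T i \<equiv> tensor_module R (cobj P i) D"
abbreviation "pure i \<equiv> pure_tensor R (cobj P i) D"
abbreviation "cdiff_tensor j \<equiv> tensor_map R (cobj P (j + 1)) D (cobj P j) D (cdiff P (j + 1)) (\<lambda>x. x)"
abbreviation "dmap_tensor j \<equiv> tensor_map R (cobj P j) D (cobj P j) D (\<lambda>c. c) (dmap D)"

lemma P_module: "Module.module R (cobj P i)"
  using graded_complex.cobj_graded[OF P] by (rule graded_module.axioms(1))

lemma cdiff_mod_hom: "cdiff P (i + 1) \<in> mod_hom R (cobj P (i + 1)) (cobj P i)"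
  using graded_complex.cdiff_hom[OF P, of "i + 1"] by (simp add: graded_hom_def)

lemma T_module: "Module.module R (T i)" by (rule tensor_module_is_module[OF P_module D_module])

lemma pure_hom1: "y \<in> carrier D \<Longrightarrow> (\<lambda>x. pure i x y) \<in> mod_hom R (cobj P i) (T i)"
  using pure_tensor_bilinear[OF P_module D_module] by (simp add: bilinear_map_def)

lemma pure_hom2: "x \<in> carrier (cobj P i) \<Longrightarrow> pure i x \<in> mod_hom R D (T i)"
  using pure_tensor_bilinear[OF P_module D_module] by (simp add: bilinear_map_def)

lemmas pure_closed = pure_tensor_closed[OF P_module D_module]

lemma cdiff_tensor_hom: "cdiff_tensor j \<in> mod_hom R (T (j + 1)) (T j)"
  by (rule tensor_map_hom[OF P_module D_module P_module D_module cdiff_mod_hom mod_hom_id])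

lemma dmap_tensor_hom: "dmap_tensor j \<in> mod_hom R (T j) (T j)"
  by (rule tensor_map_hom[OF P_module D_module P_module D_module mod_hom_id dmap_mod_hom])

lemma cdiff_tensor_pure: "\<lbrakk>x \<in> carrier (cobj P (j + 1)); y \<in> carrier D\<rbrakk> \<Longrightarrow> cdiff_tensor j (pure (j + 1) x y) = pure j (cdiff P (j + 1) x) y"
  by (rule tensor_map_pure[OF P_module D_module P_module D_module cdiff_mod_hom mod_hom_id])

lemma dmap_tensor_pure: "\<lbrakk>x \<in> carrier (cobj P j); y \<in> carrier D\<rbrakk> \<Longrightarrow> dmap_tensor j (pure j x y) = pure j x (dmap D y)"
  by (rule tensor_map_pure[OF P_module D_module P_module D_module mod_hom_id dmap_mod_hom])

lemmas T_eqI = tensor_hom_eqI[OF P_module D_module]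

lemma cdiff_tensor_cdiff_tensor: "t \<in> carrier (T (j + 1 + 1)) \<Longrightarrow> cdiff_tensor j (cdiff_tensor (j + 1) t) = \<zero>\<^bsub>T j\<^esub>"
proof (rule T_eqI[OF T_module mod_hom_comp[OF cdiff_tensor_hom cdiff_tensor_hom] mod_hom_zero_map[OF T_module T_module]])
  fix x y assume x: "x \<in> carrier (cobj P (j + 1 + 1))" and y: "y \<in> carrier D"
  have "cdiff P (j + 1) (cdiff P (j + 1 + 1) x) = \<zero>\<^bsub>cobj P j\<^esub>"
    using graded_complex.cdiff_cdiff[OF P x] by (simp add: ac_simps)
  then show "cdiff_tensor j (cdiff_tensor (j + 1) (pure (j + 1 + 1) x y)) = \<zero>\<^bsub>T j\<^esub>"
    unfolding cdiff_tensor_pure[OF x y] cdiff_tensor_pure[OF mod_homD(1)[OF cdiff_mod_hom x] y]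
    by (simp only: mod_hom_zero[OF P_module T_module pure_hom1[OF y]])
qed

lemma dmap_tensor_dmap_tensor: "t \<in> carrier (T j) \<Longrightarrow> dmap_tensor j (dmap_tensor j t) = \<zero>\<^bsub>T j\<^esub>"
proof (rule T_eqI[OF T_module mod_hom_comp[OF dmap_tensor_hom dmap_tensor_hom] mod_hom_zero_map[OF T_module T_module]])
  fix x y assume x: "x \<in> carrier (cobj P j)" and y: "y \<in> carrier D"
  then show "dmap_tensor j (dmap_tensor j (pure j x y)) = \<zero>\<^bsub>T j\<^esub>"
    using mod_hom_zero[OF D_module T_module pure_hom2[OF x]] dmap_dmap[OF y] by (simp add: dmap_tensor_pure)
qed

lemma cdiff_tensor_dmap_tensor: "t \<in> carrier (T (j + 1)) \<Longrightarrow> cdiff_tensor j (dmap_tensor (j + 1) t) = dmap_tensor j (cdiff_tensor j t)"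
proof (rule T_eqI[OF T_module mod_hom_comp[OF dmap_tensor_hom cdiff_tensor_hom] mod_hom_comp[OF cdiff_tensor_hom dmap_tensor_hom]])
  fix x y assume x: "x \<in> carrier (cobj P (j + 1))" and y: "y \<in> carrier D"
  then show "cdiff_tensor j (dmap_tensor (j + 1) (pure (j + 1) x y)) = dmap_tensor j (cdiff_tensor j (pure (j + 1) x y))"
    using mod_homD(1)[OF cdiff_mod_hom x] by (simp add: dmap_tensor_pure cdiff_tensor_pure)
qed

text \<open>Tensoring the zero module gives zero. It settles the negative degrees, where the Koszul
  complex has no counterpart.\<close>

lemma T_neg:
  assumes i: "i < 0" and t: "t \<in> carrier (T i)"
  shows "t = \<zero>\<^bsub>T i\<^esub>"
  using t
proof (rule T_eqI[OF T_module mod_hom_id mod_hom_zero_map[OF T_module T_module], rotated])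
  fix x y assume "x \<in> carrier (cobj P i)" and y: "y \<in> carrier D"
  then have "x = \<zero>\<^bsub>cobj P i\<^esub>" using P_neg[OF i] by simp
  then show "pure i x y = \<zero>\<^bsub>T i\<^esub>" using mod_hom_zero[OF P_module T_module pure_hom1[OF y]] by simp
qed

lemma box_map_eq:
  "box_map d P D u j = cdiff_tensor j (u (j + 1)) \<oplus>\<^bsub>T j\<^esub> (if even j then dmap_tensor j (u j) else \<ominus>\<^bsub>T j\<^esub> dmap_tensor j (u j))"
  by (simp add: box_map_def Let_def)

lemma box_closed: "u \<in> carrier (box d P D) \<Longrightarrow> u i \<in> carrier (T i)"
  by (simp add: box_carrier)

lemma box_module: "Module.module R (box d P D)"
proof -
  interpret T: Module.module R "T i" for i by (rule T_module)
  have "abelian_group (box d P D)"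
  proof (rule abelian_groupI)
    fix u v assume uv: "u \<in> carrier (box d P D)" "v \<in> carrier (box d P D)"
    have "finite {i. u i \<oplus>\<^bsub>T i\<^esub> v i \<noteq> \<zero>\<^bsub>T i\<^esub>}"
      by (rule finite_subset[of _ "{i. u i \<noteq> \<zero>\<^bsub>T i\<^esub>} \<union> {i. v i \<noteq> \<zero>\<^bsub>T i\<^esub>}"])
        (use uv in \<open>auto simp: box_carrier\<close>)
    with uv show "u \<oplus>\<^bsub>box d P D\<^esub> v \<in> carrier (box d P D)" by (simp add: box_carrier)
    show "u \<oplus>\<^bsub>box d P D\<^esub> v = v \<oplus>\<^bsub>box d P D\<^esub> u" using uv by (simp add: box_closed T.M.a_comm)
    fix w assume "w \<in> carrier (box d P D)"
    with uv show "u \<oplus>\<^bsub>box d P D\<^esub> v \<oplus>\<^bsub>box d P D\<^esub> w = u \<oplus>\<^bsub>box d P D\<^esub> (v \<oplus>\<^bsub>box d P D\<^esub> w)"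
      by (simp add: box_closed T.M.a_assoc)
  next
    fix u assume u: "u \<in> carrier (box d P D)"
    have "finite {i. \<ominus>\<^bsub>T i\<^esub> u i \<noteq> \<zero>\<^bsub>T i\<^esub>}"
      by (rule finite_subset[of _ "{i. u i \<noteq> \<zero>\<^bsub>T i\<^esub>}"]) (use u in \<open>auto simp: box_carrier\<close>)
    then have "(\<lambda>i. \<ominus>\<^bsub>T i\<^esub> u i) \<in> carrier (box d P D)" using u by (simp add: box_carrier)
    then show "\<exists>v\<in>carrier (box d P D). v \<oplus>\<^bsub>box d P D\<^esub> u = \<zero>\<^bsub>box d P D\<^esub>"
      by (rule bexI[rotated]) (use u in \<open>simp add: box_closed T.M.l_neg\<close>)
    show "\<zero>\<^bsub>box d P D\<^esub> \<oplus>\<^bsub>box d P D\<^esub> u = u" using u by (simp add: box_closed)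
  qed (simp add: box_carrier)
  then show ?thesis
  proof (rule moduleI[OF mpoly_cring])
    fix r u assume r: "r \<in> carrier R" and u: "u \<in> carrier (box d P D)"
    have "finite {i. r \<odot>\<^bsub>T i\<^esub> u i \<noteq> \<zero>\<^bsub>T i\<^esub>}"
      by (rule finite_subset[of _ "{i. u i \<noteq> \<zero>\<^bsub>T i\<^esub>}"]) (use r u in \<open>auto simp: box_carrier\<close>)
    then show "r \<odot>\<^bsub>box d P D\<^esub> u \<in> carrier (box d P D)" using r u by (simp add: box_carrier)
  next
    fix u assume "u \<in> carrier (box d P D)"
    then show "\<one>\<^bsub>R\<^esub> \<odot>\<^bsub>box d P D\<^esub> u = u" using T.smult_one by (simp add: box_closed)
  next
    fix a b u assume a: "a \<in> carrier R" "b \<in> carrier R" and u: "u \<in> carrier (box d P D)"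
    show "(a \<oplus>\<^bsub>R\<^esub> b) \<odot>\<^bsub>box d P D\<^esub> u = a \<odot>\<^bsub>box d P D\<^esub> u \<oplus>\<^bsub>box d P D\<^esub> b \<odot>\<^bsub>box d P D\<^esub> u"
      using T.smult_l_distr[OF a box_closed[OF u]] by simp
    show "(a \<otimes>\<^bsub>R\<^esub> b) \<odot>\<^bsub>box d P D\<^esub> u = a \<odot>\<^bsub>box d P D\<^esub> (b \<odot>\<^bsub>box d P D\<^esub> u)"
      using T.smult_assoc1[OF a box_closed[OF u]] by simp
  qed (simp add: box_closed T.smult_r_distr)
qed

lemma box_eval_hom: "(\<lambda>u. u i) \<in> mod_hom R (box d P D) (T i)"
  by (rule mod_homI) (simp_all add: box_closed)

lemma box_map_hom: "box_map d P D \<in> mod_hom R (box d P D) (box d P D)"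
proof -
  interpret T: Module.module R "T i" for i by (rule T_module)
  have *: "(\<lambda>u. box_map d P D u j) \<in> mod_hom R (box d P D) (T j)" for j
  proof (cases "even j")
    case True
    have "(\<lambda>u. cdiff_tensor j (u (j + 1)) \<oplus>\<^bsub>T j\<^esub> dmap_tensor j (u j)) \<in> mod_hom R (box d P D) (T j)"
      by (intro mod_hom_add box_module T_module mod_hom_comp[OF box_eval_hom cdiff_tensor_hom] mod_hom_comp[OF box_eval_hom dmap_tensor_hom])
    with True show ?thesis by (simp add: box_map_eq)
  next
    case False
    have "(\<lambda>u. cdiff_tensor j (u (j + 1)) \<oplus>\<^bsub>T j\<^esub> (\<ominus>\<^bsub>T j\<^esub> dmap_tensor j (u j))) \<in> mod_hom R (box d P D) (T j)"
      by (intro mod_hom_add mod_hom_uminus box_module T_module mod_hom_comp[OF box_eval_hom cdiff_tensor_hom] mod_hom_comp[OF box_eval_hom dmap_tensor_hom])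
    with False show ?thesis by (simp add: box_map_eq)
  qed
  show ?thesis
  proof (rule mod_homI)
    fix u assume u: "u \<in> carrier (box d P D)"
    let ?S = "{i. u i \<noteq> \<zero>\<^bsub>T i\<^esub>}"
    have "box_map d P D u j = \<zero>\<^bsub>T j\<^esub>" if "j \<notin> ?S" "j + 1 \<notin> ?S" for j
      using that mod_hom_zero[OF T_module T_module cdiff_tensor_hom] mod_hom_zero[OF T_module T_module dmap_tensor_hom]
      by (simp add: box_map_eq)
    note zero = this
    \<comment> \<open>The differential reads positions \<open>j\<close> and \<open>j + 1\<close>, so
      the support grows at most by its translate and stays finite.\<close>
    have "{j. box_map d P D u j \<noteq> \<zero>\<^bsub>T j\<^esub>} \<subseteq> ?S \<union> (\<lambda>i. i - 1) ` ?S"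
    proof
      fix j assume "j \<in> {j. box_map d P D u j \<noteq> \<zero>\<^bsub>T j\<^esub>}"
      with zero[of j] have "j \<in> ?S \<or> j + 1 \<in> ?S" by blast
      then show "j \<in> ?S \<union> (\<lambda>i. i - 1) ` ?S" using image_eqI[of j "\<lambda>i. i - 1" "j + 1" ?S] by auto
    qed
    moreover have "finite (?S \<union> (\<lambda>i. i - 1) ` ?S)" using u by (simp add: box_carrier)
    ultimately have "finite {j. box_map d P D u j \<noteq> \<zero>\<^bsub>T j\<^esub>}" by (rule finite_subset)
    then show "box_map d P D u \<in> carrier (box d P D)" using mod_homD(1)[OF * u] by (simp add: box_carrier)
  qed (auto simp: fun_eq_iff mod_homD(2,3)[OF *, unfolded box_simps])
qed

text \<open>The two tensored differentials square to zero and commute. The mixed term occurs twice,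
  with signs \<open>(-1)^(j+1)\<close> and \<open>(-1)^j\<close>.\<close>

lemma box_map_square: "\<forall>u\<in>carrier (box d P D). box_map d P D (box_map d P D u) = \<zero>\<^bsub>box d P D\<^esub>"
proof
  interpret T: Module.module R "T i" for i by (rule T_module)
  fix u assume u: "u \<in> carrier (box d P D)"
  note cl = box_closed[OF u]
  show "box_map d P D (box_map d P D u) = \<zero>\<^bsub>box d P D\<^esub>"
  proof
    fix j
    let ?a = "cdiff_tensor j (dmap_tensor (j + 1) (u (j + 1)))"
    have a: "?a \<in> carrier (T j)" by (intro mod_homD(1)[OF cdiff_tensor_hom] mod_homD(1)[OF dmap_tensor_hom] cl)
    define b where "b = cdiff_tensor (j + 1) (u (j + 1 + 1))"
    have t1: "b \<in> carrier (T (j + 1))" unfolding b_def by (intro mod_homD(1)[OF cdiff_tensor_hom] cl)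
    have b0: "cdiff_tensor j b = \<zero>\<^bsub>T j\<^esub>" unfolding b_def by (rule cdiff_tensor_cdiff_tensor[OF cl])
    have t2: "dmap_tensor (j + 1) (u (j + 1)) \<in> carrier (T (j + 1))" by (intro mod_homD(1)[OF dmap_tensor_hom] cl)
    have t3: "cdiff_tensor j (u (j + 1)) \<in> carrier (T j)" by (intro mod_homD(1)[OF cdiff_tensor_hom] cl)
    have t4: "dmap_tensor j (u j) \<in> carrier (T j)" by (intro mod_homD(1)[OF dmap_tensor_hom] cl)
    have "cdiff_tensor j (box_map d P D u (j + 1)) = (if even j then \<ominus>\<^bsub>T j\<^esub> ?a else ?a)"
      unfolding box_map_eq[of u "j + 1"] b_def[symmetric] using a t1 t2 b0
      by (simp add: mod_homD(2)[OF cdiff_tensor_hom] mod_hom_a_inv[OF T_module T_module cdiff_tensor_hom])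
    moreover have "dmap_tensor j (box_map d P D u j) = ?a"
      unfolding box_map_eq[of u j] using a t3 t4 cl
      by (simp add: mod_homD(2)[OF dmap_tensor_hom] mod_hom_a_inv[OF T_module T_module dmap_tensor_hom] dmap_tensor_dmap_tensor cdiff_tensor_dmap_tensor)
    ultimately show "box_map d P D (box_map d P D u) j = \<zero>\<^bsub>box d P D\<^esub> j"
      unfolding box_map_eq[of "box_map d P D u" j] using a by (simp add: T.M.l_neg T.M.r_neg)
  qed
qed

end

section \<open>Comparison of the Koszul complex with a resolution\<close>

text \<open>From here on the comparison enters only through \<open>f\<close>, \<open>g\<close> and
  \<open>s\<close>. Degrees are written \<open>int n + 1\<close> and not \<open>int (Suc n)\<close>,
  to agree with the index \<open>j + 1\<close> in \<open>box_map_eq\<close>.\<close>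

locale koszul_resolution = koszul_box d D P
  for d :: nat and D :: "('k::field mpol, 'm) graded_diff_module" and P :: "('k mpol, 'p) graded_complex" +
  fixes f :: "nat \<Rightarrow> (nat set \<Rightarrow> 'k mpol) \<Rightarrow> 'p" and g :: "nat \<Rightarrow> 'p \<Rightarrow> nat set \<Rightarrow> 'k mpol"
    and s :: "nat \<Rightarrow> (nat set \<Rightarrow> 'k mpol) \<Rightarrow> nat set \<Rightarrow> 'k mpol"
  assumes f_hom: "f n \<in> mod_hom R (koszul_module d n) (cobj P (int n))"
    and f_chain: "x \<in> carrier (koszul_module d (Suc n)) \<Longrightarrow> cdiff P (int n + 1) (f (Suc n) x) = f n (koszul_diff d x)"
    and g_hom: "g n \<in> mod_hom R (cobj P (int n)) (koszul_module d n)"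
    and g_chain: "y \<in> carrier (cobj P (int n + 1)) \<Longrightarrow> koszul_diff d (g (Suc n) y) = g n (cdiff P (int n + 1) y)"
    and s_hom: "s n \<in> mod_hom R (koszul_module d n) (koszul_module d (Suc n))"
    and homotopy: "x \<in> carrier (koszul_module d n) \<Longrightarrow>
      g n (f n x) S = x S + koszul_diff d (s n x) S + (if n = 0 then 0 else s (n - 1) (koszul_diff d x) S)"
begin

abbreviation "e S \<equiv> free_gen R S"
abbreviation "I n \<equiv> subsets_of_card d n"

lemma e_closed: "S \<in> I n \<Longrightarrow> e S \<in> carrier (koszul_module d n)"
  by (rule cring.free_gen_closed[OF mpoly_cring])

lemma fe_closed: "S \<in> I n \<Longrightarrow> f n (e S) \<in> carrier (cobj P (int n))"
  by (rule mod_homD(1)[OF f_hom e_closed])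

lemma koszul_diff_closed:
  "x \<in> carrier (koszul_module d (Suc n)) \<Longrightarrow> koszul_diff d x \<in> carrier (koszul_module d n)"
  by (rule mod_homD(1)[OF koszul_diff_hom])

lemma koszul_diff_e_closed: "S \<in> I n \<Longrightarrow> koszul_diff d (e S) U \<in> carrier R"
proof (cases n)
  case 0
  assume "S \<in> I n"
  then show ?thesis using 0 by (auto simp: koszul_diff_def free_gen_def intro!: mpoly_carrier_sum cong: if_cong)
next
  case (Suc k)
  assume "S \<in> I n"
  then show ?thesis unfolding Suc by (intro koszul_carrierD[OF koszul_diff_closed] e_closed)
qed

lemma s_closed: "U \<in> I n \<Longrightarrow> s n (e U) S \<in> carrier R"
  by (rule koszul_carrierD[OF mod_homD(1)[OF s_hom e_closed]])

lemma I_subset: "S \<in> I n \<Longrightarrow> S \<subseteq> {..<d}" "S \<in> I n \<Longrightarrow> card S = n"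
  by (simp_all add: subsets_of_card_def)

lemma sign_Suc: "x \<in> carrier D \<Longrightarrow> (- 1) ^ Suc n \<odot>\<^bsub>D\<^esub> x = \<ominus>\<^bsub>D\<^esub> ((- 1) ^ n \<odot>\<^bsub>D\<^esub> x)"
  unfolding sign_smult by (simp add: sign_smult)

section \<open>The map from the Koszul side to the box product\<close>

text \<open>The map \<open>f\<close> tensored with the identity of \<open>D\<close>, where the
  family \<open>u\<close> stands for the sum of all \<open>e_S \<otimes> u S\<close>.\<close>

definition to_box :: "(nat set \<Rightarrow> 'm) \<Rightarrow> int \<Rightarrow> ('p \<times> 'm \<Rightarrow> 'k mpol) set" where
  "to_box u i = (if i < 0 then \<zero>\<^bsub>T i\<^esub> else \<Oplus>\<^bsub>T i\<^esub>S\<in>I (nat i). pure i (f (nat i) (e S)) (u S))"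

lemma to_box_nat: "to_box u (int n) = (\<Oplus>\<^bsub>T (int n)\<^esub>S\<in>I n. pure (int n) (f n (e S)) (u S))"
  by (simp add: to_box_def)

lemma to_box_Suc: "to_box u (int n + 1) = (\<Oplus>\<^bsub>T (int n + 1)\<^esub>S\<in>I (Suc n). pure (int n + 1) (f (Suc n) (e S)) (u S))"
proof -
  have eq: "int n + 1 = int (Suc n)" by simp
  show ?thesis unfolding eq by (rule to_box_nat)
qed

lemma fe_closed_Suc: "S \<in> I (Suc n) \<Longrightarrow> f (Suc n) (e S) \<in> carrier (cobj P (int n + 1))"
proof -
  have eq: "int n + 1 = int (Suc n)" by simp
  show "S \<in> I (Suc n) \<Longrightarrow> ?thesis" unfolding eq by (rule fe_closed)
qed

lemma to_box_hom: "to_box \<in> mod_hom R KD (box d P D)"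
proof -
  have *: "(\<lambda>u. to_box u i) \<in> mod_hom R KD (T i)" for i
  proof (cases "i < 0")
    case True
    then show ?thesis using mod_hom_zero_map[OF KD_module T_module] by (simp add: to_box_def)
  next
    case False
    then obtain n where i: "i = int n" by (auto simp: not_less elim: nonneg_int_cases)
    show ?thesis unfolding i to_box_nat
      by (rule mod_hom_finsum_maps[OF KD_module T_module])
        (rule mod_hom_comp[OF fun_module_eval_hom[OF D_module] pure_hom2[OF fe_closed]], simp_all)
  qed
  have "to_box u i = \<zero>\<^bsub>T i\<^esub>" if "i \<notin> {0..int d}" for u i
  proof (cases "i < 0")
    case False
    \<comment> \<open>There are no sets of more than \<open>d\<close> variables, so the sum is empty
      above \<open>d\<close> and the support finite.\<close>
    have "S \<notin> I (nat i)" for S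
    proof
      assume S: "S \<in> I (nat i)"
      have "card S \<le> d" using card_mono[OF _ I_subset(1)[OF S]] by simp
      then show False using that False I_subset(2)[OF S] by simp
    qed
    then have "I (nat i) = {}" by blast
    then show ?thesis
      using abelian_monoid.finsum_empty[OF abelian_group.axioms(1)[OF Module.module.axioms(2)[OF T_module]]] False
      by (simp add: to_box_def)
  qed (simp add: to_box_def)
  then have "{i. to_box u i \<noteq> \<zero>\<^bsub>T i\<^esub>} \<subseteq> {0..int d}" for u by blast
  then have "finite {i. to_box u i \<noteq> \<zero>\<^bsub>T i\<^esub>}" for u by (rule finite_subset) simp
  then have fin: "finite {i. to_box u i \<noteq> \<zero>\<^bsub>T i\<^esub>}" for u .
  show ?thesis
  proof (rule mod_homI)
    show "to_box u \<in> carrier (box d P D)" if "u \<in> carrier KD" for u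
      using fin mod_homD(1)[OF * that] by (simp add: box_carrier)
    show "to_box (u \<oplus>\<^bsub>KD\<^esub> v) = to_box u \<oplus>\<^bsub>box d P D\<^esub> to_box v" if "u \<in> carrier KD" "v \<in> carrier KD" for u v
      unfolding box_simps by (rule ext) (rule mod_homD(2)[OF * that])
    show "to_box (r \<odot>\<^bsub>KD\<^esub> u) = r \<odot>\<^bsub>box d P D\<^esub> to_box u" if "r \<in> carrier R" "u \<in> carrier KD" for r u
      unfolding box_simps by (rule ext) (rule mod_homD(3)[OF * that])
  qed
qed

text \<open>Expand \<open>f\<close> of the differential of \<open>e_S\<close> over the basis. Its
  coefficients move through the tensor sign to \<open>u\<close>, and exchanging the two sums
  collects them into the Koszul part of \<open>kdiff u\<close>; the signs before
  \<open>dmap D\<close> agree because \<open>card U\<close> is the homological degree.\<close>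

lemma to_box_chain:
  assumes u: "u \<in> carrier KD"
  shows "box_map d P D (to_box u) = to_box (kdiff u)"
proof
  fix j
  interpret T: Module.module R "T i" for i by (rule T_module)
  note cl = KD_closed[OF u]
  have bu: "to_box u \<in> carrier (box d P D)" by (rule mod_homD(1)[OF to_box_hom u])
  show "box_map d P D (to_box u) j = to_box (kdiff u) j"
  proof (cases "j < 0")
    case True
    have "box_map d P D (to_box u) j \<in> carrier (T j)" by (rule box_closed[OF mod_homD(1)[OF box_map_hom bu]])
    then show ?thesis using T_neg[OF True] True by (simp add: to_box_def)
  next
    case False
    then obtain n where j: "j = int n" by (auto simp: not_less elim: nonneg_int_cases)
    let ?M = "T (int n)" and ?p = "\<lambda>S. pure (int n) (f n (e S))"
    note p2 = pure_hom2[OF fe_closed] and p2c = mod_homD(1)[OF pure_hom2[OF fe_closed]]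
    let ?c = "\<lambda>S U. koszul_diff d (e S) U"
    \<comment> \<open>The matrix entries of the Koszul differential pass from the first tensor
      factor to the second.\<close>
    have 1: "cdiff_tensor (int n) (pure (int n + 1) (f (Suc n) (e S)) (u S)) = (\<Oplus>\<^bsub>?M\<^esub>U\<in>I n. ?p U (?c S U \<odot>\<^bsub>D\<^esub> u S))"
      if S: "S \<in> I (Suc n)" for S
    proof -
      have dS: "koszul_diff d (e S) \<in> carrier (koszul_module d n)" by (rule koszul_diff_closed[OF e_closed[OF S]])
      have "cdiff_tensor (int n) (pure (int n + 1) (f (Suc n) (e S)) (u S)) = pure (int n) (cdiff P (int n + 1) (f (Suc n) (e S))) (u S)"
        by (rule cdiff_tensor_pure[OF fe_closed_Suc[OF S] cl])
      also have "cdiff P (int n + 1) (f (Suc n) (e S)) = f n (koszul_diff d (e S))" by (rule f_chain[OF e_closed[OF S]])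
      also have "pure (int n) (f n (koszul_diff d (e S))) (u S) = (\<Oplus>\<^bsub>?M\<^esub>U\<in>I n. ?c S U \<odot>\<^bsub>?M\<^esub> ?p U (u S))"
        by (rule koszul_hom_expand[OF T_module mod_hom_comp[OF f_hom pure_hom1[OF cl]] dS])
      also have "\<dots> = (\<Oplus>\<^bsub>?M\<^esub>U\<in>I n. ?p U (?c S U \<odot>\<^bsub>D\<^esub> u S))"
      proof (rule T.M.finsum_cong'[OF refl])
        have c: "?c S U \<in> carrier R" for U by (rule koszul_diff_e_closed[OF S])
        show "(\<lambda>U. ?p U (?c S U \<odot>\<^bsub>D\<^esub> u S)) \<in> I n \<rightarrow> carrier ?M" using p2c c cl by auto
        show "?c S U \<odot>\<^bsub>?M\<^esub> ?p U (u S) = ?p U (?c S U \<odot>\<^bsub>D\<^esub> u S)" if "U \<in> I n" for U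
          by (rule mod_homD(3)[OF p2[OF that] c cl, symmetric])
      qed
      finally show ?thesis .
    qed
    have c: "?c S U \<in> carrier R" if "S \<in> I (Suc n)" for S U by (rule koszul_diff_e_closed[OF that])
    have "cdiff_tensor (int n) (to_box u (int n + 1)) = (\<Oplus>\<^bsub>?M\<^esub>S\<in>I (Suc n). cdiff_tensor (int n) (pure (int n + 1) (f (Suc n) (e S)) (u S)))"
      unfolding to_box_Suc
      by (rule mod_hom_finsum[OF T_module T_module cdiff_tensor_hom]) (auto intro!: pure_closed fe_closed_Suc cl)
    also have "\<dots> = (\<Oplus>\<^bsub>?M\<^esub>S\<in>I (Suc n). \<Oplus>\<^bsub>?M\<^esub>U\<in>I n. ?p U (?c S U \<odot>\<^bsub>D\<^esub> u S))"
      by (rule T.M.finsum_cong'[OF refl _ 1]) (auto intro!: T.M.finsum_closed p2c c cl smult_closed)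
    also have "\<dots> = (\<Oplus>\<^bsub>?M\<^esub>U\<in>I n. \<Oplus>\<^bsub>?M\<^esub>S\<in>I (Suc n). ?p U (?c S U \<odot>\<^bsub>D\<^esub> u S))"
      by (rule T.M.finsum_swap) (auto intro!: p2c c cl smult_closed)
    also have "\<dots> = (\<Oplus>\<^bsub>?M\<^esub>U\<in>I n. ?p U (\<Oplus>\<^bsub>D\<^esub>S\<in>I (Suc n). ?c S U \<odot>\<^bsub>D\<^esub> u S))"
    proof (rule T.M.finsum_cong'[OF refl])
      show "(\<lambda>U. ?p U (\<Oplus>\<^bsub>D\<^esub>S\<in>I (Suc n). ?c S U \<odot>\<^bsub>D\<^esub> u S)) \<in> I n \<rightarrow> carrier ?M"
        by (auto intro!: p2c M.finsum_closed c cl smult_closed)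
      show "(\<Oplus>\<^bsub>?M\<^esub>S\<in>I (Suc n). ?p U (?c S U \<odot>\<^bsub>D\<^esub> u S)) = ?p U (\<Oplus>\<^bsub>D\<^esub>S\<in>I (Suc n). ?c S U \<odot>\<^bsub>D\<^esub> u S)" if "U \<in> I n" for U
        by (rule mod_hom_finsum[OF D_module T_module p2[OF that], symmetric]) (auto intro!: c cl smult_closed)
    qed
    finally have A: "cdiff_tensor (int n) (to_box u (int n + 1)) = (\<Oplus>\<^bsub>?M\<^esub>U\<in>I n. ?p U (\<Oplus>\<^bsub>D\<^esub>S\<in>I (Suc n). ?c S U \<odot>\<^bsub>D\<^esub> u S))" .
    have "dmap_tensor (int n) (to_box u (int n)) = (\<Oplus>\<^bsub>?M\<^esub>U\<in>I n. dmap_tensor (int n) (?p U (u U)))"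
      unfolding to_box_nat
      by (rule mod_hom_finsum[OF T_module T_module dmap_tensor_hom]) (auto intro!: pure_closed fe_closed cl)
    also have "\<dots> = (\<Oplus>\<^bsub>?M\<^esub>U\<in>I n. ?p U (dmap D (u U)))"
      by (rule T.M.finsum_cong'[OF refl]) (auto intro!: pure_closed fe_closed cl dmap_tensor_pure dmap_closed)
    finally have dmap_tensor: "dmap_tensor (int n) (to_box u (int n)) = (\<Oplus>\<^bsub>?M\<^esub>U\<in>I n. ?p U (dmap D (u U)))" .
    have dmap_tensor_closed: "dmap_tensor (int n) (to_box u (int n)) \<in> carrier ?M" by (rule mod_homD(1)[OF dmap_tensor_hom box_closed[OF bu]])
    have "(if even (int n) then dmap_tensor (int n) (to_box u (int n)) else \<ominus>\<^bsub>?M\<^esub> dmap_tensor (int n) (to_box u (int n))) =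
        (- 1) ^ n \<odot>\<^bsub>?M\<^esub> dmap_tensor (int n) (to_box u (int n))"
      using T.smult_l_minus[of 1 "dmap_tensor (int n) (to_box u (int n))" "int n"] T.smult_one[OF dmap_tensor_closed] dmap_tensor_closed by (auto simp: mpoly_a_inv)
    also have "\<dots> = (\<Oplus>\<^bsub>?M\<^esub>U\<in>I n. (- 1) ^ n \<odot>\<^bsub>?M\<^esub> ?p U (dmap D (u U)))"
      unfolding dmap_tensor by (rule T.finsum_smult_ldistr) (auto intro!: pure_closed fe_closed cl dmap_closed)
    also have "\<dots> = (\<Oplus>\<^bsub>?M\<^esub>U\<in>I n. ?p U ((- 1) ^ n \<odot>\<^bsub>D\<^esub> dmap D (u U)))"
    proof (rule T.M.finsum_cong'[OF refl])
      show "(\<lambda>U. ?p U ((- 1) ^ n \<odot>\<^bsub>D\<^esub> dmap D (u U))) \<in> I n \<rightarrow> carrier ?M"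
        by (auto intro!: p2c cl smult_closed dmap_closed)
      show "(- 1) ^ n \<odot>\<^bsub>?M\<^esub> ?p U (dmap D (u U)) = ?p U ((- 1) ^ n \<odot>\<^bsub>D\<^esub> dmap D (u U))" if "U \<in> I n" for U
        by (rule mod_homD(3)[OF p2[OF that] sign_closed dmap_closed[OF cl], symmetric])
    qed
    finally have B: "(if even (int n) then dmap_tensor (int n) (to_box u (int n)) else \<ominus>\<^bsub>?M\<^esub> dmap_tensor (int n) (to_box u (int n))) =
        (\<Oplus>\<^bsub>?M\<^esub>U\<in>I n. ?p U ((- 1) ^ n \<odot>\<^bsub>D\<^esub> dmap D (u U)))" .
    have "box_map d P D (to_box u) (int n) = (\<Oplus>\<^bsub>?M\<^esub>U\<in>I n. ?p U (\<Oplus>\<^bsub>D\<^esub>S\<in>I (Suc n). ?c S U \<odot>\<^bsub>D\<^esub> u S)) \<oplus>\<^bsub>?M\<^esub>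
        (\<Oplus>\<^bsub>?M\<^esub>U\<in>I n. ?p U ((- 1) ^ n \<odot>\<^bsub>D\<^esub> dmap D (u U)))"
      unfolding box_map_eq A B ..
    also have "\<dots> = (\<Oplus>\<^bsub>?M\<^esub>U\<in>I n. ?p U (\<Oplus>\<^bsub>D\<^esub>S\<in>I (Suc n). ?c S U \<odot>\<^bsub>D\<^esub> u S) \<oplus>\<^bsub>?M\<^esub> ?p U ((- 1) ^ n \<odot>\<^bsub>D\<^esub> dmap D (u U)))"
      by (rule T.M.finsum_addf[symmetric]) (auto intro!: p2c M.finsum_closed c cl smult_closed dmap_closed)
    also have "\<dots> = (\<Oplus>\<^bsub>?M\<^esub>U\<in>I n. ?p U (kdiff u U))"
    proof (rule T.M.finsum_cong'[OF refl])
      show "(\<lambda>U. ?p U (kdiff u U)) \<in> I n \<rightarrow> carrier ?M" by (auto intro!: p2c kdiff_closed u)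
      fix U assume U: "U \<in> I n"
      have "kdiff u U = (\<Oplus>\<^bsub>D\<^esub>S\<in>I (Suc n). ?c S U \<odot>\<^bsub>D\<^esub> u S) \<oplus>\<^bsub>D\<^esub> (- 1) ^ n \<odot>\<^bsub>D\<^esub> dmap D (u U)"
        using I_subset[OF U] koszul_diff_matrix[where v = u, OF D_module cl U] by (simp add: kdiff_def)
      then show "?p U (\<Oplus>\<^bsub>D\<^esub>S\<in>I (Suc n). ?c S U \<odot>\<^bsub>D\<^esub> u S) \<oplus>\<^bsub>?M\<^esub> ?p U ((- 1) ^ n \<odot>\<^bsub>D\<^esub> dmap D (u U)) = ?p U (kdiff u U)"
        by (simp only:) (rule mod_homD(2)[OF p2[OF U], symmetric], auto intro!: M.finsum_closed c cl smult_closed dmap_closed)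
    qed
    also have "\<dots> = to_box (kdiff u) (int n)" by (simp add: to_box_nat)
    finally show ?thesis unfolding j .
  qed
qed

section \<open>The map back to the Koszul side\<close>

text \<open>The entry at \<open>S\<close> of \<open>g\<close> tensored with the identity. A choice
  is needed because the universal property is available only as an existence statement; the values
  on pure tensors determine it on the carrier.\<close>

definition coord :: "nat set \<Rightarrow> ('p \<times> 'm \<Rightarrow> 'k mpol) set \<Rightarrow> 'm" where
  "coord S = (SOME h. h \<in> mod_hom R (T (int (card S))) D \<and>
     (\<forall>x\<in>carrier (cobj P (int (card S))). \<forall>y\<in>carrier D. h (pure (int (card S)) x y) = g (card S) x S \<odot>\<^bsub>D\<^esub> y))"

lemma coord_props:
  assumes S: "S \<in> I n"
  shows coord_hom: "coord S \<in> mod_hom R (T (int n)) D"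
    and coord_pure: "\<lbrakk>x \<in> carrier (cobj P (int n)); y \<in> carrier D\<rbrakk> \<Longrightarrow> coord S (pure (int n) x y) = g n x S \<odot>\<^bsub>D\<^esub> y"
proof -
  have gS: "g n x S \<in> carrier R" if "x \<in> carrier (cobj P (int n))" for x
    by (rule koszul_carrierD[OF mod_homD(1)[OF g_hom that]])
  have bil: "bilinear_map R (cobj P (int n)) D D (\<lambda>x y. g n x S \<odot>\<^bsub>D\<^esub> y)"
    unfolding bilinear_map_def
  proof (intro conjI ballI)
    show "(\<lambda>y. g n x S \<odot>\<^bsub>D\<^esub> y) \<in> mod_hom R D D" if "x \<in> carrier (cobj P (int n))" for x
      by (rule mod_hom_scale[OF D_module gS[OF that]])
    show "(\<lambda>x. g n x S \<odot>\<^bsub>D\<^esub> y) \<in> mod_hom R (cobj P (int n)) D" if "y \<in> carrier D" for y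
      by (rule mod_hom_comp[OF mod_hom_comp[OF g_hom koszul_eval_hom] scalar_mod_hom[OF D_module that]])
  qed
  obtain h where h1: "h \<in> mod_hom R (T (int n)) D"
    and h2: "\<And>x y. \<lbrakk>x \<in> carrier (cobj P (int n)); y \<in> carrier D\<rbrakk> \<Longrightarrow> h (pure (int n) x y) = g n x S \<odot>\<^bsub>D\<^esub> y"
  proof (rule tensor_lift[OF P_module D_module D_module bil])
    fix h assume h: "h \<in> mod_hom R (T (int n)) D"
      "\<And>x y. \<lbrakk>x \<in> carrier (cobj P (int n)); y \<in> carrier D\<rbrakk> \<Longrightarrow> h (pure (int n) x y) = g n x S \<odot>\<^bsub>D\<^esub> y"
    show thesis by (rule that[OF h])
  qed
  have h: "h \<in> mod_hom R (T (int n)) D \<and> (\<forall>x\<in>carrier (cobj P (int n)). \<forall>y\<in>carrier D. h (pure (int n) x y) = g n x S \<odot>\<^bsub>D\<^esub> y)"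
    using h1 h2 by simp
  have "coord S \<in> mod_hom R (T (int n)) D \<and>
    (\<forall>x\<in>carrier (cobj P (int n)). \<forall>y\<in>carrier D. coord S (pure (int n) x y) = g n x S \<odot>\<^bsub>D\<^esub> y)"
    unfolding coord_def I_subset(2)[OF S] by (rule someI[of _ h]) (rule h)
  then show "coord S \<in> mod_hom R (T (int n)) D"
    "\<lbrakk>x \<in> carrier (cobj P (int n)); y \<in> carrier D\<rbrakk> \<Longrightarrow> coord S (pure (int n) x y) = g n x S \<odot>\<^bsub>D\<^esub> y"
    by blast+
qed

definition from_box :: "(int \<Rightarrow> ('p \<times> 'm \<Rightarrow> 'k mpol) set) \<Rightarrow> nat set \<Rightarrow> 'm" where
  "from_box v S = (if S \<subseteq> {..<d} then coord S (v (int (card S))) else \<zero>\<^bsub>D\<^esub>)"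

lemma from_box_I: "S \<in> I n \<Longrightarrow> from_box v S = coord S (v (int n))"
  by (simp add: from_box_def I_subset)

lemma in_I: "S \<subseteq> {..<d} \<Longrightarrow> S \<in> I (card S)"
  by (simp add: subsets_of_card_def)

lemma from_box_closed: "v \<in> carrier (box d P D) \<Longrightarrow> from_box v \<in> carrier KD"
  using mod_homD(1)[OF coord_hom[OF in_I]] box_closed by (auto simp: fun_module_carrier from_box_def)

text \<open>Both sides are linear, so pure tensors suffice, and there it is the chain map property
  of \<open>g\<close> read at the entry \<open>S\<close>.\<close>

lemma coord_cdiff_tensor:
  assumes S: "S \<in> I n" and t: "t \<in> carrier (T (int n + 1))"
  shows "coord S (cdiff_tensor (int n) t) = (\<Oplus>\<^bsub>D\<^esub>i\<in>{..<d} - S. koszul_coeff i S \<odot>\<^bsub>D\<^esub> coord (insert i S) t)"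
proof -
  have eq: "int n + 1 = int (Suc n)" by simp
  have iS: "insert i S \<in> I (Suc n)" if "i \<in> {..<d} - S" for i
    using insert_subsets_of_card[OF I_subset(1)[OF S] that] I_subset(2)[OF S] by simp
  note ch = coord_hom[OF iS, folded eq] and cp = coord_pure[OF iS, folded eq]
  show ?thesis
  proof (rule T_eqI[OF D_module mod_hom_comp[OF cdiff_tensor_hom coord_hom[OF S]] _ _ t])
    show "(\<lambda>t. \<Oplus>\<^bsub>D\<^esub>i\<in>{..<d} - S. koszul_coeff i S \<odot>\<^bsub>D\<^esub> coord (insert i S) t) \<in> mod_hom R (T (int n + 1)) D"
      by (intro mod_hom_finsum_maps T_module D_module mod_hom_comp[OF ch mod_hom_scale[OF D_module]]) auto
    fix x y assume x: "x \<in> carrier (cobj P (int n + 1))" and y: "y \<in> carrier D"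
    have gx: "g (Suc n) x U \<in> carrier R" for U
      using koszul_carrierD[OF mod_homD(1)[OF g_hom]] x unfolding eq by blast
    have "coord S (cdiff_tensor (int n) (pure (int n + 1) x y)) = g n (cdiff P (int n + 1) x) S \<odot>\<^bsub>D\<^esub> y"
      unfolding cdiff_tensor_pure[OF x y] by (rule coord_pure[OF S mod_homD(1)[OF cdiff_mod_hom x] y])
    also have "g n (cdiff P (int n + 1) x) S = (\<Sum>i\<in>{..<d} - S. koszul_coeff i S * g (Suc n) x (insert i S))"
      using g_chain[OF x] I_subset(1)[OF S] by (simp add: koszul_diff_def fun_eq_iff flip: g_chain[OF x])
    also have "\<dots> \<odot>\<^bsub>D\<^esub> y = (\<Oplus>\<^bsub>D\<^esub>i\<in>{..<d} - S. (koszul_coeff i S * g (Suc n) x (insert i S)) \<odot>\<^bsub>D\<^esub> y)"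
      by (rule sum_smult_module[OF D_module y]) (use gx in auto)
    also have "\<dots> = (\<Oplus>\<^bsub>D\<^esub>i\<in>{..<d} - S. koszul_coeff i S \<odot>\<^bsub>D\<^esub> coord (insert i S) (pure (int n + 1) x y))"
      by (rule M.finsum_cong'[OF refl]) (use gx y cp[OF _ x y] in \<open>auto simp: smult_smult\<close>)
    finally show "coord S (cdiff_tensor (int n) (pure (int n + 1) x y)) =
      (\<Oplus>\<^bsub>D\<^esub>i\<in>{..<d} - S. koszul_coeff i S \<odot>\<^bsub>D\<^esub> coord (insert i S) (pure (int n + 1) x y))" .
  qed
qed

lemma coord_dmap_tensor:
  assumes S: "S \<in> I n" and t: "t \<in> carrier (T (int n))"
  shows "coord S (dmap_tensor (int n) t) = dmap D (coord S t)"
proof (rule T_eqI[OF D_module mod_hom_comp[OF dmap_tensor_hom coord_hom[OF S]] mod_hom_comp[OF coord_hom[OF S] dmap_mod_hom] _ t])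
  fix x y assume x: "x \<in> carrier (cobj P (int n))" and y: "y \<in> carrier D"
  have gx: "g n x S \<in> carrier R" by (rule koszul_carrierD[OF mod_homD(1)[OF g_hom x]])
  show "coord S (dmap_tensor (int n) (pure (int n) x y)) = dmap D (coord S (pure (int n) x y))"
    unfolding dmap_tensor_pure[OF x y] coord_pure[OF S x y] coord_pure[OF S x dmap_closed[OF y]]
    by (rule mod_homD(3)[OF dmap_mod_hom gx y, symmetric])
qed

lemma from_box_chain:
  assumes v: "v \<in> carrier (box d P D)"
  shows "kdiff (from_box v) = from_box (box_map d P D v)"
proof
  fix S
  show "kdiff (from_box v) S = from_box (box_map d P D v) S"
  proof (cases "S \<subseteq> {..<d}")
    case True
    define n where "n = card S"
    have S: "S \<in> I n" using True by (simp add: n_def in_I)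
    note cl = box_closed[OF v]
    have eq: "int n + 1 = int (Suc n)" by simp
    have tp: "cdiff_tensor (int n) (v (int n + 1)) \<in> carrier (T (int n))" by (rule mod_homD(1)[OF cdiff_tensor_hom cl])
    have tq: "dmap_tensor (int n) (v (int n)) \<in> carrier (T (int n))" by (rule mod_homD(1)[OF dmap_tensor_hom cl])
    have cv: "coord S (v (int n)) \<in> carrier D" by (rule mod_homD(1)[OF coord_hom[OF S] cl])
    interpret T: Module.module R "T i" for i by (rule T_module)
    have "from_box (box_map d P D v) S = coord S (cdiff_tensor (int n) (v (int n + 1))) \<oplus>\<^bsub>D\<^esub>
        coord S (if even (int n) then dmap_tensor (int n) (v (int n)) else \<ominus>\<^bsub>T (int n)\<^esub> dmap_tensor (int n) (v (int n)))"
      unfolding from_box_I[OF S] box_map_eq by (rule mod_homD(2)[OF coord_hom[OF S] tp]) (use tq in auto)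
    also have "coord S (if even (int n) then dmap_tensor (int n) (v (int n)) else \<ominus>\<^bsub>T (int n)\<^esub> dmap_tensor (int n) (v (int n))) =
        (- 1) ^ n \<odot>\<^bsub>D\<^esub> dmap D (coord S (v (int n)))"
      using mod_hom_a_inv[OF T_module D_module coord_hom[OF S] tq] coord_dmap_tensor[OF S cl] cv by (simp add: sign_smult)
    also have "coord S (cdiff_tensor (int n) (v (int n + 1))) = (\<Oplus>\<^bsub>D\<^esub>i\<in>{..<d} - S. koszul_coeff i S \<odot>\<^bsub>D\<^esub> from_box v (insert i S))"
      unfolding coord_cdiff_tensor[OF S cl]
    proof (rule M.finsum_cong'[OF refl])
      have "from_box v U \<in> carrier D" for U using KD_closed[OF from_box_closed[OF v]] .
      then show "(\<lambda>i. koszul_coeff i S \<odot>\<^bsub>D\<^esub> from_box v (insert i S)) \<in> {..<d} - S \<rightarrow> carrier D" by auto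
      fix i assume "i \<in> {..<d} - S"
      then have "insert i S \<in> I (Suc n)"
        using insert_subsets_of_card[OF True] by (simp add: n_def)
      then show "koszul_coeff i S \<odot>\<^bsub>D\<^esub> coord (insert i S) (v (int n + 1)) = koszul_coeff i S \<odot>\<^bsub>D\<^esub> from_box v (insert i S)"
        unfolding eq by (simp only: from_box_I)
    qed
    finally show ?thesis using True by (simp add: kdiff_def from_box_I[OF S] n_def[symmetric])
  qed (simp add: kdiff_def from_box_def)
qed

section \<open>The homotopy with coefficients, and injectivity on homology\<close>

text \<open>The homotopy \<open>s\<close> tensored with the identity. It raises the homological
  degree, so the entry at \<open>S\<close> comes from sets with one element less and the entry at
  \<open>{}\<close> is zero.\<close>

definition homotopy_map :: "(nat set \<Rightarrow> 'm) \<Rightarrow> nat set \<Rightarrow> 'm" where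
  "homotopy_map u S = (if S \<subseteq> {..<d} \<and> S \<noteq> {}
     then \<Oplus>\<^bsub>D\<^esub>U\<in>I (card S - 1). s (card S - 1) (e U) S \<odot>\<^bsub>D\<^esub> u U else \<zero>\<^bsub>D\<^esub>)"

lemma homotopy_map_Suc:
  "S \<in> I (Suc n) \<Longrightarrow> homotopy_map u S = (\<Oplus>\<^bsub>D\<^esub>U\<in>I n. s n (e U) S \<odot>\<^bsub>D\<^esub> u U)"
  using I_subset[of S "Suc n"] by (auto simp: homotopy_map_def)

lemma homotopy_map_closed: "u \<in> carrier KD \<Longrightarrow> homotopy_map u \<in> carrier KD"
  using s_closed KD_closed by (auto simp: fun_module_carrier homotopy_map_def intro!: M.finsum_closed smult_closed)

text \<open>For a cycle the Koszul part of \<open>kdiff u\<close> is the negative of its part with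
  \<open>dmap D\<close>, so the term in which \<open>s\<close> follows the Koszul differential
  becomes one with \<open>dmap D\<close>. Its sign is the one that \<open>kdiff\<close> uses at
  \<open>S\<close>, so it completes the Koszul part of
  \<open>kdiff (homotopy_map u)\<close>.\<close>

lemma homotopy_sum:
  assumes u: "u \<in> carrier KD" "kdiff u = (\<lambda>_. \<zero>\<^bsub>D\<^esub>)" and S: "S \<in> I n"
  shows "(\<Oplus>\<^bsub>D\<^esub>U\<in>I n. (if n = 0 then 0 else s (n - 1) (koszul_diff d (e U)) S) \<odot>\<^bsub>D\<^esub> u U) =
    (- 1) ^ n \<odot>\<^bsub>D\<^esub> dmap D (homotopy_map u S)"
proof (cases n)
  case 0
  then have "S = {}" using S by simp
  then show ?thesis using 0 smult_l_null[OF KD_closed[OF u(1)]] smult_r_null[of 1]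
    by (simp add: homotopy_map_def dmap_zero)
next
  case (Suc k)
  note cl = KD_closed[OF u(1)]
  let ?c = "\<lambda>U V. koszul_diff d (e U) V" and ?s = "\<lambda>V. s k (e V) S"
  have c: "?c U V \<in> carrier R" if "U \<in> I n" for U V by (rule koszul_diff_e_closed[OF that])
  have sc: "?s V \<in> carrier R" if "V \<in> I k" for V by (rule s_closed[OF that])
  have r: "s k (koszul_diff d (e U)) S = (\<Sum>V\<in>I k. ?c U V * ?s V)" if U: "U \<in> I n" for U
  proof -
    have kU: "koszul_diff d (e U) \<in> carrier (koszul_module d k)"
      using koszul_diff_closed[OF e_closed[OF U[unfolded Suc]]] .
    have "s k (koszul_diff d (e U)) S = (\<Oplus>\<^bsub>poly_module d\<^esub>V\<in>I k. ?c U V \<odot>\<^bsub>poly_module d\<^esub> ?s V)"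
      by (rule koszul_hom_expand[OF poly_module_is_module mod_hom_comp[OF s_hom koszul_eval_hom] kU])
    also have "\<dots> = (\<Sum>V\<in>I k. ?c U V * ?s V)"
      using poly_module_finsum[of "\<lambda>V. ?c U V * ?s V" "I k" d] c[OF U] sc by auto
    finally show ?thesis .
  qed
  have "(\<Oplus>\<^bsub>D\<^esub>U\<in>I n. (if n = 0 then 0 else s (n - 1) (koszul_diff d (e U)) S) \<odot>\<^bsub>D\<^esub> u U) =
      (\<Oplus>\<^bsub>D\<^esub>U\<in>I n. \<Oplus>\<^bsub>D\<^esub>V\<in>I k. ?s V \<odot>\<^bsub>D\<^esub> (?c U V \<odot>\<^bsub>D\<^esub> u U))"
  proof (rule M.finsum_cong'[OF refl])
    show "(\<lambda>U. \<Oplus>\<^bsub>D\<^esub>V\<in>I k. ?s V \<odot>\<^bsub>D\<^esub> (?c U V \<odot>\<^bsub>D\<^esub> u U)) \<in> I n \<rightarrow> carrier D"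
      by (auto intro!: M.finsum_closed smult_closed c sc cl)
    fix U assume U: "U \<in> I n"
    have "(\<Sum>V\<in>I k. ?c U V * ?s V) \<odot>\<^bsub>D\<^esub> u U = (\<Oplus>\<^bsub>D\<^esub>V\<in>I k. (?c U V * ?s V) \<odot>\<^bsub>D\<^esub> u U)"
      by (rule sum_smult_module[OF D_module cl]) (use c[OF U] sc in auto)
    also have "\<dots> = (\<Oplus>\<^bsub>D\<^esub>V\<in>I k. ?s V \<odot>\<^bsub>D\<^esub> (?c U V \<odot>\<^bsub>D\<^esub> u U))"
      by (rule M.finsum_cong'[OF refl]) (use c[OF U] sc cl in \<open>auto simp: smult_smult mult.commute\<close>)
    finally show "(if n = 0 then 0 else s (n - 1) (koszul_diff d (e U)) S) \<odot>\<^bsub>D\<^esub> u U =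
        (\<Oplus>\<^bsub>D\<^esub>V\<in>I k. ?s V \<odot>\<^bsub>D\<^esub> (?c U V \<odot>\<^bsub>D\<^esub> u U))"
      using r[OF U] Suc by simp
  qed
  also have "\<dots> = (\<Oplus>\<^bsub>D\<^esub>V\<in>I k. \<Oplus>\<^bsub>D\<^esub>U\<in>I n. ?s V \<odot>\<^bsub>D\<^esub> (?c U V \<odot>\<^bsub>D\<^esub> u U))"
    by (rule M.finsum_swap) (auto intro!: smult_closed c sc cl)
  also have "\<dots> = (\<Oplus>\<^bsub>D\<^esub>V\<in>I k. (- 1) ^ n \<odot>\<^bsub>D\<^esub> dmap D (?s V \<odot>\<^bsub>D\<^esub> u V))"
  proof (rule M.finsum_cong'[OF refl])
    show "(\<lambda>V. (- 1) ^ n \<odot>\<^bsub>D\<^esub> dmap D (?s V \<odot>\<^bsub>D\<^esub> u V)) \<in> I k \<rightarrow> carrier D"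
      by (auto intro!: smult_closed dmap_closed sc cl)
    fix V assume V: "V \<in> I k"
    have dV: "dmap D (u V) \<in> carrier D" by (rule dmap_closed[OF cl])
    have sum: "(\<Oplus>\<^bsub>D\<^esub>U\<in>I n. ?c U V \<odot>\<^bsub>D\<^esub> u U) \<in> carrier D" by (auto intro!: M.finsum_closed smult_closed c cl)
    have "(\<Oplus>\<^bsub>D\<^esub>U\<in>I n. ?c U V \<odot>\<^bsub>D\<^esub> u U) \<oplus>\<^bsub>D\<^esub> (- 1) ^ k \<odot>\<^bsub>D\<^esub> dmap D (u V) = kdiff u V"
      using I_subset[OF V] koszul_diff_matrix[where v = u, OF D_module cl V] Suc by (simp add: kdiff_def)
    also have "\<dots> = \<zero>\<^bsub>D\<^esub>" using u(2) by simp
    \<comment> \<open>The cycle condition at \<open>V\<close>; the minus sign turns the exponent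
      \<open>k\<close> into \<open>n = Suc k\<close>.\<close>
    finally have "(\<Oplus>\<^bsub>D\<^esub>U\<in>I n. ?c U V \<odot>\<^bsub>D\<^esub> u U) = \<ominus>\<^bsub>D\<^esub> ((- 1) ^ k \<odot>\<^bsub>D\<^esub> dmap D (u V))"
      using sum dV by (intro M.minus_equality[symmetric]) auto
    also have "\<dots> = (- 1) ^ n \<odot>\<^bsub>D\<^esub> dmap D (u V)" unfolding Suc by (rule sign_Suc[OF dV, symmetric])
    finally have eq: "(\<Oplus>\<^bsub>D\<^esub>U\<in>I n. ?c U V \<odot>\<^bsub>D\<^esub> u U) = (- 1) ^ n \<odot>\<^bsub>D\<^esub> dmap D (u V)" .
    have "(\<Oplus>\<^bsub>D\<^esub>U\<in>I n. ?s V \<odot>\<^bsub>D\<^esub> (?c U V \<odot>\<^bsub>D\<^esub> u U)) = ?s V \<odot>\<^bsub>D\<^esub> (\<Oplus>\<^bsub>D\<^esub>U\<in>I n. ?c U V \<odot>\<^bsub>D\<^esub> u U)"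
      by (rule finsum_smult_ldistr[symmetric]) (use sc[OF V] c cl in auto)
    also have "\<dots> = (- 1) ^ n \<odot>\<^bsub>D\<^esub> dmap D (?s V \<odot>\<^bsub>D\<^esub> u V)"
      unfolding eq mod_homD(3)[OF dmap_mod_hom sc[OF V] cl] using sc[OF V] dV
      by (simp add: smult_smult mult.commute)
    finally show "(\<Oplus>\<^bsub>D\<^esub>U\<in>I n. ?s V \<odot>\<^bsub>D\<^esub> (?c U V \<odot>\<^bsub>D\<^esub> u U)) = (- 1) ^ n \<odot>\<^bsub>D\<^esub> dmap D (?s V \<odot>\<^bsub>D\<^esub> u V)" .
  qed
  also have "\<dots> = (- 1) ^ n \<odot>\<^bsub>D\<^esub> (\<Oplus>\<^bsub>D\<^esub>V\<in>I k. dmap D (?s V \<odot>\<^bsub>D\<^esub> u V))"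
    by (rule finsum_smult_ldistr[symmetric]) (auto intro!: smult_closed dmap_closed sc cl)
  also have "(\<Oplus>\<^bsub>D\<^esub>V\<in>I k. dmap D (?s V \<odot>\<^bsub>D\<^esub> u V)) = dmap D (homotopy_map u S)"
    unfolding homotopy_map_Suc[OF S[unfolded Suc]]
    by (rule mod_hom_finsum[OF D_module D_module dmap_mod_hom, symmetric]) (auto intro!: smult_closed sc cl)
  finally show ?thesis .
qed

text \<open>The three terms of the homotopy formula at \<open>e_U\<close>, summed against
  \<open>u\<close>, give the entry of \<open>u\<close>, the Koszul part of
  \<open>kdiff (homotopy_map u)\<close>, and by \<open>homotopy_sum\<close> its remaining
  part.\<close>

lemma from_box_to_box:
  assumes u: "u \<in> carrier KD" "kdiff u = (\<lambda>_. \<zero>\<^bsub>D\<^esub>)"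
  shows "from_box (to_box u) = (\<lambda>S. u S \<oplus>\<^bsub>D\<^esub> kdiff (homotopy_map u) S)"
proof
  fix S
  note cl = KD_closed[OF u(1)]
  show "from_box (to_box u) S = u S \<oplus>\<^bsub>D\<^esub> kdiff (homotopy_map u) S"
  proof (cases "S \<subseteq> {..<d}")
    case False
    then show ?thesis using u(1) by (simp add: from_box_def kdiff_def fun_module_carrier)
  next
    case True
    define n where "n = card S"
    have S: "S \<in> I n" using True by (simp add: n_def in_I)
    let ?k = "\<lambda>U. koszul_diff d (s n (e U)) S"
    let ?r = "\<lambda>U. if n = 0 then 0 else s (n - 1) (koszul_diff d (e U)) S"
    have k: "?k U \<in> carrier R" if "U \<in> I n" for U
      by (rule koszul_carrierD[OF koszul_diff_closed[OF mod_homD(1)[OF s_hom e_closed[OF that]]]])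
    have r: "?r U \<in> carrier R" if "U \<in> I n" for U
    proof (cases n)
      case (Suc m)
      have "s m (koszul_diff d (e U)) \<in> carrier (koszul_module d (Suc m))"
        by (rule mod_homD(1)[OF s_hom koszul_diff_closed[OF e_closed[OF that[unfolded Suc]]]])
      then show ?thesis using Suc koszul_carrierD by auto
    qed simp
    have eS: "e U S \<in> carrier R" if "U \<in> I n" for U by (rule koszul_carrierD[OF e_closed[OF that]])
    have "from_box (to_box u) S = (\<Oplus>\<^bsub>D\<^esub>U\<in>I n. coord S (pure (int n) (f n (e U)) (u U)))"
      unfolding from_box_I[OF S] to_box_nat
      by (rule mod_hom_finsum[OF T_module D_module coord_hom[OF S]]) (auto intro!: pure_closed fe_closed cl)
    also have "\<dots> = (\<Oplus>\<^bsub>D\<^esub>U\<in>I n. e U S \<odot>\<^bsub>D\<^esub> u U \<oplus>\<^bsub>D\<^esub> (?k U \<odot>\<^bsub>D\<^esub> u U \<oplus>\<^bsub>D\<^esub> ?r U \<odot>\<^bsub>D\<^esub> u U))"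
    proof (rule M.finsum_cong'[OF refl])
      show "(\<lambda>U. e U S \<odot>\<^bsub>D\<^esub> u U \<oplus>\<^bsub>D\<^esub> (?k U \<odot>\<^bsub>D\<^esub> u U \<oplus>\<^bsub>D\<^esub> ?r U \<odot>\<^bsub>D\<^esub> u U)) \<in> I n \<rightarrow> carrier D"
        using eS k r cl by (intro Pi_I M.a_closed smult_closed) auto
      fix U assume U: "U \<in> I n"
      have "coord S (pure (int n) (f n (e U)) (u U)) = (e U S + ?k U + ?r U) \<odot>\<^bsub>D\<^esub> u U"
        unfolding coord_pure[OF S fe_closed[OF U] cl] homotopy[OF e_closed[OF U]] ..
      also have "\<dots> = (e U S \<odot>\<^bsub>D\<^esub> u U \<oplus>\<^bsub>D\<^esub> ?k U \<odot>\<^bsub>D\<^esub> u U) \<oplus>\<^bsub>D\<^esub> ?r U \<odot>\<^bsub>D\<^esub> u U"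
        using smult_l_distr[OF mpoly_carrier_intros(3)[OF eS[OF U] k[OF U]] r[OF U] cl, of U]
          smult_l_distr[OF eS[OF U] k[OF U] cl, of U] by (simp only: mpoly_ring_simps)
      also have "\<dots> = e U S \<odot>\<^bsub>D\<^esub> u U \<oplus>\<^bsub>D\<^esub> (?k U \<odot>\<^bsub>D\<^esub> u U \<oplus>\<^bsub>D\<^esub> ?r U \<odot>\<^bsub>D\<^esub> u U)"
        by (rule M.a_assoc) (intro smult_closed eS[OF U] k[OF U] r[OF U] cl)+
      finally show "coord S (pure (int n) (f n (e U)) (u U)) = e U S \<odot>\<^bsub>D\<^esub> u U \<oplus>\<^bsub>D\<^esub> (?k U \<odot>\<^bsub>D\<^esub> u U \<oplus>\<^bsub>D\<^esub> ?r U \<odot>\<^bsub>D\<^esub> u U)" .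
    qed
    also have "\<dots> = (\<Oplus>\<^bsub>D\<^esub>U\<in>I n. e U S \<odot>\<^bsub>D\<^esub> u U) \<oplus>\<^bsub>D\<^esub> (\<Oplus>\<^bsub>D\<^esub>U\<in>I n. ?k U \<odot>\<^bsub>D\<^esub> u U \<oplus>\<^bsub>D\<^esub> ?r U \<odot>\<^bsub>D\<^esub> u U)"
      by (rule M.finsum_addf) (intro Pi_I M.a_closed smult_closed eS k r cl; assumption)+
    also have "(\<Oplus>\<^bsub>D\<^esub>U\<in>I n. ?k U \<odot>\<^bsub>D\<^esub> u U \<oplus>\<^bsub>D\<^esub> ?r U \<odot>\<^bsub>D\<^esub> u U) =
        (\<Oplus>\<^bsub>D\<^esub>U\<in>I n. ?k U \<odot>\<^bsub>D\<^esub> u U) \<oplus>\<^bsub>D\<^esub> (\<Oplus>\<^bsub>D\<^esub>U\<in>I n. ?r U \<odot>\<^bsub>D\<^esub> u U)"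
      by (rule M.finsum_addf) (intro Pi_I smult_closed k r cl; assumption)+
    also have "(\<Oplus>\<^bsub>D\<^esub>U\<in>I n. ?r U \<odot>\<^bsub>D\<^esub> u U) = (- 1) ^ n \<odot>\<^bsub>D\<^esub> dmap D (homotopy_map u S)"
      by (rule homotopy_sum[OF u S])
    also have "(\<Oplus>\<^bsub>D\<^esub>U\<in>I n. e U S \<odot>\<^bsub>D\<^esub> u U) = (\<Oplus>\<^bsub>D\<^esub>U\<in>I n. if S = U then u U else \<zero>\<^bsub>D\<^esub>)"
      by (rule M.finsum_cong'[OF refl]) (use cl smult_one[OF cl] smult_l_null[OF cl] in \<open>auto simp: free_gen_def\<close>)
    also have "\<dots> = u S"
      by (rule M.finsum_singleton[OF S finite_subsets_of_card]) (use cl in auto)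
    also have "(\<Oplus>\<^bsub>D\<^esub>U\<in>I n. ?k U \<odot>\<^bsub>D\<^esub> u U) = (\<Oplus>\<^bsub>D\<^esub>i\<in>{..<d} - S. koszul_coeff i S \<odot>\<^bsub>D\<^esub> homotopy_map u (insert i S))"
    proof -
      have sc: "s n (e U) V \<in> carrier R" if "U \<in> I n" for U V by (rule s_closed[OF that])
      have "(\<Oplus>\<^bsub>D\<^esub>U\<in>I n. ?k U \<odot>\<^bsub>D\<^esub> u U) = (\<Oplus>\<^bsub>D\<^esub>U\<in>I n. \<Oplus>\<^bsub>D\<^esub>i\<in>{..<d} - S. koszul_coeff i S \<odot>\<^bsub>D\<^esub> (s n (e U) (insert i S) \<odot>\<^bsub>D\<^esub> u U))"
      proof (rule M.finsum_cong'[OF refl])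
        show "(\<lambda>U. \<Oplus>\<^bsub>D\<^esub>i\<in>{..<d} - S. koszul_coeff i S \<odot>\<^bsub>D\<^esub> (s n (e U) (insert i S) \<odot>\<^bsub>D\<^esub> u U)) \<in> I n \<rightarrow> carrier D"
          by (auto intro!: M.finsum_closed smult_closed sc cl koszul_coeff_closed)
        fix U assume U: "U \<in> I n"
        have "?k U = (\<Sum>i\<in>{..<d} - S. koszul_coeff i S * s n (e U) (insert i S))"
          using True by (simp add: koszul_diff_def)
        then have "?k U \<odot>\<^bsub>D\<^esub> u U = (\<Sum>i\<in>{..<d} - S. koszul_coeff i S * s n (e U) (insert i S)) \<odot>\<^bsub>D\<^esub> u U" by simp
        also have "\<dots> = (\<Oplus>\<^bsub>D\<^esub>i\<in>{..<d} - S. (koszul_coeff i S * s n (e U) (insert i S)) \<odot>\<^bsub>D\<^esub> u U)"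
          by (rule sum_smult_module[OF D_module cl]) (use sc[OF U] in auto)
        also have "\<dots> = (\<Oplus>\<^bsub>D\<^esub>i\<in>{..<d} - S. koszul_coeff i S \<odot>\<^bsub>D\<^esub> (s n (e U) (insert i S) \<odot>\<^bsub>D\<^esub> u U))"
          by (rule M.finsum_cong'[OF refl]) (use sc[OF U] cl in \<open>auto simp: smult_smult\<close>)
        finally show "?k U \<odot>\<^bsub>D\<^esub> u U = (\<Oplus>\<^bsub>D\<^esub>i\<in>{..<d} - S. koszul_coeff i S \<odot>\<^bsub>D\<^esub> (s n (e U) (insert i S) \<odot>\<^bsub>D\<^esub> u U))" .
      qed
      also have "\<dots> = (\<Oplus>\<^bsub>D\<^esub>i\<in>{..<d} - S. \<Oplus>\<^bsub>D\<^esub>U\<in>I n. koszul_coeff i S \<odot>\<^bsub>D\<^esub> (s n (e U) (insert i S) \<odot>\<^bsub>D\<^esub> u U))"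
        by (rule M.finsum_swap) (auto intro!: smult_closed sc cl koszul_coeff_closed)
      also have "\<dots> = (\<Oplus>\<^bsub>D\<^esub>i\<in>{..<d} - S. koszul_coeff i S \<odot>\<^bsub>D\<^esub> homotopy_map u (insert i S))"
      proof (rule M.finsum_cong'[OF refl])
        show "(\<lambda>i. koszul_coeff i S \<odot>\<^bsub>D\<^esub> homotopy_map u (insert i S)) \<in> {..<d} - S \<rightarrow> carrier D"
          using KD_closed[OF homotopy_map_closed[OF u(1)]] by auto
        fix i assume i: "i \<in> {..<d} - S"
        then have "insert i S \<in> I (Suc n)" using insert_subsets_of_card[OF True] by (simp add: n_def)
        from homotopy_map_Suc[OF this]
        show "(\<Oplus>\<^bsub>D\<^esub>U\<in>I n. koszul_coeff i S \<odot>\<^bsub>D\<^esub> (s n (e U) (insert i S) \<odot>\<^bsub>D\<^esub> u U)) = koszul_coeff i S \<odot>\<^bsub>D\<^esub> homotopy_map u (insert i S)"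
          by (simp only:) (rule finsum_smult_ldistr[symmetric], use i sc cl in auto)
      qed
      finally show ?thesis .
    qed
    finally show ?thesis using True by (simp add: kdiff_def n_def[symmetric])
  qed
qed

text \<open>If \<open>to_box u\<close> is the boundary of \<open>v\<close>, applying
  \<open>from_box\<close> shows that \<open>u\<close> is the boundary of
  \<open>from_box v - homotopy_map u\<close>. This is injectivity on homology.\<close>

lemma cycle_boundary:
  assumes u: "u \<in> carrier KD" "kdiff u = (\<lambda>_. \<zero>\<^bsub>D\<^esub>)"
    and v: "to_box u \<in> box_map d P D ` carrier (box d P D)"
  shows "u \<in> kdiff ` carrier KD"
proof -
  obtain v where v: "v \<in> carrier (box d P D)" "to_box u = box_map d P D v" using v by blast
  interpret KD: Module.module R KD by (rule KD_module)
  have h: "homotopy_map u \<in> carrier KD" by (rule homotopy_map_closed[OF u(1)])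
  have dh: "kdiff (homotopy_map u) \<in> carrier KD" by (rule mod_homD(1)[OF kdiff_hom h])
  have b: "from_box v \<in> carrier KD" by (rule from_box_closed[OF v(1)])
  have "kdiff (from_box v) = u \<oplus>\<^bsub>KD\<^esub> kdiff (homotopy_map u)"
    unfolding from_box_chain[OF v(1)] v(2)[symmetric] from_box_to_box[OF u] by simp
  then have "u = kdiff (from_box v) \<ominus>\<^bsub>KD\<^esub> kdiff (homotopy_map u)"
    using u(1) dh by (simp only: KD.minus_eq KD.a_assoc KD.r_neg KD.M.a_inv_closed KD.r_zero)
  also have "\<dots> = kdiff (from_box v \<ominus>\<^bsub>KD\<^esub> homotopy_map u)"
    by (rule mod_hom_minus[OF KD_module KD_module kdiff_hom b h, symmetric])
  finally have eq: "u = kdiff (from_box v \<ominus>\<^bsub>KD\<^esub> homotopy_map u)" .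
  have "from_box v \<ominus>\<^bsub>KD\<^esub> homotopy_map u \<in> carrier KD"
    unfolding KD.minus_eq using b h by (intro KD.M.a_closed KD.M.a_inv_closed)
  then have "kdiff (from_box v \<ominus>\<^bsub>KD\<^esub> homotopy_map u) \<in> kdiff ` carrier KD" by (rule imageI)
  then show ?thesis unfolding eq[symmetric] .
qed

section \<open>From degrees to the Betti number\<close>

text \<open>Project an element with boundary \<open>u\<close> to degree \<open>n\<close>: its
  boundary becomes \<open>c n\<close> times \<open>w n\<close>. If \<open>c n\<close> were nonzero,
  dividing by it would make \<open>w n\<close> a boundary within its degree.\<close>

lemma homogeneous_independent:
  assumes F: "finite F" "F \<subseteq> mdegs d"
    and w: "\<And>m. m \<in> F \<Longrightarrow> w m \<in> Khom d m" "\<And>m v. \<lbrakk>m \<in> F; v \<in> Khom d m\<rbrakk> \<Longrightarrow> kdiff v \<noteq> w m"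
    and u: "\<And>S. u S = (\<Oplus>\<^bsub>D\<^esub>m\<in>F. Poly_Mapping.single 0 (c m) \<odot>\<^bsub>D\<^esub> w m S)"
    and bd: "u \<in> kdiff ` carrier KD" and n: "n \<in> F"
  shows "c n = 0"
proof (rule ccontr)
  assume cn: "c n \<noteq> 0"
  obtain v where v: "v \<in> carrier KD" "u = kdiff v" using bd by blast
  have nd: "n \<in> mdegs d" using n F(2) by blast
  have const: "Poly_Mapping.single 0 a \<in> carrier R" for a :: 'k by simp
  have cwK: "(\<lambda>S. Poly_Mapping.single 0 (c m) \<odot>\<^bsub>D\<^esub> w m S) \<in> Khom d m" if "m \<in> F" for m
    by (rule Khom_const_smult[OF le_refl _ w(1)[OF that]]) (use that F(2) in blast)
  have cw: "Poly_Mapping.single 0 (c m) \<odot>\<^bsub>D\<^esub> w m S \<in> carrier D" if "m \<in> F" for m S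
    using KD_closed[OF Khom_KD[OF le_refl _ cwK[OF that]]] that F(2) by blast
  \<comment> \<open>Each summand is homogeneous of its own degree \<open>m\<close>, so only
    \<open>m = n\<close> contributes.\<close>
  have "Kcomponent n u S = Poly_Mapping.single 0 (c n) \<odot>\<^bsub>D\<^esub> w n S" for S
  proof -
    have "Kcomponent n u S = (\<Oplus>\<^bsub>D\<^esub>m\<in>F. component (n - set_deg S) (Poly_Mapping.single 0 (c m) \<odot>\<^bsub>D\<^esub> w m S))"
      unfolding Kcomponent_def u by (rule component_finsum[OF cw])
    also have "\<dots> = (\<Oplus>\<^bsub>D\<^esub>m\<in>F. if n = m then Poly_Mapping.single 0 (c m) \<odot>\<^bsub>D\<^esub> w m S else \<zero>\<^bsub>D\<^esub>)"
    proof (rule M.finsum_cong'[OF refl])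
      show "(\<lambda>m. if n = m then Poly_Mapping.single 0 (c m) \<odot>\<^bsub>D\<^esub> w m S else \<zero>\<^bsub>D\<^esub>) \<in> F \<rightarrow> carrier D"
        using cw by auto
      fix m assume m: "m \<in> F"
      then have md: "m \<in> mdegs d" using F(2) by blast
      show "component (n - set_deg S) (Poly_Mapping.single 0 (c m) \<odot>\<^bsub>D\<^esub> w m S) =
          (if n = m then Poly_Mapping.single 0 (c m) \<odot>\<^bsub>D\<^esub> w m S else \<zero>\<^bsub>D\<^esub>)"
      proof (cases "S \<subseteq> {..<d}")
        case True
        then have "Poly_Mapping.single 0 (c m) \<odot>\<^bsub>D\<^esub> w m S \<in> hcomp D (m - set_deg S)"
          using cwK[OF m] by (simp add: Khom_def)
        from component_homogeneous[OF mdegs_intros(2)[OF md set_deg_mdegs[OF True]] this, of "n - set_deg S"]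
        show ?thesis by simp
      next
        case False
        then have "Poly_Mapping.single 0 (c m) \<odot>\<^bsub>D\<^esub> w m S = \<zero>\<^bsub>D\<^esub>"
          using cwK[OF m] by (simp add: Khom_def)
        then show ?thesis by (simp add: component_zero)
      qed
    qed
    also have "\<dots> = Poly_Mapping.single 0 (c n) \<odot>\<^bsub>D\<^esub> w n S"
      by (rule M.finsum_singleton[OF n F(1)]) (use cw in auto)
    finally show ?thesis .
  qed
  then have cn_eq: "kdiff (Kcomponent n v) = (\<lambda>S. Poly_Mapping.single 0 (c n) \<odot>\<^bsub>D\<^esub> w n S)"
    unfolding Kcomponent_kdiff[OF v(1), symmetric] v(2)[symmetric] by (rule ext)
  let ?b = "\<lambda>S. Poly_Mapping.single 0 (inverse (c n)) \<odot>\<^bsub>D\<^esub> Kcomponent n v S"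
  have vK: "Kcomponent n v \<in> Khom d n" by (rule Kcomponent_Khom[OF nd v(1)])
  have wn: "w n S \<in> carrier D" for S using KD_closed[OF Khom_KD[OF le_refl nd w(1)[OF n]]] .
  have "kdiff ?b = (\<lambda>S. Poly_Mapping.single 0 (inverse (c n)) \<odot>\<^bsub>D\<^esub> (Poly_Mapping.single 0 (c n) \<odot>\<^bsub>D\<^esub> w n S))"
    unfolding kdiff_smult[OF const Khom_KD[OF le_refl nd vK]] cn_eq ..
  also have "\<dots> = w n"
  proof
    fix S
    have "Poly_Mapping.single 0 (inverse (c n)) \<odot>\<^bsub>D\<^esub> (Poly_Mapping.single 0 (c n) \<odot>\<^bsub>D\<^esub> w n S) =
        (Poly_Mapping.single 0 (inverse (c n)) * Poly_Mapping.single 0 (c n)) \<odot>\<^bsub>D\<^esub> w n S"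
      by (rule smult_smult[OF const const wn])
    also have "Poly_Mapping.single 0 (inverse (c n)) * Poly_Mapping.single 0 (c n) = (1 :: 'k mpol)"
      using cn by (simp add: mult_single)
    also have "1 \<odot>\<^bsub>D\<^esub> w n S = w n S" using smult_one[OF wn] by simp
    finally show "Poly_Mapping.single 0 (inverse (c n)) \<odot>\<^bsub>D\<^esub> (Poly_Mapping.single 0 (c n) \<odot>\<^bsub>D\<^esub> w n S) = w n S" .
  qed
  finally show False using w(2)[OF n Khom_const_smult[OF le_refl nd vK]] by blast
qed

text \<open>One nonbounding cycle is chosen in each degree of \<open>F\<close>. As
  \<open>vs_dim\<close> is an infimum over finite bases, it is enough to bound each of them; if
  there is none, the infimum is \<infinity>.\<close>

lemma betti_lower_bound:
  assumes F: "finite F" "F \<subseteq> Hdeg d"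
  shows "enat (card F) \<le> betti d P D"
proof -
  let ?V = "restrict_to_field (Tor d P D)"
  have sq: "\<forall>u\<in>carrier (box d P D). dmap (box d P D) (dmap (box d P D) u) = \<zero>\<^bsub>box d P D\<^esub>"
    unfolding box_simps(4) by (rule box_map_square)
  have bh: "dmap (box d P D) \<in> mod_hom R (box d P D) (box d P D)"
    unfolding box_simps(4) by (rule box_map_hom)
  note B = box_module bh sq
  have Tor: "Module.module R (Tor d P D)" unfolding Tor_def by (rule homology_module[OF B])
  have V: "Module.module field_ring ?V" by (rule restrict_to_field_module[OF Tor])
  \<comment> \<open>The cycles as a module of their own, so that passing to homology classes is a
    linear map defined on the whole module and commutes with finite sums.\<close>
  define Z where "Z = KD\<lparr>carrier := {u \<in> carrier KD. kdiff u = \<zero>\<^bsub>KD\<^esub>}\<rparr>"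
  have Z: "Module.module R Z"
    unfolding Z_def
    by (rule submodule.submodule_is_module[OF mod_hom_kernel_submodule[OF KD_module KD_module kdiff_hom] KD_module])
  have Z_carrier: "u \<in> carrier Z \<longleftrightarrow> u \<in> carrier KD \<and> kdiff u = (\<lambda>_. \<zero>\<^bsub>D\<^esub>)" for u by (simp add: Z_def)
  have Z_ops: "u \<oplus>\<^bsub>Z\<^esub> v = (\<lambda>S. u S \<oplus>\<^bsub>D\<^esub> v S)" "r \<odot>\<^bsub>Z\<^esub> u = (\<lambda>S. r \<odot>\<^bsub>D\<^esub> u S)" for u v r by (simp_all add: Z_def)
  interpret Z: Module.module R Z by (rule Z)
  let ?N = "dmap (box d P D) ` carrier (box d P D)"
  let ?\<Phi> = "\<lambda>u. ?N +>\<^bsub>cycle_module (box d P D)\<^esub> to_box u"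
  have cyc: "to_box \<in> mod_hom R Z (cycle_module (box d P D))"
  proof (rule mod_homI)
    show "to_box u \<in> carrier (cycle_module (box d P D))" if "u \<in> carrier Z" for u
    proof -
      have u: "u \<in> carrier KD" "kdiff u = \<zero>\<^bsub>KD\<^esub>" using that by (simp_all add: Z_carrier)
      then have "box_map d P D (to_box u) = \<zero>\<^bsub>box d P D\<^esub>"
        using to_box_chain[OF u(1)] mod_hom_zero[OF KD_module box_module to_box_hom] by simp
      then show ?thesis using mod_homD(1)[OF to_box_hom u(1)] unfolding cycle_module_simps dker_def box_simps(4) by blast
    qed
    show "to_box (u \<oplus>\<^bsub>Z\<^esub> v) = to_box u \<oplus>\<^bsub>cycle_module (box d P D)\<^esub> to_box v" if "u \<in> carrier Z" "v \<in> carrier Z" for u v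
      using mod_homD(2)[OF to_box_hom, of u v] that unfolding Z_carrier Z_ops cycle_module_simps fun_module_simps by blast
    show "to_box (r \<odot>\<^bsub>Z\<^esub> u) = r \<odot>\<^bsub>cycle_module (box d P D)\<^esub> to_box u" if "r \<in> carrier R" "u \<in> carrier Z" for r u
      using mod_homD(3)[OF to_box_hom, of r u] that unfolding Z_carrier Z_ops cycle_module_simps fun_module_simps by blast
  qed
  have \<Phi>: "?\<Phi> \<in> mod_hom R Z (Tor d P D)"
    unfolding Tor_def by (rule mod_hom_comp[OF cyc homology_proj[OF B]])
  have "\<exists>u. \<forall>m\<in>F. u m \<in> Khom d m \<and> kdiff (u m) = (\<lambda>_. \<zero>\<^bsub>D\<^esub>) \<and> (\<forall>v\<in>Khom d m. kdiff v \<noteq> u m)"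
    by (rule bchoice) (use F(2) in \<open>auto simp: Hdeg_def\<close>)
  then obtain w where w: "\<And>m. m \<in> F \<Longrightarrow> w m \<in> Khom d m" "\<And>m. m \<in> F \<Longrightarrow> kdiff (w m) = (\<lambda>_. \<zero>\<^bsub>D\<^esub>)"
    "\<And>m v. \<lbrakk>m \<in> F; v \<in> Khom d m\<rbrakk> \<Longrightarrow> kdiff v \<noteq> w m" by blast
  have Fd: "F \<subseteq> mdegs d" using F(2) by (auto simp: Hdeg_def)
  have wZ: "w m \<in> carrier Z" if "m \<in> F" for m
    unfolding Z_carrier using Khom_KD[OF le_refl _ w(1)[OF that]] w(2)[OF that] that Fd by blast
  have "card F \<le> card B" if B': "finite B" "module_basis field_ring ?V B" for B
  proof (rule dimension_bound[OF V B'(2,1) F(1)])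
    show "?\<Phi> (w m) \<in> carrier ?V" if "m \<in> F" for m
      using mod_homD(1)[OF \<Phi> wZ[OF that]] by simp
    fix c :: "mdeg \<Rightarrow> 'k" and n
    assume zero: "(\<Oplus>\<^bsub>?V\<^esub>m\<in>F. c m \<odot>\<^bsub>?V\<^esub> ?\<Phi> (w m)) = \<zero>\<^bsub>?V\<^esub>" and n: "n \<in> F"
    have const: "Poly_Mapping.single 0 a \<in> carrier R" for a :: 'k by simp
    define u where "u = (\<Oplus>\<^bsub>Z\<^esub>m\<in>F. Poly_Mapping.single 0 (c m) \<odot>\<^bsub>Z\<^esub> w m)"
    have cwZ: "(\<lambda>m. Poly_Mapping.single 0 (c m) \<odot>\<^bsub>Z\<^esub> w m) \<in> F \<rightarrow> carrier Z"
      using Z.smult_closed[OF const wZ] by blast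
    then have uZ: "u \<in> carrier Z" unfolding u_def by (rule Z.M.finsum_closed)
    have "?\<Phi> u = (\<Oplus>\<^bsub>Tor d P D\<^esub>m\<in>F. ?\<Phi> (Poly_Mapping.single 0 (c m) \<odot>\<^bsub>Z\<^esub> w m))"
      unfolding u_def by (rule mod_hom_finsum[OF Z Tor \<Phi> cwZ])
    also have "\<dots> = (\<Oplus>\<^bsub>Tor d P D\<^esub>m\<in>F. Poly_Mapping.single 0 (c m) \<odot>\<^bsub>Tor d P D\<^esub> ?\<Phi> (w m))"
    proof (rule abelian_monoid.finsum_cong'[OF abelian_group.axioms(1)[OF Module.module.axioms(2)[OF Tor]] refl])
      show "(\<lambda>m. Poly_Mapping.single 0 (c m) \<odot>\<^bsub>Tor d P D\<^esub> ?\<Phi> (w m)) \<in> F \<rightarrow> carrier (Tor d P D)"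
        using Module.module.smult_closed[OF Tor const mod_homD(1)[OF \<Phi> wZ]] by blast
      show "?\<Phi> (Poly_Mapping.single 0 (c m) \<odot>\<^bsub>Z\<^esub> w m) = Poly_Mapping.single 0 (c m) \<odot>\<^bsub>Tor d P D\<^esub> ?\<Phi> (w m)" if "m \<in> F" for m
        by (rule mod_homD(3)[OF \<Phi> const wZ[OF that]])
    qed
    \<comment> \<open>Field scalars act through constant polynomials, so this is the assumed
      relation over the field.\<close>
    also have "\<dots> = (\<Oplus>\<^bsub>?V\<^esub>m\<in>F. c m \<odot>\<^bsub>?V\<^esub> ?\<Phi> (w m))"
      unfolding restrict_to_field_simps by (rule finsum_struct_cong) simp_all
    also have "\<dots> = \<zero>\<^bsub>homology (box d P D)\<^esub>" using zero by (simp add: Tor_def)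
    finally have "to_box u \<in> ?N"
      using homology_class_eq_zero[OF B, of "to_box u"] mod_homD(1)[OF cyc uZ] unfolding cycle_module_simps by blast
    then have bd: "u \<in> kdiff ` carrier KD"
      using cycle_boundary uZ unfolding Z_carrier box_simps(4) by blast
    have eval: "(\<lambda>u. u S) \<in> mod_hom R Z D" for S
      by (rule mod_homI) (simp_all add: Z_carrier Z_ops KD_closed)
    have uS: "u S = (\<Oplus>\<^bsub>D\<^esub>m\<in>F. Poly_Mapping.single 0 (c m) \<odot>\<^bsub>D\<^esub> w m S)" for S
      using mod_hom_finsum[OF Z D_module eval cwZ] unfolding u_def Z_ops .
    show "c n = 0" by (rule homogeneous_independent[OF F(1) Fd w(1,3) uS bd n])
  qed
  then show ?thesis unfolding betti_def vs_dim_def by (intro INF_greatest) auto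
qed

end

theorem theorem6p4:
  fixes d :: nat
    and D :: "('k::field mpol, 'm) graded_diff_module"
    and P :: "('k mpol, 'p) graded_complex"
  assumes "graded_diff_module d D"
    and "ddeg D = 0"
    and "carrier (homology D) \<noteq> {\<zero>\<^bsub>homology D\<^esub>}"
    and "\<forall>i<d. bounded_in_direction d (homology D) i"
    and "graded_free_resolution d P (residue_module d :: ('k mpol, 'k mpol set) graded_module)"
  shows "betti d P D \<ge> 2 ^ d"
proof -
  interpret P: graded_free_resolution d P "residue_module d :: ('k mpol, 'k mpol set) graded_module" by fact
  interpret koszul_box d D P
    by (intro koszul_box.intro koszul_tensor.intro koszul_tensor_axioms.intro koszul_box_axioms.intro
        assms P.graded_complex_axioms P.cobj_neg)
  have eq: "int n + 1 = int (Suc n)" for n by simp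
  show ?thesis
  proof (rule koszul_comparison[OF assms(5)])
    fix f :: "nat \<Rightarrow> (nat set \<Rightarrow> 'k mpol) \<Rightarrow> 'p" and g :: "nat \<Rightarrow> 'p \<Rightarrow> nat set \<Rightarrow> 'k mpol"
      and s :: "nat \<Rightarrow> (nat set \<Rightarrow> 'k mpol) \<Rightarrow> nat set \<Rightarrow> 'k mpol"
    assume f: "\<And>n. f n \<in> mod_hom (mpoly_ring d) (koszul_module d n) (cobj P (int n))"
        "\<And>n x. x \<in> carrier (koszul_module d (Suc n)) \<Longrightarrow> cdiff P (int (Suc n)) (f (Suc n) x) = f n (koszul_diff d x)"
      and g: "\<And>n. g n \<in> mod_hom (mpoly_ring d) (cobj P (int n)) (koszul_module d n)"
        "\<And>n x. x \<in> carrier (cobj P (int (Suc n))) \<Longrightarrow> koszul_diff d (g (Suc n) x) = g n (cdiff P (int (Suc n)) x)"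
      and s: "\<And>n. s n \<in> mod_hom (mpoly_ring d) (koszul_module d n) (koszul_module d (Suc n))"
        "\<And>n x T. x \<in> carrier (koszul_module d n) \<Longrightarrow>
          g n (f n x) T = x T + koszul_diff d (s n x) T + (if n = 0 then 0 else s (n - 1) (koszul_diff d x) T)"
    interpret koszul_resolution d D P f g s
      by (rule koszul_resolution.intro[OF koszul_box_axioms], rule koszul_resolution_axioms.intro, unfold eq)
        (rule f(1), erule f(2), rule g(1), erule g(2), rule s(1), erule s(2))
    obtain F where F: "F \<subseteq> Hdeg d" "finite F" "card F = 2 ^ d" using Hdeg_count[OF assms(3,4)] by blast
    have "(2 :: enat) ^ d = enat (2 ^ d)" by (induction d) (simp_all add: one_enat_def numeral_eq_enat)
    then show "2 ^ d \<le> betti d P D" using betti_lower_bound[OF F(2,1)] F(3) by simp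
  qed
qed

end
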